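(* Let $K$ be a field, let $m\ge 1$, let $G$ be the graph consisting of $m$ disjoint edges (on $2m$ vertices), and let $I=I(G)$ be the edge ideal of $G$ over $K$. Then $\operatorname{reg}R(I)=0$ if $m=1$, and $\operatorname{reg}R(I)\ge m$ if $m>1$.
   Context: Let $G$ be a finite simple graph with $V(G)=[n]=\{1,\dots,n\}$ and edge set $E(G)$, and let $S=K[x_1,\dots,x_n]$ be the polynomial ring over a field $K$. The edge ideal $I(G)\subset S$ is the ideal generated by the monomials $x_ix_j$ with $\{i,j\}\in E(G)$. The edge ring $K[G]$ of a graph $G$ is the $K$-algebra generated by the monomials $x_ix_j$ with $\{i,j\}\in E(G)$. The Rees algebra of an ideal $I$ is $R(I)=\bigoplus_{s\ge 0}I^s$. $G^*$ denotes the graph with $V(G^* )=[n+1]$ and $E(G^* )=E(G)\cup\{\{i,n+1\}: i\in V(G)\}$. The Rees algebra $R(I(G))$ is identified with the edge ring $K[G^*]$, the monomial $x_ix_{n+1}$ corresponding to $x_i\in S$ (in Rees degree $0$) and $x_ix_j$, for $\{i,j\}\in E(G)$, corresponding to the generator $x_ix_j\in I(G)$ (in Rees degree $1$). Through this identification $R(I(G))$ is a standard graded $K$-algebra, each of the $n+|E(G)|$ monomial generators having degree $1$. For a standard graded toric $K$-algebra $A$ minimally generated by monomials $u_1,\dots,u_r$, let $P=K[t_1,\dots,t_r]$ be the standard graded polynomial ring, mapping onto $A$ by $t_k\mapsto u_k$; put $\beta_{i,j}(A)=\dim_K\operatorname{Tor}_i^P(A,K)_j$ and $\operatorname{reg}A=\max\{j-i:\beta_{i,j}(A)\ne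 0\}$ (Castelnuovo–Mumford regularity). *)

theory Defs
  imports
    "HOL-Library.Poly_Mapping"
    "HOL-Library.Function_Algebras"
    "HOL-Library.Extended_Real"
    "HOL-Computational_Algebra.Polynomial"
begin

section \<open>Multivariate polynomials\<close>

text \<open>
  A polynomial is a finitely supported map from monomials (exponent vectors) to coefficients;
  multiplication on \<^typ>\<open>('x \<Rightarrow>\<^sub>0 nat) \<Rightarrow>\<^sub>0 'k\<close> is convolution. The ring \<open>K[X]\<close> for a finite
  set \<open>X\<close> of variables is the subring \<open>polys X\<close>.
\<close>

type_synonym ('x, 'k) mpoly = "('x \<Rightarrow>\<^sub>0 nat) \<Rightarrow>\<^sub>0 'k"

definition Const :: "'k \<Rightarrow> ('x, 'k::zero) mpoly" where
  "Const a = Poly_Mapping.single 0 a"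

definition Var :: "'x \<Rightarrow> ('x, 'k::zero_neq_one) mpoly" where
  "Var x = Poly_Mapping.single (Poly_Mapping.single x 1) 1"

definition polys :: "'x set \<Rightarrow> ('x, 'k::zero) mpoly set" where
  "polys X = {p. \<forall>\<mu>\<in>Poly_Mapping.keys p. Poly_Mapping.keys \<mu> \<subseteq> X}"

definition mdeg :: "('x \<Rightarrow>\<^sub>0 nat) \<Rightarrow> nat" where
  "mdeg \<mu> = (\<Sum>x\<in>Poly_Mapping.keys \<mu>. Poly_Mapping.lookup \<mu> x)"

text \<open>The homogeneous component \<open>K[X]\<^sub>j\<close>, which is zero for negative \<open>j\<close>.\<close>

definition poly_piece :: "'x set \<Rightarrow> int \<Rightarrow> ('x, 'k::zero) mpoly set" where
  "poly_piece X j = {p \<in> polys X. \<forall>\<mu>\<in>Poly_Mapping.keys p. int (mdeg \<mu>) = j}"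

text \<open>Substitution \<open>x \<mapsto> u x\<close> along a homomorphism \<open>c\<close> of the coefficients.\<close>

definition subst_poly ::
  "('k::zero \<Rightarrow> 'a::comm_ring_1) \<Rightarrow> ('x \<Rightarrow> 'a) \<Rightarrow> ('x, 'k) mpoly \<Rightarrow> 'a" where
  "subst_poly c u p =
     (\<Sum>\<mu>\<in>Poly_Mapping.keys p. c (Poly_Mapping.lookup p \<mu>) *
        (\<Prod>x\<in>Poly_Mapping.keys \<mu>. u x ^ Poly_Mapping.lookup \<mu> x))"


section \<open>Graded free resolutions and Tor\<close>

text \<open>
  Throughout, \<open>P = K[X]\<close> carries the standard grading. A graded \<open>P\<close>-module is given by its
  homogeneous components \<open>M :: int \<Rightarrow> 'a set\<close> inside an ambient abelian group and the action
  \<open>act\<close> of polynomials. A complex \<open>\<dots> \<rightarrow> G\<^sub>1 \<rightarrow> G\<^sub>0 \<rightarrow> N \<rightarrow> 0\<close> of finitely generated graded free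
  \<open>P\<close>-modules over a module \<open>N\<close> is recorded by the ranks of the \<open>G\<^sub>i\<close>, the degrees of their basis
  elements (\<open>G\<^sub>i = \<Oplus>\<^sub>a P(-fc_shift i a)\<close> with \<open>a < fc_rank i\<close>), the matrices of the differentials
  \<open>G\<^sub>i\<^sub>+\<^sub>1 \<rightarrow> G\<^sub>i\<close> (the basis element \<open>b\<close> is sent to \<open>\<Sum>\<^sub>a fc_mat i a b \<cdot> a\<close>), and the images in \<open>N\<close>
  of the basis elements of \<open>G\<^sub>0\<close>.
\<close>

record (overloaded) ('x, 'k::zero, 'n) free_complex =
  fc_rank  :: "nat \<Rightarrow> nat"
  fc_shift :: "nat \<Rightarrow> nat \<Rightarrow> int"
  fc_mat   :: "nat \<Rightarrow> nat \<Rightarrow> nat \<Rightarrow> ('x, 'k) mpoly"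
  fc_aug   :: "nat \<Rightarrow> 'n"

text \<open>
  \<open>(M \<otimes>\<^sub>P G\<^sub>i)\<^sub>j = \<Oplus>\<^sub>a M\<^sub>j\<^sub>-\<^sub>d\<close> with \<open>d = fc_shift i a\<close>, and the differential
  \<open>M \<otimes>\<^sub>P G\<^sub>i\<^sub>+\<^sub>1 \<rightarrow> M \<otimes>\<^sub>P G\<^sub>i\<close>. For \<open>M = P\<close> acting on itself by multiplication this is the complex
  \<open>G\<close> itself.
\<close>

definition tensor_piece ::
  "(int \<Rightarrow> 'a::zero set) \<Rightarrow> ('x, 'k::zero, 'n) free_complex \<Rightarrow> nat \<Rightarrow> int \<Rightarrow> (nat \<Rightarrow> 'a) set" where
  "tensor_piece M G i j =
     {v. (\<forall>a < fc_rank G i. v a \<in> M (j - fc_shift G i a)) \<and> (\<forall>a \<ge> fc_rank G i. v a = 0)}"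

definition tensor_diff ::
  "(('x, 'k::zero) mpoly \<Rightarrow> 'a::comm_monoid_add \<Rightarrow> 'a) \<Rightarrow> ('x, 'k, 'n) free_complex \<Rightarrow> nat
     \<Rightarrow> (nat \<Rightarrow> 'a) \<Rightarrow> (nat \<Rightarrow> 'a)" where
  "tensor_diff act G i v =
     (\<lambda>a. if a < fc_rank G i then \<Sum>b < fc_rank G (Suc i). act (fc_mat G i a b) (v b) else 0)"

definition augmentation ::
  "(('x, 'k::zero) mpoly \<Rightarrow> 'n::comm_monoid_add \<Rightarrow> 'n) \<Rightarrow> ('x, 'k, 'n) free_complex
     \<Rightarrow> (nat \<Rightarrow> ('x, 'k) mpoly) \<Rightarrow> 'n" where
  "augmentation act G v = (\<Sum>a < fc_rank G 0. act (v a) (fc_aug G a))"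

text \<open>Exactness of a complex of graded modules is exactness in every degree \<open>j\<close>.\<close>

definition graded_free_resolution ::
  "'x set \<Rightarrow> (('x, 'k::comm_ring_1) mpoly \<Rightarrow> 'n::comm_monoid_add \<Rightarrow> 'n) \<Rightarrow> (int \<Rightarrow> 'n set)
     \<Rightarrow> ('x, 'k, 'n) free_complex \<Rightarrow> bool" where
  "graded_free_resolution X act N G \<longleftrightarrow>
     (\<forall>i. \<forall>a < fc_rank G i. \<forall>b < fc_rank G (Suc i).
        fc_mat G i a b \<in> poly_piece X (fc_shift G (Suc i) b - fc_shift G i a)) \<and>
     (\<forall>a < fc_rank G 0. fc_aug G a \<in> N (fc_shift G 0 a)) \<and>
     (\<forall>j. augmentation act G ` tensor_piece (poly_piece X) G 0 j = N j) \<and>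
     (\<forall>j. {v \<in> tensor_piece (poly_piece X) G 0 j. augmentation act G v = 0} =
          tensor_diff (*) G 0 ` tensor_piece (poly_piece X) G 1 j) \<and>
     (\<forall>i j. {v \<in> tensor_piece (poly_piece X) G (Suc i) j. tensor_diff (*) G i v = 0} =
          tensor_diff (*) G (Suc i) ` tensor_piece (poly_piece X) G (Suc (Suc i)) j)"

text \<open>The residue field \<open>K = P/(X)\<close>, concentrated in degree \<open>0\<close>.\<close>

definition residue_piece :: "int \<Rightarrow> 'k::zero set" where
  "residue_piece j = (if j = 0 then UNIV else {0})"

definition residue_act :: "('x, 'k::comm_ring_1) mpoly \<Rightarrow> 'k \<Rightarrow> 'k" where
  "residue_act p x = Poly_Mapping.lookup p 0 * x"

text \<open>
  \<open>Tor\<^sub>i\<^sup>P(M, -)\<close> is the \<open>i\<close>-th left derived functor of \<open>M \<otimes>\<^sub>P -\<close>, so \<open>Tor\<^sub>i\<^sup>P(M, K)\<^sub>j\<close> is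
  \<open>tor_cycles / tor_boundaries\<close> for a graded free resolution of \<open>K\<close>. One is chosen here; up to
  isomorphism the result does not depend on the choice. For finite \<open>X\<close> the field \<open>K\<close> has a
  resolution by finitely generated free modules, as required by \<open>free_complex\<close>.
\<close>

definition residue_resolution :: "'x set \<Rightarrow> ('x, 'k::comm_ring_1, 'k) free_complex" where
  "residue_resolution X = (SOME G. graded_free_resolution X residue_act residue_piece G)"

definition tor_cycles ::
  "'x set \<Rightarrow> (('x, 'k::comm_ring_1) mpoly \<Rightarrow> 'a::comm_monoid_add \<Rightarrow> 'a) \<Rightarrow> (int \<Rightarrow> 'a set)
     \<Rightarrow> nat \<Rightarrow> int \<Rightarrow> (nat \<Rightarrow> 'a) set" where
  "tor_cycles X act M i j =
     {v \<in> tensor_piece M (residue_resolution X :: ('x, 'k, 'k) free_complex) i j.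
        i > 0 \<longrightarrow> tensor_diff act (residue_resolution X) (i - 1) v = 0}"

definition tor_boundaries ::
  "'x set \<Rightarrow> (('x, 'k::comm_ring_1) mpoly \<Rightarrow> 'a::comm_monoid_add \<Rightarrow> 'a) \<Rightarrow> (int \<Rightarrow> 'a set)
     \<Rightarrow> nat \<Rightarrow> int \<Rightarrow> (nat \<Rightarrow> 'a) set" where
  "tor_boundaries X act M i j =
     tensor_diff act (residue_resolution X) i `
       tensor_piece M (residue_resolution X :: ('x, 'k, 'k) free_complex) (Suc i) j"

text \<open>
  \<open>\<beta>\<^sub>i\<^sub>j(M) = dim\<^sub>K Tor\<^sub>i\<^sup>P(M, K)\<^sub>j\<close>. The dimension of the quotient is a difference of dimensions
  because the components of a finitely generated graded module are finite-dimensional.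
\<close>

definition betti ::
  "'x set \<Rightarrow> (('x, 'k::field) mpoly \<Rightarrow> 'a::ab_group_add \<Rightarrow> 'a) \<Rightarrow> (int \<Rightarrow> 'a set)
     \<Rightarrow> nat \<Rightarrow> int \<Rightarrow> nat" where
  "betti X act M i j =
     (let scale = (\<lambda>(c::'k) (v::nat \<Rightarrow> 'a) a. act (Const c) (v a))
      in vector_space.dim scale (tor_cycles X act M i j)
         - vector_space.dim scale (tor_boundaries X act M i j))"

text \<open>
  Castelnuovo--Mumford regularity. The supremum is taken in the extended reals; for a nonzero
  finitely generated module it is the maximum of a finite nonempty set.
\<close>

definition regularity ::
  "'x set \<Rightarrow> (('x, 'k::field) mpoly \<Rightarrow> 'a::ab_group_add \<Rightarrow> 'a) \<Rightarrow> (int \<Rightarrow> 'a set) \<Rightarrow> ereal" where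
  "regularity X act M =
     Sup {ereal (real_of_int (j - int i)) | i j. betti X act M i j \<noteq> 0}"


section \<open>Edge ideals and their Rees algebras\<close>

text \<open>\<open>E\<close> is the edge set of a finite simple graph on the vertex set \<open>{1..n}\<close>.\<close>

definition simple_graph :: "nat \<Rightarrow> nat set set \<Rightarrow> bool" where
  "simple_graph n E \<longleftrightarrow> (\<forall>e\<in>E. e \<subseteq> {1..n} \<and> card e = 2)"

definition ideal_generated ::
  "'a::comm_ring_1 set \<Rightarrow> 'a set \<Rightarrow> 'a set" where
  "ideal_generated R B = {\<Sum>b\<in>F. r b * b | F r. finite F \<and> F \<subseteq> B \<and> (\<forall>b\<in>F. r b \<in> R)}"

primrec ideal_power :: "'a::comm_ring_1 set \<Rightarrow> 'a set \<Rightarrow> nat \<Rightarrow> 'a set" where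
  "ideal_power R I 0 = R"
| "ideal_power R I (Suc s) = ideal_generated R {a * b | a b. a \<in> I \<and> b \<in> ideal_power R I s}"

definition edge_ideal :: "nat \<Rightarrow> nat set set \<Rightarrow> (nat, 'k::comm_ring_1) mpoly set" where
  "edge_ideal n E = ideal_generated (polys {1..n}) {\<Prod>i\<in>e. Var i | e. e \<in> E}"

text \<open>\<open>R(I) = \<Oplus>\<^sub>s I\<^sup>s T\<^sup>s\<close> inside \<open>S[T]\<close>, where \<open>S = K[x\<^sub>1, \<dots>, x\<^sub>n]\<close>.\<close>

definition rees_algebra ::
  "nat \<Rightarrow> (nat, 'k::comm_ring_1) mpoly set \<Rightarrow> (nat, 'k) mpoly poly set" where
  "rees_algebra n I = {f. \<forall>s. coeff f s \<in> ideal_power (polys {1..n}) I s}"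

text \<open>
  The identification of \<open>R(I(G))\<close> with the edge ring of the cone \<open>G\<^sup>*\<close> makes \<open>R(I(G))\<close> an algebra
  over \<open>P = K[t\<^sub>e | e \<in> E(G\<^sup>*)]\<close>: the variable \<open>t\<^sub>e\<close> acts as \<open>x\<^sub>i\<close> if \<open>e = {i, n+1}\<close> and as
  \<open>x\<^sub>i x\<^sub>j T\<close> if \<open>e = {i, j}\<close> is an edge of \<open>G\<close>.
\<close>

definition cone_edges :: "nat \<Rightarrow> nat set set \<Rightarrow> nat set set" where
  "cone_edges n E = E \<union> {{i, n + 1} | i. i \<in> {1..n}}"

definition rees_gen :: "nat \<Rightarrow> nat set \<Rightarrow> (nat, 'k::comm_ring_1) mpoly poly" where
  "rees_gen n e = monom (\<Prod>i\<in>e - {n + 1}. Var i) (if n + 1 \<in> e then 0 else 1)"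

definition rees_act ::
  "nat \<Rightarrow> (nat set, 'k::comm_ring_1) mpoly \<Rightarrow> (nat, 'k) mpoly poly \<Rightarrow> (nat, 'k) mpoly poly" where
  "rees_act n p f = subst_poly (\<lambda>c. [:Const c:]) (rees_gen n) p * f"

text \<open>
  The grading of \<open>R(I)\<close> for which all these generators have degree \<open>1\<close>: since \<open>x\<^sub>i\<close> and
  \<open>x\<^sub>i x\<^sub>j T\<close> both have degree \<open>1\<close>, the variable \<open>T\<close> counts \<open>-1\<close>, and \<open>f T\<^sup>s\<close> with \<open>f \<in> I\<^sup>s\<close>
  homogeneous has degree \<open>deg f - s\<close>.
\<close>

definition rees_piece ::
  "nat \<Rightarrow> (nat, 'k::comm_ring_1) mpoly set \<Rightarrow> int \<Rightarrow> (nat, 'k) mpoly poly set" where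
  "rees_piece n I j = {f \<in> rees_algebra n I. \<forall>s. coeff f s \<in> poly_piece {1..n} (j + int s)}"

end

theory Submission
  imports Defs
begin

text \<open>
  Let \<open>q\<^sub>e\<close> be the product of the two variables of an edge \<open>e\<close>. Over \<open>P\<close>, the Rees algebra of \<open>m\<close>
  disjoint edges has the relations \<open>t\<^sub>e q\<^sub>f = t\<^sub>f q\<^sub>e\<close>, the \<open>2\<close>-minors of a \<open>2 \<times> m\<close> matrix with rows
  of degrees \<open>1\<close> and \<open>2\<close>. Its Eagon--Northcott resolution suggests where to look for a large
  degree: in homological position \<open>m - 1\<close> and degree \<open>2m - 1\<close>, in the multidegree of
  \<open>\<alpha> = x\<^sub>1 \<cdots> x\<^sub>2\<^sub>m T\<close>. For the lower bound one nonzero class in that place is enough, and it can be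
  written down in the Koszul complex without constructing that resolution.

  Choose a vertex \<open>a\<^sub>e\<close> of every edge and call the other one \<open>b\<^sub>e\<close>. Let \<open>A\<close> be the set of the
  variables \<open>x\<^bsub>a\<^sub>e\<^esub>\<close>, and \<open>w\<close> the product of all \<open>x\<^bsub>b\<^sub>e\<^esub>\<close>. The element \<open>w T\<close> is not in the Rees algebra,
  but \<open>x\<^bsub>a\<^sub>e\<^esub> w T\<close> is, because the factor \<open>x\<^bsub>a\<^sub>e\<^esub> x\<^bsub>b\<^sub>e\<^esub>\<close> of it lies in \<open>I\<close>. Hence the Koszul boundary of
  \<open>w T \<otimes> e\<^sub>A\<close> is a cycle over the Rees algebra that does not look like a boundary over it. To see that
  it is none, consider the faces \<open>F\<close> for which \<open>\<alpha>\<close> divided by the generators in \<open>F\<close> stays in the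
  Rees algebra. They form a simplicial complex with the homotopy type of the sphere that bounds
  the simplex on the vertex set \<open>E\<close>: a colouring of the generators by edges, under which \<open>x\<^sub>i\<close> goes to
  the edge containing \<open>i\<close> and \<open>t\<^sub>e\<close> to some other edge than \<open>e\<close>, maps each such face to a proper subset
  of \<open>E\<close> (\<open>top_coeff_vanishes\<close>). The pull-back of the fundamental cocycle of the sphere vanishes
  on boundaries (\<open>pulled_back_cocycle\<close>), but it is \<open>\<plusminus>1\<close> on the cycle (\<open>regularity_ge_card\<close>).

  Tor is computed from an unspecified resolution of \<open>K\<close>, so a class in the Koszul complex must be
  transported to it. The Koszul complex is a resolution (\<open>koszul_resolution\<close>), which also shows that
  the unspecified choice is a resolution at all, and it is linear. By the comparison theorem
  there are chain maps in both directions, and for a linear resolution the composite is forced to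
  be the identity (\<open>chain_endomorphism_linear\<close>); so nonzero classes survive.

  For \<open>m = 1\<close> the Rees algebra is a polynomial ring, free of rank one over \<open>P\<close>, and the only Betti
  number that is not zero is \<open>\<beta>\<^sub>0\<^sub>0\<close> (\<open>regularity_free_module\<close>).
\<close>

section \<open>Monomials, homogeneous components and substitution\<close>

lemma lookup_single_mult_shift:
  fixes p :: "('x, 'k::semiring_0) mpoly"
  shows "Poly_Mapping.lookup (Poly_Mapping.single \<nu> a * p) (\<nu> + \<mu>) = a * Poly_Mapping.lookup p \<mu>"
proof -
  have "Poly_Mapping.lookup (Poly_Mapping.single \<nu> a * p) (\<nu> + \<mu>) =
      (\<Sum>l. Poly_Mapping.lookup (Poly_Mapping.single \<nu> a) l
        * (\<Sum>q. Poly_Mapping.lookup p q when \<nu> + \<mu> = l + q))"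
    by (simp add: lookup_mult)
  also have "\<dots> = (\<Sum>l. a * (\<Sum>q. Poly_Mapping.lookup p q when \<nu> + \<mu> = \<nu> + q) when l = \<nu>)"
    by (rule Sum_any.cong) (simp add: lookup_single when_def)
  also have "\<dots> = a * (\<Sum>q. Poly_Mapping.lookup p q when \<mu> = q)"
    by simp
  finally show ?thesis by simp
qed

lemma lookup_single_mult_eq_0:
  fixes p :: "('x, 'k::semiring_0) mpoly"
  assumes "\<And>\<rho>. \<mu> \<noteq> \<nu> + \<rho>"
  shows "Poly_Mapping.lookup (Poly_Mapping.single \<nu> a * p) \<mu> = 0"
proof -
  have "Poly_Mapping.lookup (Poly_Mapping.single \<nu> a * p) \<mu> =
      (\<Sum>l. Poly_Mapping.lookup (Poly_Mapping.single \<nu> a) l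
        * (\<Sum>q. Poly_Mapping.lookup p q when \<mu> = l + q))"
    by (simp add: lookup_mult)
  also have "\<dots> = (\<Sum>l. a * (\<Sum>q. Poly_Mapping.lookup p q when \<mu> = \<nu> + q) when l = \<nu>)"
    by (rule Sum_any.cong) (simp add: lookup_single when_def)
  also have "\<dots> = 0"
    using assms by simp
  finally show ?thesis .
qed

lemma lookup_Var_times:
  fixes p :: "('x, 'k::comm_ring_1) mpoly"
  shows "Poly_Mapping.lookup (Var x * p) \<mu> =
    (if Poly_Mapping.lookup \<mu> x = 0 then 0 else Poly_Mapping.lookup p (\<mu> - Poly_Mapping.single x 1))"
proof (cases "Poly_Mapping.lookup \<mu> x = 0")
  case True
  have "\<mu> \<noteq> Poly_Mapping.single x 1 + \<rho>" for \<rho>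
    using True by (auto simp: lookup_add)
  then show ?thesis
    using True by (simp add: Var_def lookup_single_mult_eq_0)
next
  case False
  have "\<mu> = Poly_Mapping.single x 1 + (\<mu> - Poly_Mapping.single x 1)"
    using False by (intro poly_mapping_eqI) (auto simp: lookup_add lookup_minus lookup_single when_def)
  then show ?thesis
    using False lookup_single_mult_shift[of "Poly_Mapping.single x 1" 1 p "\<mu> - Poly_Mapping.single x 1"]
    by (simp add: Var_def)
qed

lemma poly_mapping_sum_single:
  "p = (\<Sum>\<mu>\<in>Poly_Mapping.keys p. Poly_Mapping.single \<mu> (Poly_Mapping.lookup p \<mu>))"
  by (intro poly_mapping_eqI) (auto simp: lookup_sum lookup_single when_def sum.delta not_in_keys_iff_lookup_eq_zero)

lemma mdeg_superset:
  assumes "finite A" "Poly_Mapping.keys \<mu> \<subseteq> A"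
  shows "mdeg \<mu> = (\<Sum>x\<in>A. Poly_Mapping.lookup \<mu> x)"
  unfolding mdeg_def
  by (rule sum.mono_neutral_left) (use assms in \<open>auto simp: not_in_keys_iff_lookup_eq_zero\<close>)

lemma keys_add_nat: "Poly_Mapping.keys (\<mu> + \<nu> :: 'x \<Rightarrow>\<^sub>0 nat) = Poly_Mapping.keys \<mu> \<union> Poly_Mapping.keys \<nu>"
  by (auto simp: in_keys_iff lookup_add)

lemma mdeg_add: "mdeg (\<mu> + \<nu>) = mdeg \<mu> + mdeg \<nu>"
proof -
  let ?A = "Poly_Mapping.keys \<mu> \<union> Poly_Mapping.keys \<nu>"
  have "mdeg (\<mu> + \<nu>) = (\<Sum>x\<in>?A. Poly_Mapping.lookup (\<mu> + \<nu>) x)"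
    by (rule mdeg_superset) (auto simp: keys_add_nat)
  also have "\<dots> = mdeg \<mu> + mdeg \<nu>"
    by (simp add: lookup_add sum.distrib mdeg_superset[of ?A])
  finally show ?thesis .
qed

lemma mdeg_0 [simp]: "mdeg 0 = 0"
  by (simp add: mdeg_def)

lemma mdeg_single [simp]: "mdeg (Poly_Mapping.single x a) = a"
  by (simp add: mdeg_def)

lemma mdeg_eq_0: "mdeg \<mu> = 0 \<Longrightarrow> \<mu> = 0"
  by (intro poly_mapping_eqI) (metis finite_keys in_keys_iff lookup_zero mdeg_def sum_eq_0_iff)

text \<open>Written as a condition on each coefficient, membership reduces the closure properties of
  \<open>poly_piece\<close> to statements about single monomials.\<close>

lemma poly_piece_iff:
  "p \<in> poly_piece X d \<longleftrightarrow>
    (\<forall>\<mu>. Poly_Mapping.lookup p \<mu> \<noteq> 0 \<longrightarrow> Poly_Mapping.keys \<mu> \<subseteq> X \<and> int (mdeg \<mu>) = d)"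
  by (auto simp: poly_piece_def polys_def in_keys_iff)

lemma poly_piece_0 [simp]: "0 \<in> poly_piece X d"
  by (simp add: poly_piece_iff)

lemma poly_piece_add: "p \<in> poly_piece X d \<Longrightarrow> q \<in> poly_piece X d \<Longrightarrow> p + q \<in> poly_piece X d"
  unfolding poly_piece_iff lookup_add by (metis add.right_neutral add_0)

lemma poly_piece_diff:
  fixes p :: "('x, 'k::ab_group_add) mpoly"
  shows "p \<in> poly_piece X d \<Longrightarrow> q \<in> poly_piece X d \<Longrightarrow> p - q \<in> poly_piece X d"
  unfolding poly_piece_iff lookup_minus by (metis diff_zero)

lemma poly_piece_mult:
  fixes p :: "('x, 'k::comm_ring_1) mpoly"
  assumes "p \<in> poly_piece X d" "q \<in> poly_piece X e"
  shows "p * q \<in> poly_piece X (d + e)"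
  unfolding poly_piece_iff
proof (intro allI impI)
  fix \<mu> assume "Poly_Mapping.lookup (p * q) \<mu> \<noteq> 0"
  then have "\<mu> \<in> Poly_Mapping.keys (p * q)" by (simp add: in_keys_iff)
  then obtain \<rho> \<sigma> where "\<mu> = \<rho> + \<sigma>" "\<rho> \<in> Poly_Mapping.keys p" "\<sigma> \<in> Poly_Mapping.keys q"
    using keys_mult[of p q] by auto
  then show "Poly_Mapping.keys \<mu> \<subseteq> X \<and> int (mdeg \<mu>) = d + e"
    using assms by (auto simp: poly_piece_iff in_keys_iff keys_add_nat mdeg_add)
qed

lemma poly_piece_neg: "d < 0 \<Longrightarrow> p \<in> poly_piece X d \<Longrightarrow> p = 0"
  unfolding poly_piece_iff by (intro poly_mapping_eqI) force

lemma poly_piece_single: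
  "Poly_Mapping.keys \<mu> \<subseteq> X \<Longrightarrow> int (mdeg \<mu>) = d \<Longrightarrow> Poly_Mapping.single \<mu> a \<in> poly_piece X d"
  by (auto simp: poly_piece_iff lookup_single when_def split: if_splits)

lemma poly_piece_Var: "x \<in> X \<Longrightarrow> Var x \<in> poly_piece X 1"
  unfolding Var_def by (rule poly_piece_single) auto

lemma poly_piece_sum: "(\<And>a. a \<in> A \<Longrightarrow> f a \<in> poly_piece X d) \<Longrightarrow> sum f A \<in> poly_piece X d"
  by (induction A rule: infinite_finite_induct) (auto intro: poly_piece_add)

definition mono_eval :: "('x \<Rightarrow> 'a::comm_monoid_mult) \<Rightarrow> ('x \<Rightarrow>\<^sub>0 nat) \<Rightarrow> 'a" where
  "mono_eval u \<mu> = (\<Prod>x\<in>Poly_Mapping.keys \<mu>. u x ^ Poly_Mapping.lookup \<mu> x)"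

lemma mono_eval_superset:
  assumes "finite A" "Poly_Mapping.keys \<mu> \<subseteq> A"
  shows "mono_eval u \<mu> = (\<Prod>x\<in>A. u x ^ Poly_Mapping.lookup \<mu> x)"
  unfolding mono_eval_def
  by (rule prod.mono_neutral_left) (use assms in \<open>auto simp: not_in_keys_iff_lookup_eq_zero\<close>)

lemma mono_eval_add: "mono_eval u (\<mu> + \<nu>) = mono_eval u \<mu> * mono_eval u \<nu>"
proof -
  let ?A = "Poly_Mapping.keys \<mu> \<union> Poly_Mapping.keys \<nu>"
  have "mono_eval u (\<mu> + \<nu>) = (\<Prod>x\<in>?A. u x ^ Poly_Mapping.lookup (\<mu> + \<nu>) x)"
    by (rule mono_eval_superset) (auto simp: keys_add_nat)
  also have "\<dots> = mono_eval u \<mu> * mono_eval u \<nu>"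
    by (simp add: lookup_add power_add prod.distrib mono_eval_superset[of ?A])
  finally show ?thesis .
qed

lemma mono_eval_0 [simp]: "mono_eval u 0 = 1"
  by (simp add: mono_eval_def)

lemma mono_eval_single [simp]: "mono_eval u (Poly_Mapping.single x a) = u x ^ a"
  by (simp add: mono_eval_def)

locale coeff_hom =
  fixes c :: "'k::comm_ring_1 \<Rightarrow> 'a::comm_ring_1"
  assumes hom_0: "c 0 = 0" and hom_1: "c 1 = 1"
    and hom_add: "c (a + b) = c a + c b" and hom_mult: "c (a * b) = c a * c b"
begin

lemma subst_poly_superset:
  assumes "finite A" "Poly_Mapping.keys p \<subseteq> A"
  shows "subst_poly c u p = (\<Sum>\<mu>\<in>A. c (Poly_Mapping.lookup p \<mu>) * mono_eval u \<mu>)"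
  unfolding subst_poly_def mono_eval_def[symmetric]
  by (rule sum.mono_neutral_left) (use assms in \<open>auto simp: not_in_keys_iff_lookup_eq_zero hom_0\<close>)

lemma subst_poly_0 [simp]: "subst_poly c u 0 = 0"
  by (simp add: subst_poly_def)

lemma subst_poly_add: "subst_poly c u (p + q) = subst_poly c u p + subst_poly c u q"
proof -
  let ?A = "Poly_Mapping.keys p \<union> Poly_Mapping.keys q"
  have "subst_poly c u (p + q) = (\<Sum>\<mu>\<in>?A. c (Poly_Mapping.lookup (p + q) \<mu>) * mono_eval u \<mu>)"
    by (rule subst_poly_superset) (use keys_add[of p q] in auto)
  also have "\<dots> = subst_poly c u p + subst_poly c u q"
    by (simp add: lookup_add hom_add algebra_simps sum.distrib subst_poly_superset[of ?A])
  finally show ?thesis .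
qed

lemma subst_poly_sum: "subst_poly c u (sum f A) = (\<Sum>a\<in>A. subst_poly c u (f a))"
  by (induction A rule: infinite_finite_induct) (auto simp: subst_poly_add)

lemma subst_poly_single: "subst_poly c u (Poly_Mapping.single \<mu> a) = c a * mono_eval u \<mu>"
  by (simp add: subst_poly_def mono_eval_def[symmetric] hom_0)

lemma subst_poly_1: "subst_poly c u 1 = 1"
  by (simp flip: single_one add: subst_poly_single hom_1)

lemma subst_poly_Var: "subst_poly c u (Var x) = u x"
  by (simp add: Var_def subst_poly_single hom_1)

lemma subst_poly_mult: "subst_poly c u (p * q) = subst_poly c u p * subst_poly c u q"
proof -
  let ?s = "\<lambda>p \<mu>. Poly_Mapping.single \<mu> (Poly_Mapping.lookup p \<mu>)"
  have "p * q = (\<Sum>\<mu>\<in>Poly_Mapping.keys p. \<Sum>\<nu>\<in>Poly_Mapping.keys q. ?s p \<mu> * ?s q \<nu>)"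
    by (subst poly_mapping_sum_single[of p], subst poly_mapping_sum_single[of q])
      (rule sum_product)
  then have "subst_poly c u (p * q) = (\<Sum>\<mu>\<in>Poly_Mapping.keys p. \<Sum>\<nu>\<in>Poly_Mapping.keys q.
      (c (Poly_Mapping.lookup p \<mu>) * mono_eval u \<mu>) * (c (Poly_Mapping.lookup q \<nu>) * mono_eval u \<nu>))"
    by (simp add: subst_poly_sum mult_single subst_poly_single hom_mult mono_eval_add mult_ac)
  also have "\<dots> = subst_poly c u p * subst_poly c u q"
    by (simp add: subst_poly_def mono_eval_def[symmetric] sum_product)
  finally show ?thesis .
qed

end

section \<open>Chain maps between graded free resolutions\<close>

lemma sum_mult_sum_assoc:
  fixes a :: "'i \<Rightarrow> 'a::comm_ring_1"
  shows "(\<Sum>k\<in>K. a k * (\<Sum>c\<in>C. b k c * d c)) = (\<Sum>c\<in>C. (\<Sum>k\<in>K. a k * b k c) * d c)"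
proof -
  have "(\<Sum>k\<in>K. a k * (\<Sum>c\<in>C. b k c * d c)) = (\<Sum>k\<in>K. \<Sum>c\<in>C. a k * b k c * d c)"
    by (simp add: sum_distrib_left mult.assoc)
  also have "\<dots> = (\<Sum>c\<in>C. \<Sum>k\<in>K. a k * b k c * d c)"
    by (rule sum.swap)
  finally show ?thesis
    by (simp add: sum_distrib_right)
qed

definition mat_vec ::
  "('p \<Rightarrow> 'a \<Rightarrow> 'a) \<Rightarrow> nat \<Rightarrow> nat \<Rightarrow> (nat \<Rightarrow> nat \<Rightarrow> 'p) \<Rightarrow> (nat \<Rightarrow> 'a) \<Rightarrow> (nat \<Rightarrow> 'a::comm_monoid_add)" where
  "mat_vec act r c A v = (\<lambda>a. if a < r then \<Sum>b<c. act (A a b) (v b) else 0)"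

lemma tensor_diff_mat_vec:
  "tensor_diff act G i = mat_vec act (fc_rank G i) (fc_rank G (Suc i)) (fc_mat G i)"
  by (simp add: fun_eq_iff tensor_diff_def mat_vec_def)

lemma mat_vec_cong:
  "(\<And>a b. a < r \<Longrightarrow> b < c \<Longrightarrow> A a b = B a b) \<Longrightarrow> mat_vec act r c A v = mat_vec act r c B v"
  by (auto simp: mat_vec_def fun_eq_iff intro!: sum.cong)

context module
begin

lemma mat_vec_comp:
  "mat_vec scale r c A (mat_vec scale c d B v) = mat_vec scale r d (\<lambda>a b. \<Sum>k<c. A a k * B k b) v"
  (is "?l = ?r")
proof
  fix a
  have "(\<Sum>k<c. \<Sum>b<d. scale (A a k) (scale (B k b) (v b)))
      = (\<Sum>b<d. \<Sum>k<c. scale (A a k * B k b) (v b))"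
    by (subst sum.swap) simp
  then show "?l a = ?r a"
    by (simp add: mat_vec_def scale_sum_right scale_sum_left)
qed

lemma mat_vec_0 [simp]: "mat_vec scale r c A (\<lambda>_. 0) = (\<lambda>_. 0)"
  by (simp add: mat_vec_def fun_eq_iff)

lemma mat_vec_identity:
  assumes "\<And>a. a \<ge> r \<Longrightarrow> v a = 0"
  shows "mat_vec scale r r (\<lambda>a b. if a = b then 1 else 0) v = v"
proof
  fix a
  have "(\<Sum>b<r. scale (if a = b then 1 else 0) (v b)) = (\<Sum>b<r. if a = b then v b else 0)"
    by (rule sum.cong) auto
  then show "mat_vec scale r r (\<lambda>a b. if a = b then 1 else 0) v a = v a"
    using assms by (auto simp: mat_vec_def)
qed

end

text \<open>The closure properties that make \<open>tensor_piece M G i j\<close> a group and let homogeneous matrices act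
  on these groups.\<close>

locale graded_action = module act
  for act :: "('x, 'k::comm_ring_1) mpoly \<Rightarrow> 'a::ab_group_add \<Rightarrow> 'a" +
  fixes X :: "'x set" and M :: "int \<Rightarrow> 'a set"
  assumes piece_0: "0 \<in> M j"
    and piece_add: "f \<in> M j \<Longrightarrow> g \<in> M j \<Longrightarrow> f + g \<in> M j"
    and piece_act: "p \<in> poly_piece X d \<Longrightarrow> f \<in> M j \<Longrightarrow> act p f \<in> M (d + j)"
begin

lemma piece_sum: "(\<And>a. a \<in> A \<Longrightarrow> f a \<in> M j) \<Longrightarrow> sum f A \<in> M j"
  by (induction A rule: infinite_finite_induct) (auto intro: piece_add piece_0)

lemma mat_vec_piece:
  assumes "\<And>a b. a < fc_rank G k \<Longrightarrow> b < fc_rank F i \<Longrightarrow>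
      A a b \<in> poly_piece X (fc_shift F i b - fc_shift G k a)"
    and "v \<in> tensor_piece M F i j"
  shows "mat_vec act (fc_rank G k) (fc_rank F i) A v \<in> tensor_piece M G k j"
proof -
  have "act (A a b) (v b) \<in> M (j - fc_shift G k a)" if "a < fc_rank G k" "b < fc_rank F i" for a b
  proof -
    have "act (A a b) (v b) \<in> M ((fc_shift F i b - fc_shift G k a) + (j - fc_shift F i b))"
      by (rule piece_act) (use assms that in \<open>auto simp: tensor_piece_def\<close>)
    then show ?thesis by simp
  qed
  then show ?thesis
    by (auto simp: tensor_piece_def mat_vec_def intro!: piece_sum)
qed

end

lemma module_mult: "module ((*) :: 'a::comm_ring_1 \<Rightarrow> 'a \<Rightarrow> 'a)"
  by unfold_locales (auto simp: algebra_simps)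

lemma graded_action_poly: "graded_action ((*) :: ('x, 'k::comm_ring_1) mpoly \<Rightarrow> _) X (poly_piece X)"
  by (intro graded_action.intro graded_action_axioms.intro module_mult poly_piece_add poly_piece_mult
      poly_piece_0)

text \<open>The kernel of the map that leaves position \<open>i\<close> of a resolution, the augmentation for \<open>i = 0\<close>;
  this makes exactness a single statement for all \<open>i\<close>.\<close>

definition res_cycle ::
  "(('x, 'k::comm_ring_1) mpoly \<Rightarrow> 'n::comm_monoid_add \<Rightarrow> 'n) \<Rightarrow> ('x, 'k, 'n) free_complex \<Rightarrow> nat
    \<Rightarrow> (nat \<Rightarrow> ('x, 'k) mpoly) \<Rightarrow> bool" where
  "res_cycle act G i v \<longleftrightarrow>
    (case i of 0 \<Rightarrow> augmentation act G v = 0 | Suc k \<Rightarrow> tensor_diff (*) G k v = (\<lambda>_. 0))"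

lemma resolution_exact:
  assumes "graded_free_resolution X act N G"
  shows "v \<in> tensor_piece (poly_piece X) G i j \<and> res_cycle act G i v \<longleftrightarrow>
    v \<in> tensor_diff (*) G i ` tensor_piece (poly_piece X) G (Suc i) j"
proof (cases i)
  case 0
  have "{v \<in> tensor_piece (poly_piece X) G 0 j. augmentation act G v = 0} =
          tensor_diff (*) G 0 ` tensor_piece (poly_piece X) G 1 j"
    using assms by (auto simp: graded_free_resolution_def)
  then show ?thesis
    using 0 by (auto simp: res_cycle_def)
next
  case (Suc k)
  have "{v \<in> tensor_piece (poly_piece X) G (Suc k) j. tensor_diff (*) G k v = 0} =
          tensor_diff (*) G (Suc k) ` tensor_piece (poly_piece X) G (Suc (Suc k)) j"
    using assms by (auto simp: graded_free_resolution_def)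
  then show ?thesis
    using Suc by (auto simp: res_cycle_def zero_fun_def)
qed

lemma resolution_mat:
  assumes "graded_free_resolution X act N G" "a < fc_rank G i" "b < fc_rank G (Suc i)"
  shows "fc_mat G i a b \<in> poly_piece X (fc_shift G (Suc i) b - fc_shift G i a)"
  using assms by (auto simp: graded_free_resolution_def)

definition mat_col :: "nat \<Rightarrow> (nat \<Rightarrow> nat \<Rightarrow> 'p) \<Rightarrow> nat \<Rightarrow> nat \<Rightarrow> 'p::zero" where
  "mat_col r A b = (\<lambda>a. if a < r then A a b else 0)"

lemma mat_vec_mult_unit:
  fixes A :: "nat \<Rightarrow> nat \<Rightarrow> 'p::comm_ring_1"
  assumes "b < c"
  shows "mat_vec (*) r c A (\<lambda>b'. if b' = b then 1 else 0) = mat_col r A b"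
proof -
  have "(\<Sum>b'<c. A a b' * (if b' = b then 1 else 0)) = (\<Sum>b'<c. if b' = b then A a b' else 0)" for a
    by (rule sum.cong) auto
  then show ?thesis
    using assms by (auto simp: mat_vec_def mat_col_def fun_eq_iff)
qed

lemma poly_piece_one: "1 \<in> poly_piece X 0"
  unfolding single_one[symmetric] by (rule poly_piece_single) auto

lemma mat_col_cycle:
  fixes F :: "('x, 'k::comm_ring_1, 'n::comm_monoid_add) free_complex"
  assumes F: "graded_free_resolution X act N F" and b: "b < fc_rank F (Suc i)"
  shows "mat_col (fc_rank F i) (fc_mat F i) b \<in> tensor_piece (poly_piece X) F i (fc_shift F (Suc i) b)"
    and "res_cycle act F i (mat_col (fc_rank F i) (fc_mat F i) b)"
proof -
  have "(\<lambda>b'. if b' = b then 1 else 0) \<in> tensor_piece (poly_piece X) F (Suc i) (fc_shift F (Suc i) b)"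
    using b by (auto simp: tensor_piece_def poly_piece_one)
  moreover have "tensor_diff (*) F i (\<lambda>b'. if b' = b then 1 else 0)
      = mat_col (fc_rank F i) (fc_mat F i) b"
    using b by (simp add: tensor_diff_mat_vec mat_vec_mult_unit)
  ultimately have "mat_col (fc_rank F i) (fc_mat F i) b
      \<in> tensor_diff (*) F i ` tensor_piece (poly_piece X) F (Suc i) (fc_shift F (Suc i) b)"
    by (intro image_eqI[OF sym])
  then show "mat_col (fc_rank F i) (fc_mat F i) b \<in> tensor_piece (poly_piece X) F i (fc_shift F (Suc i) b)"
    and "res_cycle act F i (mat_col (fc_rank F i) (fc_mat F i) b)"
    by (simp_all add: resolution_exact[OF F, symmetric])
qed

definition graded_map ::
  "'x set \<Rightarrow> ('x, 'k::zero, 'n) free_complex \<Rightarrow> ('x, 'k, 'n) free_complex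
    \<Rightarrow> nat \<Rightarrow> (nat \<Rightarrow> nat \<Rightarrow> ('x, 'k) mpoly) \<Rightarrow> bool" where
  "graded_map X F G i A \<longleftrightarrow> (\<forall>a < fc_rank G i. \<forall>b < fc_rank F i.
      A a b \<in> poly_piece X (fc_shift F i b - fc_shift G i a))"

text \<open>A chain map that lifts the identity of the resolved module, recorded by its matrices rather
  than by its effect on \<open>P\<close>-chains: in this form it can be tensored with any graded module.\<close>

definition chain_map ::
  "'x set \<Rightarrow> (('x, 'k::comm_ring_1) mpoly \<Rightarrow> 'n::comm_monoid_add \<Rightarrow> 'n)
    \<Rightarrow> ('x, 'k, 'n) free_complex \<Rightarrow> ('x, 'k, 'n) free_complex
    \<Rightarrow> (nat \<Rightarrow> nat \<Rightarrow> nat \<Rightarrow> ('x, 'k) mpoly) \<Rightarrow> bool" where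
  "chain_map X act F G \<phi> \<longleftrightarrow>
    (\<forall>i. graded_map X F G i (\<phi> i)) \<and>
    (\<forall>b < fc_rank F 0. (\<Sum>a < fc_rank G 0. act (\<phi> 0 a b) (fc_aug G a)) = fc_aug F b) \<and>
    (\<forall>i. \<forall>a < fc_rank G i. \<forall>b < fc_rank F (Suc i).
      (\<Sum>c < fc_rank G (Suc i). fc_mat G i a c * \<phi> (Suc i) c b) =
      (\<Sum>c < fc_rank F i. \<phi> i a c * fc_mat F i c b))"

lemma chain_map_tensor_diff:
  assumes \<phi>: "chain_map X act F G \<phi>" and M: "module actM"
  shows "tensor_diff actM G i (mat_vec actM (fc_rank G (Suc i)) (fc_rank F (Suc i)) (\<phi> (Suc i)) v) =
    mat_vec actM (fc_rank G i) (fc_rank F i) (\<phi> i) (tensor_diff actM F i v)"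
  unfolding tensor_diff_mat_vec module.mat_vec_comp[OF M]
  by (rule mat_vec_cong) (use \<phi> in \<open>auto simp: chain_map_def\<close>)

text \<open>The comparison theorem. The matrices are built one position at a time: the columns of
  \<open>\<phi> i \<cdot> fc_mat F i\<close> are cycles of \<open>G\<close>, and exactness lifts each of them to a column of
  \<open>\<phi> (Suc i)\<close>. That \<open>\<phi> i\<close> maps cycles to cycles is the invariant that keeps this going.\<close>

lemma comparison:
  fixes act :: "('x, 'k::comm_ring_1) mpoly \<Rightarrow> 'n::ab_group_add \<Rightarrow> 'n"
    and F G :: "('x, 'k, 'n) free_complex"
  assumes act: "module act"
    and F: "graded_free_resolution X act N F" and G: "graded_free_resolution X act N G"
  obtains \<phi> where "chain_map X act F G \<phi>"
proof -
  interpret act: module act by (rule act)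
  interpret P: graded_action "(*) :: ('x, 'k) mpoly \<Rightarrow> _" X "poly_piece X"
    by (rule graded_action_poly)
  let ?rF = "fc_rank F" and ?rG = "fc_rank G"
  let ?ap = "\<lambda>i A. mat_vec (*) (?rG i) (?rF i) A"
  \<comment> \<open>\<open>good\<close> is the invariant of a single matrix, \<open>step\<close> the commuting square between two of them\<close>
  define good where "good i A \<longleftrightarrow> graded_map X F G i A \<and>
      (\<forall>j. \<forall>v \<in> tensor_piece (poly_piece X) F i j. res_cycle act F i v \<longrightarrow> res_cycle act G i (?ap i A v)) \<and>
      (i = 0 \<longrightarrow> (\<forall>b < ?rF 0. (\<Sum>a < ?rG 0. act (A a b) (fc_aug G a)) = fc_aug F b))" for i A
  define step where "step i A B \<longleftrightarrow> (\<forall>a < ?rG i. \<forall>b < ?rF (Suc i).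
      (\<Sum>c < ?rG (Suc i). fc_mat G i a c * B c b) = (\<Sum>c < ?rF i. A a c * fc_mat F i c b))" for i A B
  have start: "\<exists>A. good 0 A"
  proof -
    have "\<exists>w \<in> tensor_piece (poly_piece X) G 0 (fc_shift F 0 b). augmentation act G w = fc_aug F b"
      if "b < ?rF 0" for b
    proof -
      have "fc_aug F b \<in> N (fc_shift F 0 b)"
        using F that by (auto simp: graded_free_resolution_def)
      also have "N (fc_shift F 0 b) =
          augmentation act G ` tensor_piece (poly_piece X) G 0 (fc_shift F 0 b)"
        using G by (auto simp: graded_free_resolution_def)
      finally show ?thesis by (auto simp: image_iff)
    qed
    then obtain w where w: "\<And>b. b < ?rF 0 \<Longrightarrow>
        w b \<in> tensor_piece (poly_piece X) G 0 (fc_shift F 0 b) \<and> augmentation act G (w b) = fc_aug F b"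
      by metis
    define A where "A a b = w b a" for a b
    have aug: "(\<Sum>a < ?rG 0. act (A a b) (fc_aug G a)) = fc_aug F b" if "b < ?rF 0" for b
      using w[OF that] by (simp add: augmentation_def A_def)
    have "augmentation act G (?ap 0 A v) = augmentation act F v" for v
    proof -
      have "augmentation act G (?ap 0 A v)
          = (\<Sum>a<?rG 0. \<Sum>b<?rF 0. act (v b) (act (A a b) (fc_aug G a)))"
        by (simp add: augmentation_def mat_vec_def act.scale_sum_left mult.commute)
      also have "\<dots> = (\<Sum>b<?rF 0. act (v b) (\<Sum>a<?rG 0. act (A a b) (fc_aug G a)))"
        by (subst sum.swap) (simp add: act.scale_sum_right)
      also have "\<dots> = augmentation act F v"
        by (simp add: aug augmentation_def)
      finally show ?thesis .
    qed
    then have "good 0 A"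
      using w aug by (auto simp: good_def graded_map_def A_def res_cycle_def tensor_piece_def)
    then show ?thesis by blast
  qed
  have extend: "\<exists>B. good (Suc i) B \<and> step i A B" if A: "good i A" for i A
  proof -
    let ?u = "\<lambda>b. ?ap i A (mat_col (?rF i) (fc_mat F i) b)"
    have "\<exists>w \<in> tensor_piece (poly_piece X) G (Suc i) (fc_shift F (Suc i) b). tensor_diff (*) G i w = ?u b"
      if b: "b < ?rF (Suc i)" for b
    proof -
      have "?u b \<in> tensor_piece (poly_piece X) G i (fc_shift F (Suc i) b)"
        by (rule P.mat_vec_piece) (use A mat_col_cycle[OF F b] in \<open>auto simp: good_def graded_map_def\<close>)
      moreover have "res_cycle act G i (?u b)"
        using A mat_col_cycle[OF F b] by (auto simp: good_def)
      ultimately have "?u b \<in> tensor_diff (*) G i ` tensor_piece (poly_piece X) G (Suc i) (fc_shift F (Suc i) b)"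
        using resolution_exact[OF G] by blast
      then show ?thesis by (auto simp: image_iff)
    qed
    then obtain w where w: "\<And>b. b < ?rF (Suc i) \<Longrightarrow>
        w b \<in> tensor_piece (poly_piece X) G (Suc i) (fc_shift F (Suc i) b) \<and> tensor_diff (*) G i (w b) = ?u b"
      by metis
    define B where "B a b = w b a" for a b
    have step: "step i A B"
      unfolding step_def
    proof (intro allI impI)
      fix a b assume ab: "a < ?rG i" "b < ?rF (Suc i)"
      have "tensor_diff (*) G i (w b) a = ?u b a"
        using w ab by simp
      then show "(\<Sum>c < ?rG (Suc i). fc_mat G i a c * B c b) = (\<Sum>c < ?rF i. A a c * fc_mat F i c b)"
        using ab by (simp add: tensor_diff_def B_def mat_vec_def mat_col_def)
    qed
    have "res_cycle act G (Suc i) (?ap (Suc i) B v)" if "res_cycle act F (Suc i) v" for v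
    proof -
      have "tensor_diff (*) G i (?ap (Suc i) B v) = ?ap i A (tensor_diff (*) F i v)"
        unfolding tensor_diff_mat_vec P.mat_vec_comp
        by (rule mat_vec_cong) (use step in \<open>auto simp: step_def\<close>)
      then show ?thesis
        using that by (simp add: res_cycle_def)
    qed
    then have "good (Suc i) B"
      using w by (auto simp: good_def graded_map_def B_def tensor_piece_def)
    with step show ?thesis by blast
  qed
  obtain \<phi> where \<phi>: "\<And>i. good i (\<phi> i) \<and> step i (\<phi> i) (\<phi> (Suc i))"
    using dependent_nat_choice[of good step] start extend by metis
  have "chain_map X act F G \<phi>"
    using \<phi> unfolding chain_map_def good_def step_def by blast
  then show ?thesis by (rule that)
qed

text \<open>If \<open>F\<close> is a linear resolution, then \<open>F\<close> is a direct summand of every resolution of the same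
  module, and no homotopy is needed to see it: \<open>\<psi> \<phi> - 1\<close> sends the basis of \<open>F\<^sub>i\<close>, which sits in
  degree \<open>i\<close>, to cycles of degree \<open>i\<close> of \<open>F\<^sub>i\<close>. These are images of elements of degree \<open>i\<close> of
  \<open>F\<^sub>i\<^sub>+\<^sub>1\<close>, which is zero in that degree.\<close>

lemma chain_endomorphism_linear:
  fixes act :: "('x, 'k::comm_ring_1) mpoly \<Rightarrow> 'n::ab_group_add \<Rightarrow> 'n"
    and F G :: "('x, 'k, 'n) free_complex"
  assumes act: "module act" and F: "graded_free_resolution X act N F"
    and linear: "\<And>i a. fc_shift F i a = int i"
    and \<phi>: "chain_map X act F G \<phi>" and \<psi>: "chain_map X act G F \<psi>"
    and ab: "a < fc_rank F i" "b < fc_rank F i"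
  shows "(\<Sum>c < fc_rank G i. \<psi> i a c * \<phi> i c b) = (if a = b then 1 else 0)"
  using ab
proof (induction i arbitrary: a b)
  interpret act: module act by (rule act)
  interpret P: graded_action "(*) :: ('x, 'k) mpoly \<Rightarrow> _" X "poly_piece X"
    by (rule graded_action_poly)
  let ?rF = "fc_rank F" and ?rG = "fc_rank G"
  define D where "D i b = (\<lambda>a. if a < ?rF i then (\<Sum>c < ?rG i. \<psi> i a c * \<phi> i c b) - (if a = b then 1 else 0) else 0)"
    for i b
  have D_piece: "D i b \<in> tensor_piece (poly_piece X) F i (int i)" if "b < ?rF i" for i b
  proof -
    have "\<psi> i a c * \<phi> i c b \<in> poly_piece X 0" if "a < ?rF i" "c < ?rG i" for a c
    proof -
      have "\<psi> i a c * \<phi> i c b \<in> poly_piece X ((fc_shift G i c - fc_shift F i a) + (fc_shift F i b - fc_shift G i c))"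
        by (rule poly_piece_mult) (use \<phi> \<psi> that \<open>b < ?rF i\<close> in \<open>auto simp: chain_map_def graded_map_def\<close>)
      then show ?thesis by (simp add: linear)
    qed
    then show ?thesis
      by (auto simp: tensor_piece_def D_def linear intro!: poly_piece_diff poly_piece_sum poly_piece_one)
  qed
  have D_0: "D i b = (\<lambda>_. 0)" if "b < ?rF i" "res_cycle act F i (D i b)" for i b
  proof -
    have "D i b \<in> tensor_diff (*) F i ` tensor_piece (poly_piece X) F (Suc i) (int i)"
      using D_piece[OF that(1)] that(2) resolution_exact[OF F] by blast
    then obtain w where w: "w \<in> tensor_piece (poly_piece X) F (Suc i) (int i)" "D i b = tensor_diff (*) F i w"
      by blast
    have "w a = 0" for a
    proof (cases "a < ?rF (Suc i)")
      case True
      then have "w a \<in> poly_piece X (int i - int (Suc i))"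
        using w(1) by (auto simp: tensor_piece_def linear)
      then show ?thesis by (rule poly_piece_neg[rotated]) simp
    qed (use w(1) in \<open>auto simp: tensor_piece_def\<close>)
    then have "w = (\<lambda>_. 0)" by auto
    then show ?thesis
      using w(2) by (simp add: tensor_diff_mat_vec)
  qed
  have conclude: "(\<Sum>c < ?rG i. \<psi> i a c * \<phi> i c b) = (if a = b then 1 else 0)"
    if "a < ?rF i" "b < ?rF i" "res_cycle act F i (D i b)" for i a b
    using fun_cong[OF D_0[OF that(2,3)], of a] that(1) by (simp add: D_def)
  { case 0
    have "augmentation act F (D 0 b) =
        (\<Sum>a<?rF 0. \<Sum>c<?rG 0. act (\<phi> 0 c b) (act (\<psi> 0 a c) (fc_aug F a)))
          - (\<Sum>a<?rF 0. act (if a = b then 1 else 0) (fc_aug F a))"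
      by (simp add: augmentation_def D_def act.scale_left_diff_distrib act.scale_sum_left
          sum_subtractf mult.commute)
    also have "(\<Sum>a<?rF 0. \<Sum>c<?rG 0. act (\<phi> 0 c b) (act (\<psi> 0 a c) (fc_aug F a)))
        = (\<Sum>c<?rG 0. act (\<phi> 0 c b) (\<Sum>a<?rF 0. act (\<psi> 0 a c) (fc_aug F a)))"
      by (subst sum.swap) (simp add: act.scale_sum_right)
    also have "\<dots> = (\<Sum>c<?rG 0. act (\<phi> 0 c b) (fc_aug G c))"
      using \<psi> by (auto simp: chain_map_def intro!: sum.cong)
    also have "\<dots> = fc_aug F b"
      using \<phi> 0 by (auto simp: chain_map_def)
    also have "(\<Sum>a<?rF 0. act (if a = b then 1 else 0) (fc_aug F a)) = (\<Sum>a<?rF 0. if a = b then fc_aug F a else 0)"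
      by (rule sum.cong) auto
    finally have "res_cycle act F 0 (D 0 b)"
      using 0 by (simp add: res_cycle_def)
    then show ?case
      using conclude 0 by blast
  next
    case (Suc i)
    have "tensor_diff (*) F i (D (Suc i) b) a' = 0" for a'
    proof (cases "a' < ?rF i")
      case True
      have "tensor_diff (*) F i (D (Suc i) b) a' =
          (\<Sum>k<?rF (Suc i). fc_mat F i a' k * (\<Sum>c<?rG (Suc i). \<psi> (Suc i) k c * \<phi> (Suc i) c b))
          - (\<Sum>k<?rF (Suc i). fc_mat F i a' k * (if k = b then 1 else 0))"
        using True by (simp add: tensor_diff_def D_def right_diff_distrib sum_subtractf)
      also have "(\<Sum>k<?rF (Suc i). fc_mat F i a' k * (if k = b then 1 else 0))
          = (\<Sum>k<?rF (Suc i). if k = b then fc_mat F i a' k else 0)"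
        by (rule sum.cong) auto
      also have "\<dots> = fc_mat F i a' b"
        using Suc.prems by simp
      also have "(\<Sum>k<?rF (Suc i). fc_mat F i a' k * (\<Sum>c<?rG (Suc i). \<psi> (Suc i) k c * \<phi> (Suc i) c b))
          = (\<Sum>c<?rG (Suc i). (\<Sum>k<?rF (Suc i). fc_mat F i a' k * \<psi> (Suc i) k c) * \<phi> (Suc i) c b)"
        by (rule sum_mult_sum_assoc)
      also have "\<dots> = (\<Sum>c<?rG (Suc i). (\<Sum>k<?rG i. \<psi> i a' k * fc_mat G i k c) * \<phi> (Suc i) c b)"
        using \<psi> True by (auto simp: chain_map_def intro!: sum.cong)
      also have "\<dots> = (\<Sum>k<?rG i. \<psi> i a' k * (\<Sum>c<?rG (Suc i). fc_mat G i k c * \<phi> (Suc i) c b))"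
        by (rule sum_mult_sum_assoc[symmetric])
      also have "\<dots> = (\<Sum>k<?rG i. \<psi> i a' k * (\<Sum>c<?rF i. \<phi> i k c * fc_mat F i c b))"
        using \<phi> Suc.prems by (auto simp: chain_map_def intro!: sum.cong)
      also have "\<dots> = (\<Sum>c<?rF i. (\<Sum>k<?rG i. \<psi> i a' k * \<phi> i k c) * fc_mat F i c b)"
        by (rule sum_mult_sum_assoc)
      also have "\<dots> = (\<Sum>c<?rF i. if a' = c then fc_mat F i c b else 0)"
        by (rule sum.cong) (use Suc.IH[OF True] in auto)
      also have "\<dots> = fc_mat F i a' b"
        using True by simp
      finally show ?thesis by simp
    qed (simp add: tensor_diff_def)
    then have "res_cycle act F (Suc i) (D (Suc i) b)"
      by (simp add: res_cycle_def fun_eq_iff)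
    then show ?case
      using conclude Suc.prems by blast
  }
qed

text \<open>If the image of \<open>z\<close> under the chain map \<open>F \<rightarrow> G\<close> were a boundary, then the chain map back would
  exhibit \<open>z\<close> itself as a boundary, because the composite is the identity.\<close>

lemma linear_resolution_class_survives:
  fixes act :: "('x, 'k::comm_ring_1) mpoly \<Rightarrow> 'n::ab_group_add \<Rightarrow> 'n"
    and F G :: "('x, 'k, 'n) free_complex"
  assumes act: "module act"
    and F: "graded_free_resolution X act N F" and G: "graded_free_resolution X act N G"
    and linear: "\<And>i a. fc_shift F i a = int i"
    and M: "graded_action actM X M"
    and z: "z \<in> tensor_piece M F i j" "i > 0 \<Longrightarrow> tensor_diff actM F (i - 1) z = 0"
      "z \<notin> tensor_diff actM F i ` tensor_piece M F (Suc i) j"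
  obtains z' where "z' \<in> tensor_piece M G i j" "i > 0 \<Longrightarrow> tensor_diff actM G (i - 1) z' = 0"
    "z' \<notin> tensor_diff actM G i ` tensor_piece M G (Suc i) j"
proof -
  interpret M: graded_action actM X M by (rule M)
  obtain \<phi> where \<phi>: "chain_map X act F G \<phi>" by (rule comparison[OF act F G])
  obtain \<psi> where \<psi>: "chain_map X act G F \<psi>" by (rule comparison[OF act G F])
  let ?z = "mat_vec actM (fc_rank G i) (fc_rank F i) (\<phi> i) z"
  show ?thesis
  proof (rule that)
    show "?z \<in> tensor_piece M G i j"
      by (rule M.mat_vec_piece) (use \<phi> z in \<open>auto simp: chain_map_def graded_map_def\<close>)
    show "tensor_diff actM G (i - 1) ?z = 0" if i: "i > 0"
      using chain_map_tensor_diff[OF \<phi> M.module_axioms, of "i - 1" z] z(2) i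
      by (simp add: zero_fun_def)
    show "?z \<notin> tensor_diff actM G i ` tensor_piece M G (Suc i) j"
    proof
      assume "?z \<in> tensor_diff actM G i ` tensor_piece M G (Suc i) j"
      then obtain w where w: "w \<in> tensor_piece M G (Suc i) j" "?z = tensor_diff actM G i w"
        by blast
      have "z = mat_vec actM (fc_rank F i) (fc_rank F i) (\<lambda>a b. if a = b then 1 else 0) z"
        by (rule M.mat_vec_identity[symmetric]) (use z(1) in \<open>auto simp: tensor_piece_def\<close>)
      also have "\<dots> = mat_vec actM (fc_rank F i) (fc_rank G i) (\<psi> i) ?z"
        unfolding M.mat_vec_comp
        by (rule mat_vec_cong) (use chain_endomorphism_linear[OF act F linear \<phi> \<psi>] in auto)
      also have "\<dots> = tensor_diff actM F i (mat_vec actM (fc_rank F (Suc i)) (fc_rank G (Suc i)) (\<psi> (Suc i)) w)"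
        unfolding w(2) chain_map_tensor_diff[OF \<psi> M.module_axioms] ..
      finally have "z = tensor_diff actM F i (mat_vec actM (fc_rank F (Suc i)) (fc_rank G (Suc i)) (\<psi> (Suc i)) w)" .
      moreover have "mat_vec actM (fc_rank F (Suc i)) (fc_rank G (Suc i)) (\<psi> (Suc i)) w \<in> tensor_piece M F (Suc i) j"
        by (rule M.mat_vec_piece) (use \<psi> w in \<open>auto simp: chain_map_def graded_map_def\<close>)
      ultimately show False
        using z(3) by blast
    qed
  qed
qed

section \<open>The Koszul complex\<close>

text \<open>Pairing \<open>(x, y)\<close> with \<open>(y, x)\<close> rather than comparing the sum with its own negative, which
  would prove nothing in characteristic \<open>2\<close>.\<close>

lemma sum_antisymmetric_pairs:
  fixes g :: "'i \<Rightarrow> 'i \<Rightarrow> 'a::ab_group_add"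
  assumes "finite A" and anti: "\<And>x y. x \<in> A \<Longrightarrow> y \<in> A \<Longrightarrow> x \<noteq> y \<Longrightarrow> g x y = - g y x"
  shows "(\<Sum>x\<in>A. \<Sum>y\<in>A - {x}. g x y) = 0"
  using assms
proof (induction A rule: finite_induct)
  case (insert z A)
  have "(\<Sum>x\<in>insert z A. \<Sum>y\<in>insert z A - {x}. g x y)
      = (\<Sum>y\<in>A. g z y) + (\<Sum>x\<in>A. g x z + (\<Sum>y\<in>A - {x}. g x y))"
  proof -
    have "insert z A - {z} = A" using insert.hyps by auto
    moreover have "(\<Sum>y\<in>insert z A - {x}. g x y) = g x z + (\<Sum>y\<in>A - {x}. g x y)" if "x \<in> A" for x
    proof -
      have "insert z A - {x} = insert z (A - {x})" using that insert.hyps by auto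
      then show ?thesis using insert.hyps by simp
    qed
    ultimately show ?thesis using insert.hyps by simp
  qed
  also have "\<dots> = (\<Sum>y\<in>A. g z y + g y z) + (\<Sum>x\<in>A. \<Sum>y\<in>A - {x}. g x y)"
    by (simp add: sum.distrib add_ac)
  also have "(\<Sum>y\<in>A. g z y + g y z) = 0"
  proof (rule sum.neutral, rule ballI)
    fix y assume "y \<in> A"
    then have "g z y = - g y z" using insert.hyps by (intro insert.prems) auto
    then show "g z y + g y z = 0" by simp
  qed
  also have "(\<Sum>x\<in>A. \<Sum>y\<in>A - {x}. g x y) = 0"
    by (rule insert.IH) (rule insert.prems; simp)
  finally show ?case by simp
qed simp

lemma lookup_neg_one_power_mult:
  fixes p :: "('x, 'k::comm_ring_1) mpoly"
  shows "Poly_Mapping.lookup ((- 1) ^ n * p) \<mu> = (- 1) ^ n * Poly_Mapping.lookup p \<mu>"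
  by (induction n) (auto simp: mult.assoc)

text \<open>The injection \<open>ord\<close> orders the variables and thereby fixes the signs. It is left arbitrary so that
  it can later be adapted to a colouring of the variables.\<close>

locale koszul =
  fixes X :: "'x set" and ord :: "'x \<Rightarrow> nat"
  assumes finite_X: "finite X" and inj_ord: "inj_on ord X"
begin

definition faces :: "nat \<Rightarrow> 'x set set" where
  "faces i = {S. S \<subseteq> X \<and> card S = i}"

definition enum :: "nat \<Rightarrow> nat \<Rightarrow> 'x set" where
  "enum i = (SOME e. bij_betw e {0..<card (faces i)} (faces i))"

definition position :: "'x set \<Rightarrow> nat" where
  "position S = inv_into {0..<card (faces (card S))} (enum (card S)) S"

text \<open>The sign is polymorphic because it occurs both as a coefficient in \<open>K\<close> and as a polynomial that
  acts on a module.\<close>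

definition ksign :: "'x \<Rightarrow> 'x set \<Rightarrow> 'a::comm_ring_1" where
  "ksign x S = (- 1) ^ card {y \<in> S. ord y < ord x}"

definition boundary ::
  "(('x, 'k::comm_ring_1) mpoly \<Rightarrow> 'a \<Rightarrow> 'a) \<Rightarrow> ('x set \<Rightarrow> 'a) \<Rightarrow> 'x set \<Rightarrow> 'a::comm_monoid_add" where
  "boundary act V S = (\<Sum>x\<in>X - S. act (ksign x S * Var x) (V (insert x S)))"

definition koszul_complex :: "('x, 'k::comm_ring_1, 'k) free_complex" where
  "koszul_complex = \<lparr>fc_rank = \<lambda>i. card (faces i), fc_shift = \<lambda>i a. int i,
     fc_mat = \<lambda>i a b. \<Sum>x | x \<in> X - enum i a \<and> insert x (enum i a) = enum (Suc i) b.
       ksign x (enum i a) * Var x,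
     fc_aug = \<lambda>_. 1\<rparr>"

text \<open>Chains as functions on faces; this hides the numbering of the basis.\<close>

definition chain_vec :: "nat \<Rightarrow> ('x set \<Rightarrow> 'a) \<Rightarrow> nat \<Rightarrow> 'a::zero" where
  "chain_vec i V = (\<lambda>a. if a < card (faces i) then V (enum i a) else 0)"

lemma finite_faces: "finite (faces i)"
  using finite_X by (auto simp: faces_def intro: finite_subset[of _ "Pow X"])

lemma finite_face: "S \<in> faces i \<Longrightarrow> finite S"
  using finite_X by (auto simp: faces_def intro: finite_subset)

lemma bij_enum: "bij_betw (enum i) {0..<card (faces i)} (faces i)"
  unfolding enum_def using ex_bij_betw_nat_finite[OF finite_faces] by (rule someI_ex)

lemma enum_face: "a < card (faces i) \<Longrightarrow> enum i a \<in> faces i"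
  using bij_betw_apply[OF bij_enum] by auto

lemma position_enum: "a < card (faces i) \<Longrightarrow> position (enum i a) = a"
proof -
  assume a: "a < card (faces i)"
  then have "card (enum i a) = i" using enum_face[OF a] by (auto simp: faces_def)
  then show ?thesis
    unfolding position_def using a by (simp add: bij_betw_inv_into_left[OF bij_enum])
qed

lemma face_enum: "S \<in> faces i \<Longrightarrow> \<exists>a < card (faces i). S = enum i a"
proof -
  assume "S \<in> faces i"
  then have "S \<in> enum i ` {0..<card (faces i)}"
    by (simp only: bij_betw_imp_surj_on[OF bij_enum])
  then show ?thesis by auto
qed

lemma insert_face: "S \<in> faces i \<Longrightarrow> x \<in> X - S \<Longrightarrow> insert x S \<in> faces (Suc i)"
  using finite_face[of S i] by (auto simp: faces_def)

lemma faces_0: "faces 0 = {{}}"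
  using finite_X by (auto simp: faces_def dest: finite_subset)

lemma ball_enum: "(\<forall>a < card (faces i). P (enum i a)) \<longleftrightarrow> (\<forall>S \<in> faces i. P S)"
  using face_enum enum_face by metis

lemma chain_vec_eq_iff: "chain_vec i V = chain_vec i W \<longleftrightarrow> (\<forall>S\<in>faces i. V S = W S)"
  unfolding ball_enum[symmetric, where P = "\<lambda>S. V S = W S"]
  by (auto simp: chain_vec_def fun_eq_iff)

lemma chain_vec_eq_0_iff: "chain_vec i V = 0 \<longleftrightarrow> (\<forall>S\<in>faces i. V S = 0)"
  unfolding ball_enum[symmetric, where P = "\<lambda>S. V S = 0"]
  by (auto simp: chain_vec_def fun_eq_iff)

lemma chain_vec_piece_iff:
  "chain_vec i V \<in> tensor_piece M koszul_complex i j \<longleftrightarrow> (\<forall>S\<in>faces i. V S \<in> M (j - int i))"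
  unfolding ball_enum[symmetric, where P = "\<lambda>S. V S \<in> M (j - int i)"]
  by (auto simp: chain_vec_def tensor_piece_def koszul_complex_def)

lemma chain_vec_position:
  assumes "v \<in> tensor_piece M koszul_complex i j"
  shows "chain_vec i (\<lambda>S. v (position S)) = v"
  using assms by (auto simp: chain_vec_def fun_eq_iff position_enum tensor_piece_def koszul_complex_def)

lemma tensor_diff_chain_vec:
  assumes "module act"
  shows "tensor_diff act koszul_complex i (chain_vec (Suc i) V) = chain_vec i (boundary act V)"
proof
  interpret module act by fact
  fix a
  show "tensor_diff act koszul_complex i (chain_vec (Suc i) V) a = chain_vec i (boundary act V) a"
  proof (cases "a < card (faces i)")
    case True
    define S where "S = enum i a"
    let ?N = "card (faces (Suc i))"
    have S: "S \<in> faces i" using enum_face[OF True] by (simp add: S_def)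
    have "tensor_diff act koszul_complex i (chain_vec (Suc i) V) a =
       (\<Sum>b<?N. \<Sum>x | x \<in> X - S \<and> insert x S = enum (Suc i) b.
          act (ksign x S * Var x) (V (insert x S)))"
      using True by (auto simp: tensor_diff_def koszul_complex_def S_def scale_sum_left chain_vec_def
          intro!: sum.cong)
    also have "\<dots> = (\<Sum>b<?N. \<Sum>x\<in>X - S. if insert x S = enum (Suc i) b then
          act (ksign x S * Var x) (V (insert x S)) else 0)"
      using finite_X by (intro sum.cong refl sum.inter_filter) auto
    also have "\<dots> = (\<Sum>x\<in>X - S. \<Sum>b<?N. if insert x S = enum (Suc i) b then
          act (ksign x S * Var x) (V (insert x S)) else 0)"
      by (rule sum.swap)
    also have "\<dots> = (\<Sum>x\<in>X - S. act (ksign x S * Var x) (V (insert x S)))"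
    proof (rule sum.cong[OF refl])
      fix x assume "x \<in> X - S"
      then obtain c where c: "c < ?N" "insert x S = enum (Suc i) c"
        using face_enum[OF insert_face[OF S]] by blast
      have "insert x S = enum (Suc i) b \<longleftrightarrow> b = c" if "b < ?N" for b
        using c that position_enum by metis
      then have "(\<Sum>b<?N. if insert x S = enum (Suc i) b then
          act (ksign x S * Var x) (V (insert x S)) else 0)
          = (\<Sum>b<?N. if b = c then act (ksign x S * Var x) (V (insert x S)) else 0)"
        by (intro sum.cong) auto
      then show "(\<Sum>b<?N. if insert x S = enum (Suc i) b then
          act (ksign x S * Var x) (V (insert x S)) else 0) = act (ksign x S * Var x) (V (insert x S))"
        using c by simp
    qed
    finally show ?thesis
      using True by (simp add: chain_vec_def boundary_def S_def)
  qed (simp add: tensor_diff_def koszul_complex_def chain_vec_def)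
qed

lemma ksign_insert:
  assumes "finite S" "x \<notin> S"
  shows "ksign y (insert x S) = (if ord x < ord y then - ksign y S else ksign y S)"
proof (cases "ord x < ord y")
  case True
  have "{z \<in> insert x S. ord z < ord y} = insert x {z \<in> S. ord z < ord y}"
    using True by auto
  then show ?thesis
    using True assms by (simp add: ksign_def)
next
  case False
  have "{z \<in> insert x S. ord z < ord y} = {z \<in> S. ord z < ord y}"
    using False by auto
  then show ?thesis
    using False by (simp add: ksign_def)
qed

lemma boundary_boundary:
  fixes act :: "('x, 'k::comm_ring_1) mpoly \<Rightarrow> 'a \<Rightarrow> 'a::ab_group_add"
  assumes "module act" "S \<subseteq> X"
  shows "boundary act (boundary act V) S = 0"
proof -
  interpret module act by fact
  have fin: "finite S" using assms(2) finite_X by (rule finite_subset)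
  let ?g = "\<lambda>x y. act (ksign x S * ksign y (insert x S) * Var x * Var y) (V (insert y (insert x S)))"
  have "boundary act (boundary act V) S = (\<Sum>x\<in>X - S. \<Sum>y\<in>X - S - {x}. ?g x y)"
    unfolding boundary_def scale_sum_right
    by (intro sum.cong) (auto simp: mult_ac)
  also have "\<dots> = 0"
  proof (rule sum_antisymmetric_pairs)
    fix x y assume xy: "x \<in> X - S" "y \<in> X - S" "x \<noteq> y"
    then have "ord x \<noteq> ord y" using inj_ord by (auto dest: inj_onD)
    then have "ksign x S * ksign y (insert x S) = - (ksign y S * ksign x (insert y S) :: ('x, 'k) mpoly)"
      using xy fin by (auto simp: ksign_insert)
    then show "?g x y = - ?g y x"
      by (simp add: insert_commute mult_ac)
  qed (use finite_X in auto)
  finally show ?thesis .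
qed

definition least :: "'x set \<Rightarrow> 'x" where
  "least S = arg_min_on ord S"

lemma least_eqI:
  assumes "S \<subseteq> X" "x \<in> S" "\<And>y. y \<in> S \<Longrightarrow> ord x \<le> ord y"
  shows "least S = x"
proof -
  have "finite S" using assms(1) finite_X by (rule finite_subset)
  then have "least S \<in> S" "\<not> ord x < ord (least S)"
    unfolding least_def using arg_min_if_finite[of S ord] assms(2) by auto
  then have "ord (least S) = ord x" using assms(3)[of "least S"] by simp
  then show ?thesis using inj_ord assms \<open>least S \<in> S\<close> by (meson inj_onD subsetD)
qed

lemma least_in: "S \<subseteq> X \<Longrightarrow> S \<noteq> {} \<Longrightarrow> least S \<in> S"
  unfolding least_def using arg_min_if_finite(1)[of S ord] finite_X finite_subset by metis

lemma least_le: "S \<subseteq> X \<Longrightarrow> y \<in> S \<Longrightarrow> ord (least S) \<le> ord y"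
  unfolding least_def using arg_min_if_finite(2)[of S ord] finite_X finite_subset
  by (metis empty_iff not_le)

text \<open>The part of \<open>p\<close> made of the monomials whose first variable is \<open>x\<close>, divided by \<open>x\<close>.\<close>

definition div_least :: "'x \<Rightarrow> ('x, 'k::comm_ring_1) mpoly \<Rightarrow> ('x, 'k) mpoly" where
  "div_least x p = Poly_Mapping.Abs_poly_mapping (\<lambda>\<mu>.
     if \<forall>y\<in>Poly_Mapping.keys \<mu>. ord x \<le> ord y
     then Poly_Mapping.lookup p (\<mu> + Poly_Mapping.single x 1) else 0)"

lemma lookup_div_least:
  "Poly_Mapping.lookup (div_least x p) \<mu> =
    (if \<forall>y\<in>Poly_Mapping.keys \<mu>. ord x \<le> ord y
     then Poly_Mapping.lookup p (\<mu> + Poly_Mapping.single x 1) else 0)"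
proof -
  let ?f = "\<lambda>\<mu>. if \<forall>y\<in>Poly_Mapping.keys \<mu>. ord x \<le> ord y
     then Poly_Mapping.lookup p (\<mu> + Poly_Mapping.single x 1) else 0"
  have "finite ((\<lambda>\<mu>. \<mu> + Poly_Mapping.single x 1) -` Poly_Mapping.keys p)"
    by (intro finite_vimageI) (auto simp: inj_def)
  then have "finite {\<mu>. ?f \<mu> \<noteq> 0}"
    by (rule rev_finite_subset) (auto simp: in_keys_iff split: if_splits)
  then show ?thesis by (simp add: div_least_def)
qed

lemma div_least_piece:
  assumes "p \<in> poly_piece X d"
  shows "div_least x p \<in> poly_piece X (d - 1)"
  unfolding poly_piece_iff lookup_div_least
proof (intro allI impI)
  fix \<mu>
  assume "(if \<forall>y\<in>Poly_Mapping.keys \<mu>. ord x \<le> ord y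
     then Poly_Mapping.lookup p (\<mu> + Poly_Mapping.single x 1) else 0) \<noteq> 0"
  then have "Poly_Mapping.lookup p (\<mu> + Poly_Mapping.single x 1) \<noteq> 0"
    by (auto split: if_splits)
  then have "Poly_Mapping.keys (\<mu> + Poly_Mapping.single x 1) \<subseteq> X"
    "int (mdeg (\<mu> + Poly_Mapping.single x 1)) = d"
    using assms by (auto simp: poly_piece_iff)
  then show "Poly_Mapping.keys \<mu> \<subseteq> X \<and> int (mdeg \<mu>) = d - 1"
    by (auto simp: keys_add_nat mdeg_add)
qed

text \<open>A \<open>K\<close>-linear contraction of the Koszul complex of \<open>P\<close>. A basis chain \<open>\<mu> e\<^sub>S\<close> involves the
  variables \<open>S \<union> keys \<mu>\<close>, a set which the boundary does not change; the contraction moves the least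
  of them from the monomial to the face. This works in every characteristic.\<close>

definition contraction :: "('x set \<Rightarrow> ('x, 'k::comm_ring_1) mpoly) \<Rightarrow> 'x set \<Rightarrow> ('x, 'k) mpoly" where
  "contraction V S = div_least (least S) (V (S - {least S}))"

lemma lookup_boundary:
  fixes V :: "'x set \<Rightarrow> ('x, 'k::comm_ring_1) mpoly"
  shows "Poly_Mapping.lookup (boundary (*) V S) \<mu> =
    (\<Sum>x\<in>X - S. ksign x S * (if Poly_Mapping.lookup \<mu> x = 0 then 0
      else Poly_Mapping.lookup (V (insert x S)) (\<mu> - Poly_Mapping.single x 1)))"
  unfolding boundary_def lookup_sum ksign_def
  by (intro sum.cong refl) (simp add: mult.assoc lookup_neg_one_power_mult lookup_Var_times)

lemma minus_single_add_single:
  "Poly_Mapping.lookup \<mu> x \<noteq> (0::nat) \<Longrightarrow> \<mu> - Poly_Mapping.single x 1 + Poly_Mapping.single x 1 = \<mu>"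
  by (intro poly_mapping_eqI) (auto simp: lookup_add lookup_minus lookup_single when_def)

lemma keys_minus_single:
  "Poly_Mapping.keys (\<mu> - Poly_Mapping.single x (1::nat)) \<subseteq> Poly_Mapping.keys \<mu>"
  by (auto simp: in_keys_iff lookup_minus lookup_single when_def split: if_splits)

text \<open>The coefficient form of \<open>\<partial> h + h \<partial> = 1\<close>. If \<open>z \<notin> S\<close>, then only the term \<open>x = z\<close> of the boundary
  contributes: for every other \<open>x\<close> the least variable \<open>z\<close> stays in the monomial and the contraction
  gives \<open>0\<close>. If \<open>z \<in> S\<close>, then the term \<open>x = z\<close> of \<open>h \<partial>\<close> is the identity, and the other terms of the two
  sides differ by the sign that comes from the presence of \<open>z\<close> in \<open>S\<close>.\<close>

lemma contraction_homotopy: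
  fixes V :: "'x set \<Rightarrow> ('x, 'k::comm_ring_1) mpoly"
  assumes S: "S \<subseteq> X" and \<mu>: "Poly_Mapping.keys \<mu> \<subseteq> X" and z: "z \<in> S \<union> Poly_Mapping.keys \<mu>"
    and z_le: "\<And>y. y \<in> S \<union> Poly_Mapping.keys \<mu> \<Longrightarrow> ord z \<le> ord y"
  shows "Poly_Mapping.lookup (boundary (*) (contraction V) S) \<mu> =
    Poly_Mapping.lookup (V S) \<mu> - (if z \<in> S then
      Poly_Mapping.lookup (boundary (*) V (S - {z})) (\<mu> + Poly_Mapping.single z 1) else 0)"
proof -
  have zX: "z \<in> X" and fin: "finite S"
    using S \<mu> z finite_X finite_subset by auto
  have sign_z: "ksign z T = (1::'k)" if "T \<subseteq> S" for T
  proof -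
    have none: "{y \<in> T. ord y < ord z} = {}" using z_le that by fastforce
    show ?thesis unfolding ksign_def none by simp
  qed
  let ?h = "\<lambda>x. if Poly_Mapping.lookup \<mu> x = 0 then 0
      else Poly_Mapping.lookup (contraction V (insert x S)) (\<mu> - Poly_Mapping.single x 1)"
  show ?thesis
  proof (cases "z \<in> S")
    case False
    then have z\<mu>: "Poly_Mapping.lookup \<mu> z \<noteq> 0" using z by (simp add: in_keys_iff)
    have "?h x = 0" if x: "x \<in> X - S" "x \<noteq> z" for x
    proof -
      have "least (insert x S) \<in> insert x S"
        using x S by (intro least_in) auto
      then have "least (insert x S) \<noteq> z" "least (insert x S) \<in> X"
        using x False S by auto
      moreover have "z \<in> Poly_Mapping.keys (\<mu> - Poly_Mapping.single x 1)"
        using x(2) z\<mu> by (simp add: in_keys_iff lookup_minus lookup_single when_def)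
      moreover have "ord z \<le> ord (least (insert x S))" if "Poly_Mapping.lookup \<mu> x \<noteq> 0"
        using \<open>least (insert x S) \<in> insert x S\<close> that by (intro z_le) (auto simp: in_keys_iff)
      ultimately show ?thesis
        using inj_onD[OF inj_ord _ _ zX] by (force simp: contraction_def lookup_div_least)
    qed
    then have "Poly_Mapping.lookup (boundary (*) (contraction V) S) \<mu>
        = (\<Sum>x\<in>X - S. if x = z then ksign x S * ?h x else 0)"
      unfolding lookup_boundary by (intro sum.cong) auto
    also have "\<dots> = ?h z"
      using zX False finite_X sign_z[of S] by simp
    also have "\<dots> = Poly_Mapping.lookup (V S) \<mu>"
    proof -
      have l: "least (insert z S) = z"
        using S zX z_le by (intro least_eqI) auto
      have "\<forall>y\<in>Poly_Mapping.keys (\<mu> - Poly_Mapping.single z 1). ord z \<le> ord y"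
        using keys_minus_single[of \<mu> z] z_le by blast
      then show ?thesis
        using z\<mu> False by (simp add: contraction_def l lookup_div_least minus_single_add_single del: One_nat_def)
    qed
    finally show ?thesis using False by simp
  next
    case True
    define T where "T = S - {z}"
    have S_eq: "S = insert z T" and zT: "z \<notin> T" and finT: "finite T"
      using True fin by (auto simp: T_def)
    let ?k = "\<lambda>x. if Poly_Mapping.lookup (\<mu> + Poly_Mapping.single z 1) x = 0 then 0
      else Poly_Mapping.lookup (V (insert x T)) (\<mu> + Poly_Mapping.single z 1 - Poly_Mapping.single x 1)"
    have "ksign x S * ?h x = - (ksign x T * ?k x)" if x: "x \<in> X - S" for x
    proof (cases "Poly_Mapping.lookup \<mu> x = 0")
      case True
      then show ?thesis using x \<open>z \<in> S\<close> by (auto simp: lookup_add lookup_single when_def)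
    next
      case False
      have xz: "x \<noteq> z" using x True by auto
      have zx: "ord z \<le> ord x" using False by (intro z_le) (auto simp: in_keys_iff)
      moreover have "ord z \<noteq> ord x" using xz inj_ord zX x by (auto dest: inj_onD)
      ultimately have "ksign x S = - (ksign x T :: 'k)"
        unfolding S_eq using zT finT by (simp add: ksign_insert)
      moreover have l: "least (insert x S) = z"
        using x S True z_le zx by (intro least_eqI) auto
      moreover have "\<forall>y\<in>Poly_Mapping.keys (\<mu> - Poly_Mapping.single x 1). ord z \<le> ord y"
        using keys_minus_single[of \<mu> x] z_le by blast
      moreover have "insert x S - {z} = insert x T"
        using xz by (auto simp: T_def)
      moreover have "\<mu> - Poly_Mapping.single x 1 + Poly_Mapping.single z 1
          = \<mu> + Poly_Mapping.single z 1 - Poly_Mapping.single x 1"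
        using False xz by (intro poly_mapping_eqI) (auto simp: lookup_add lookup_minus lookup_single when_def)
      ultimately show ?thesis
        using False xz by (simp add: contraction_def lookup_div_least lookup_add lookup_single when_def del: One_nat_def)
    qed
    then have "Poly_Mapping.lookup (boundary (*) (contraction V) S) \<mu> = - (\<Sum>x\<in>X - S. ksign x T * ?k x)"
      unfolding lookup_boundary sum_negf[symmetric] by (intro sum.cong) auto
    moreover have "Poly_Mapping.lookup (boundary (*) V T) (\<mu> + Poly_Mapping.single z 1)
        = ksign z T * ?k z + (\<Sum>x\<in>X - S. ksign x T * ?k x)"
    proof -
      have "X - T = insert z (X - S)" using zX True by (auto simp: T_def)
      then show ?thesis
        unfolding lookup_boundary using True finite_X by simp
    qed
    moreover have "ksign z T * ?k z = Poly_Mapping.lookup (V S) \<mu>"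
      using sign_z[of T] S_eq by (simp add: lookup_add subset_insertI)
    ultimately show ?thesis
      using True by (simp add: T_def)
  qed
qed

lemma ksign_Var_piece:
  assumes "x \<in> X"
  shows "(ksign x S * Var x :: ('x, 'k::comm_ring_1) mpoly) \<in> poly_piece X 1"
proof -
  have "(ksign x S :: ('x, 'k) mpoly) \<in> poly_piece X 0"
    using poly_piece_one[of X] poly_piece_diff[OF poly_piece_0 poly_piece_one, of X]
    by (cases "even (card {y \<in> S. ord y < ord x})") (auto simp: ksign_def)
  from poly_piece_mult[OF this poly_piece_Var[OF assms]] show ?thesis by simp
qed

lemma boundary_piece:
  fixes act :: "('x, 'k::comm_ring_1) mpoly \<Rightarrow> 'a \<Rightarrow> 'a::ab_group_add"
  assumes "graded_action act X M" "S \<in> faces i" "\<And>T. T \<in> faces (Suc i) \<Longrightarrow> V T \<in> M d"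
  shows "boundary act V S \<in> M (d + 1)"
proof -
  interpret graded_action act X M by fact
  have "act (ksign x S * Var x) (V (insert x S)) \<in> M (1 + d)" if "x \<in> X - S" for x
    using that insert_face[OF assms(2) that]
    by (intro piece_act ksign_Var_piece assms(3)) auto
  then show ?thesis
    unfolding boundary_def add.commute[of d] by (rule piece_sum)
qed

text \<open>The contraction misses only the pair \<open>S = {}\<close>, \<open>\<mu> = 0\<close>, which involves no variable at all; this is
  the constant coefficient that the augmentation sees.\<close>

lemma koszul_exact:
  fixes V :: "'x set \<Rightarrow> ('x, 'k::comm_ring_1) mpoly"
  assumes V: "\<And>S. S \<in> faces i \<Longrightarrow> V S \<in> poly_piece X d"
    and cycle: "\<And>k S. i = Suc k \<Longrightarrow> S \<in> faces k \<Longrightarrow> boundary (*) V S = 0"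
    and aug: "i = 0 \<Longrightarrow> Poly_Mapping.lookup (V {}) 0 = 0"
    and S: "S \<in> faces i"
  shows "boundary (*) (contraction V) S = V S"
proof (rule poly_mapping_eqI)
  interpret P: graded_action "(*) :: ('x, 'k) mpoly \<Rightarrow> _" X "poly_piece X"
    by (rule graded_action_poly)
  fix \<mu>
  have SX: "S \<subseteq> X" using S by (simp add: faces_def)
  have hV: "contraction V T \<in> poly_piece X (d - 1)" if T: "T \<in> faces (Suc i)" for T
  proof -
    have TX: "T \<subseteq> X" and "T \<noteq> {}" and "finite T"
      using T finite_face[OF T] by (auto simp: faces_def)
    then have "T - {least T} \<in> faces i"
      using T least_in[OF TX] by (auto simp: faces_def)
    then show ?thesis
      unfolding contraction_def by (intro div_least_piece V)
  qed
  show "Poly_Mapping.lookup (boundary (*) (contraction V) S) \<mu> = Poly_Mapping.lookup (V S) \<mu>"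
  proof (cases "Poly_Mapping.keys \<mu> \<subseteq> X \<and> S \<union> Poly_Mapping.keys \<mu> \<noteq> {}")
    case True
    let ?z = "least (S \<union> Poly_Mapping.keys \<mu>)"
    have X: "S \<union> Poly_Mapping.keys \<mu> \<subseteq> X" using True SX by auto
    have "boundary (*) V (S - {?z}) = 0" if "?z \<in> S"
    proof (cases i)
      case 0
      then show ?thesis using S that by (simp add: faces_0)
    next
      case (Suc k)
      have "S - {?z} \<in> faces k"
        using S that Suc finite_face[OF S] by (auto simp: faces_def)
      then show ?thesis by (rule cycle[OF Suc])
    qed
    then show ?thesis
      using contraction_homotopy[OF SX, of \<mu> ?z V] True least_in[OF X] least_le[OF X] by auto
  next
    case False
    show ?thesis
    proof (cases "Poly_Mapping.keys \<mu> \<subseteq> X")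
      case True
      then have "S = {}" "\<mu> = 0" using False by auto
      moreover from this have "i = 0" using S by (auto simp: faces_def)
      ultimately show ?thesis using aug by (simp add: lookup_boundary)
    next
      case False
      have "boundary (*) (contraction V) S \<in> poly_piece X (d - 1 + 1)"
        by (rule boundary_piece[OF P.graded_action_axioms S hV])
      then have "Poly_Mapping.lookup (boundary (*) (contraction V) S) \<mu> = 0"
        using False unfolding poly_piece_iff by blast
      moreover have "Poly_Mapping.lookup (V S) \<mu> = 0"
        using V[OF S] False unfolding poly_piece_iff by blast
      ultimately show ?thesis by simp
    qed
  qed
qed

lemma module_residue: "module (residue_act :: ('x, 'k::comm_ring_1) mpoly \<Rightarrow> 'k \<Rightarrow> 'k)"
proof
  fix p q :: "('x, 'k) mpoly" and x :: 'k
  have "Poly_Mapping.lookup (p * q) 0 = Poly_Mapping.lookup p 0 * Poly_Mapping.lookup q 0"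
  proof -
    interpret c: coeff_hom "\<lambda>a::'k. a"
      by unfold_locales auto
    \<comment> \<open>the constant coefficient is the value at the origin, hence multiplicative\<close>
    have "subst_poly (\<lambda>a. a) (\<lambda>_. 0) r = Poly_Mapping.lookup r 0" for r :: "('x, 'k) mpoly"
    proof -
      have "mono_eval (\<lambda>_::'x. 0::'k) \<mu> = (if \<mu> = 0 then 1 else 0)" for \<mu>
      proof (cases "\<mu> = 0")
        case False
        then obtain x where x: "x \<in> Poly_Mapping.keys \<mu>"
          using poly_mapping_eqI[of \<mu> 0] by (auto simp: in_keys_iff)
        then have "(0::'k) ^ Poly_Mapping.lookup \<mu> x = 0"
          by (simp add: in_keys_iff zero_power)
        then have "mono_eval (\<lambda>_::'x. 0::'k) \<mu> = 0"
          unfolding mono_eval_def using x by (intro prod_zero finite_keys bexI[of _ x])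
        then show ?thesis using False by simp
      qed simp
      then have "subst_poly (\<lambda>a. a) (\<lambda>_. 0) r
          = (\<Sum>\<mu>\<in>Poly_Mapping.keys r. Poly_Mapping.lookup r \<mu> * (if \<mu> = 0 then 1 else 0))"
        by (simp add: subst_poly_def mono_eval_def[symmetric])
      then show ?thesis
        by (simp add: if_distrib[of "(*) _"] in_keys_iff cong: if_cong)
    qed
    then show ?thesis by (metis c.subst_poly_mult)
  qed
  then show "residue_act p (residue_act q x) = residue_act (p * q) x"
    by (simp add: residue_act_def mult.assoc)
qed (auto simp: residue_act_def algebra_simps lookup_add)

lemma koszul_resolution:
  "graded_free_resolution X (residue_act :: ('x, 'k::comm_ring_1) mpoly \<Rightarrow> _) residue_piece koszul_complex"
proof -
  interpret P: graded_action "(*) :: ('x, 'k) mpoly \<Rightarrow> _" X "poly_piece X"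
    by (rule graded_action_poly)
  let ?C = "koszul_complex :: ('x, 'k, 'k) free_complex"
  let ?T = "tensor_piece (poly_piece X :: int \<Rightarrow> ('x, 'k) mpoly set) (koszul_complex :: ('x, 'k, 'k) free_complex)"
  have card_0: "card (faces 0) = 1" and enum_0: "enum 0 0 = {}"
    using enum_face[of 0 0] by (auto simp: faces_0)
  have aug: "augmentation residue_act koszul_complex (chain_vec 0 V) = Poly_Mapping.lookup (V {}) 0"
    for V :: "'x set \<Rightarrow> ('x, 'k) mpoly"
    by (simp add: augmentation_def koszul_complex_def card_0 chain_vec_def enum_0 residue_act_def)
  have mat: "fc_mat (koszul_complex :: ('x, 'k, 'k) free_complex) i a b \<in> poly_piece X 1" for i a b
  proof -
    show ?thesis
      by (auto simp: koszul_complex_def intro!: poly_piece_sum ksign_Var_piece)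
  qed
  have exact: "v \<in> tensor_diff (*) koszul_complex i ` ?T (Suc i) j"
    if v: "v \<in> ?T i j"
      and cycle: "\<And>k. i = Suc k \<Longrightarrow> tensor_diff (*) koszul_complex k v = 0"
      and "i = 0 \<Longrightarrow> augmentation residue_act koszul_complex v = 0" for v i j
  proof -
    define V where "V S = v (position S)" for S
    have v_eq: "v = chain_vec i V"
      unfolding V_def using chain_vec_position[OF v] by simp
    have V: "V S \<in> poly_piece X (j - int i)" if "S \<in> faces i" for S
      using v that unfolding v_eq chain_vec_piece_iff by blast
    have "chain_vec i (boundary (*) (contraction V)) = v"
      unfolding v_eq chain_vec_eq_iff
    proof
      fix S assume "S \<in> faces i"
      then show "boundary (*) (contraction V) S = V S"
      proof (rule koszul_exact[rotated 3])
        show "boundary (*) V S' = 0" if "i = Suc k" "S' \<in> faces k" for k S'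
        proof -
          have "chain_vec k (boundary (*) V) = 0"
            using cycle[OF that(1)] unfolding v_eq that(1) tensor_diff_chain_vec[OF module_mult] .
          then show ?thesis using that(2) unfolding chain_vec_eq_0_iff by blast
        qed
        show "Poly_Mapping.lookup (V {}) 0 = 0" if "i = 0"
          using \<open>i = 0 \<Longrightarrow> augmentation residue_act koszul_complex v = 0\<close> that aug[of V] v_eq by simp
      qed (rule V)
    qed
    moreover have "chain_vec (Suc i) (contraction V) \<in> ?T (Suc i) j"
      unfolding chain_vec_piece_iff
    proof
      fix T assume T: "T \<in> faces (Suc i)"
      have TX: "T \<subseteq> X" and "T \<noteq> {}" and "finite T"
        using T finite_face[OF T] by (auto simp: faces_def)
      then have "T - {least T} \<in> faces i"
        using T least_in[OF TX] by (auto simp: faces_def)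
      then have "contraction V T \<in> poly_piece X (j - int i - 1)"
        unfolding contraction_def by (intro div_least_piece V)
      then show "contraction V T \<in> poly_piece X (j - int (Suc i))"
        by (simp add: algebra_simps)
    qed
    ultimately show ?thesis
      using tensor_diff_chain_vec[OF module_mult, of i "contraction V"] by (metis image_eqI)
  qed
  have complex: "tensor_diff (*) koszul_complex i w \<in> ?T i j \<and>
      (\<forall>k. i = Suc k \<longrightarrow> tensor_diff (*) koszul_complex k (tensor_diff (*) koszul_complex i w) = 0) \<and>
      (i = 0 \<longrightarrow> augmentation residue_act koszul_complex (tensor_diff (*) koszul_complex i w) = 0)"
    if w: "w \<in> ?T (Suc i) j" for w i j
  proof -
    define W where "W S = w (position S)" for S
    have w_eq: "w = chain_vec (Suc i) W"
      unfolding W_def using chain_vec_position[OF w] by simp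
    have d: "tensor_diff (*) koszul_complex i w = chain_vec i (boundary (*) W)"
      unfolding w_eq by (rule tensor_diff_chain_vec[OF module_mult])
    have "boundary (*) W S \<in> poly_piece X (j - int i)" if "S \<in> faces i" for S
    proof -
      have "boundary (*) W S \<in> poly_piece X (j - int (Suc i) + 1)"
        using w unfolding w_eq chain_vec_piece_iff
        by (intro boundary_piece[OF P.graded_action_axioms that]) blast
      then show ?thesis by simp
    qed
    moreover have "boundary (*) (boundary (*) W) S = 0" if "S \<in> faces k" for k S
      using that by (intro boundary_boundary[OF module_mult]) (auto simp: faces_def)
    ultimately show ?thesis
      unfolding d by (auto simp: chain_vec_piece_iff tensor_diff_chain_vec[OF module_mult]
          chain_vec_eq_0_iff aug lookup_boundary)
  qed
  have onto: "augmentation residue_act koszul_complex ` ?T 0 j = residue_piece j" for j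
  proof
    show "augmentation residue_act koszul_complex ` ?T 0 j \<subseteq> residue_piece j"
    proof
      fix r assume "r \<in> augmentation residue_act koszul_complex ` ?T 0 j"
      then obtain v where v: "v \<in> ?T 0 j" "r = augmentation residue_act koszul_complex v" by blast
      define V where "V S = v (position S)" for S
      have v_eq: "v = chain_vec 0 V"
        unfolding V_def using chain_vec_position[OF v(1)] by simp
      have "V {} \<in> poly_piece X j"
        using v(1) unfolding v_eq chain_vec_piece_iff by (simp add: faces_0)
      then show "r \<in> residue_piece j"
        using v(2) by (auto simp: v_eq aug residue_piece_def poly_piece_iff)
    qed
    show "residue_piece j \<subseteq> augmentation residue_act koszul_complex ` ?T 0 j"
    proof
      fix r :: 'k assume r: "r \<in> residue_piece j"
      have "chain_vec 0 (\<lambda>_. Poly_Mapping.single 0 r) \<in> ?T 0 j"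
        using r by (auto simp: chain_vec_piece_iff residue_piece_def poly_piece_single split: if_splits)
      moreover have "r = augmentation residue_act koszul_complex (chain_vec 0 (\<lambda>_. Poly_Mapping.single 0 r))"
        by (simp add: aug)
      ultimately show "r \<in> augmentation residue_act koszul_complex ` ?T 0 j" by blast
    qed
  qed
  have shift: "fc_shift (koszul_complex :: ('x, 'k, 'k) free_complex) i a = int i"
    and aug_1: "fc_aug (koszul_complex :: ('x, 'k, 'k) free_complex) a = 1" for i a
    by (simp_all add: koszul_complex_def)
  show ?thesis
    unfolding graded_free_resolution_def
  proof (intro conjI allI impI)
    show "fc_mat ?C i a b \<in> poly_piece X (fc_shift ?C (Suc i) b
        - fc_shift ?C i a)" for i a b
      using mat[of i a b] by (simp add: shift)
    show "fc_aug ?C a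
        \<in> residue_piece (fc_shift ?C 0 a)" for a
      by (simp add: shift residue_piece_def)
    show "augmentation residue_act ?C ` ?T 0 j = residue_piece j" for j
      by (rule onto)
    show "{v \<in> ?T 0 j. augmentation residue_act ?C v = 0} = tensor_diff (*) ?C 0 ` ?T 1 j" for j
      using exact[of _ 0 j] complex[of _ 0 j] by auto
    show "{v \<in> ?T (Suc i) j. tensor_diff (*) ?C i v = 0}
        = tensor_diff (*) ?C (Suc i) ` ?T (Suc (Suc i)) j" for i j
      using exact[of _ "Suc i" j] complex[of _ "Suc i" j] by auto
  qed
qed

end

lemma residue_resolution_resolution:
  assumes "finite X"
  shows "graded_free_resolution X (residue_act :: ('x, 'k::comm_ring_1) mpoly \<Rightarrow> _) residue_piece (residue_resolution X)"
proof -
  obtain ord :: "'x \<Rightarrow> nat" where "inj_on ord X"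
    using finite_imp_inj_to_nat_seg[OF assms] by blast
  then interpret koszul X ord
    using assms by unfold_locales
  show ?thesis
    unfolding residue_resolution_def using koszul_resolution by (rule someI)
qed

section \<open>Betti numbers\<close>

text \<open>The finite spanning set matters: \<open>dim\<close> is \<open>0\<close> by convention for spaces without a finite basis.\<close>

lemma (in vector_space) dim_less:
  assumes "subspace W" "W \<subseteq> V" "z \<in> V" "z \<notin> W" "V \<subseteq> span B" "finite B"
  shows "dim W < dim V"
proof -
  obtain C where C: "C \<subseteq> W" "independent C" "W \<subseteq> span C" "card C = dim W"
    using basis_exists by blast
  have "span C \<subseteq> W" using C(1) assms(1) by (simp add: span_minimal)
  then have "z \<notin> span C" using assms(4) by blast
  then have ind: "independent (insert z C)" using C(2) by (simp add: independent_insert)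
  obtain D where D: "insert z C \<subseteq> D" "D \<subseteq> V" "independent D" "V \<subseteq> span D"
    using maximal_independent_subset_extend[OF _ ind, of V] C(1) assms(2,3) by blast
  have "finite D" using independent_span_bound[OF assms(6) D(3)] D(2) assms(5) by blast
  have "z \<notin> C" using \<open>z \<notin> span C\<close> span_base by blast
  have "dim W < card (insert z C)"
    using \<open>finite D\<close> D(1) \<open>z \<notin> C\<close> C(4) finite_subset[of C D] by auto
  also have "\<dots> \<le> card D" using \<open>finite D\<close> D(1) by (intro card_mono)
  also have "card D = dim V" using dim_eq_card[of D V] D span_mono[OF D(2)] span_minimal[of V "span D"]
    by (metis span_eq subset_antisym span_span subspace_span)
  finally show ?thesis .
qed

lemma Const_add: "Const (a + b) = Const a + Const b"
  by (simp add: Const_def single_add)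

lemma Const_mult: "Const (a * b :: 'k::comm_ring_1) = Const a * Const b"
  by (simp add: Const_def mult_single)

lemma Const_1: "Const 1 = 1"
  by (simp add: Const_def)

lemma Const_piece: "Const a \<in> poly_piece X 0"
  unfolding Const_def by (rule poly_piece_single) auto

lemma resolution_tensor_diff_tensor_diff:
  fixes G :: "('x, 'k::comm_ring_1, 'n::comm_monoid_add) free_complex"
  assumes G: "graded_free_resolution X act N G" and M: "module actM"
  shows "tensor_diff actM G i (tensor_diff actM G (Suc i) v) = 0"
proof -
  interpret module actM by (rule M)
  have "(\<Sum>k<fc_rank G (Suc i). fc_mat G i a k * fc_mat G (Suc i) k b) = 0"
    if "a < fc_rank G i" "b < fc_rank G (Suc (Suc i))" for a b
  proof -
    have "tensor_diff (*) G i (mat_col (fc_rank G (Suc i)) (fc_mat G (Suc i)) b) a = 0"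
      using mat_col_cycle(2)[OF G that(2)] by (simp add: res_cycle_def)
    then show ?thesis using that(1) by (simp add: tensor_diff_def mat_col_def)
  qed
  then have "mat_vec actM (fc_rank G i) (fc_rank G (Suc (Suc i)))
      (\<lambda>a b. \<Sum>k<fc_rank G (Suc i). fc_mat G i a k * fc_mat G (Suc i) k b) v
    = mat_vec actM (fc_rank G i) (fc_rank G (Suc (Suc i))) (\<lambda>a b. 0) v"
    by (intro mat_vec_cong)
  then show ?thesis
    unfolding tensor_diff_mat_vec mat_vec_comp by (simp add: mat_vec_def fun_eq_iff)
qed

lemma betti_eq_0: "tor_cycles X act M i j = tor_boundaries X act M i j \<Longrightarrow> betti X act M i j = 0"
  by (simp add: betti_def Let_def)

context graded_action
begin

lemma tensor_diff_piece:
  fixes G :: "('x, 'k, 'n::comm_monoid_add) free_complex"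
  assumes "graded_free_resolution X actN N G" "v \<in> tensor_piece M G (Suc i) j"
  shows "tensor_diff act G i v \<in> tensor_piece M G i j"
  unfolding tensor_diff_mat_vec
  by (rule mat_vec_piece) (use assms resolution_mat in blast)+

lemma tor_boundaries_subset:
  assumes "finite X"
  shows "tor_boundaries X act M i j \<subseteq> tor_cycles X act M i j"
proof -
  have G: "graded_free_resolution X residue_act residue_piece (residue_resolution X :: ('x, 'k, 'k) free_complex)"
    by (rule residue_resolution_resolution[OF assms])
  have "tensor_diff act (residue_resolution X :: ('x, 'k, 'k) free_complex) (i - 1)
      (tensor_diff act (residue_resolution X) i v) = 0" if "i > 0" for v
    using resolution_tensor_diff_tensor_diff[OF G module_axioms, of "i - 1" v] that by simp
  then show ?thesis
    using tensor_diff_piece[OF G] by (auto simp: tor_boundaries_def tor_cycles_def)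
qed

end

text \<open>Since \<open>betti\<close> is a truncated difference of dimensions, a cycle that is not a boundary makes it
  positive only because the cycles form a finite-dimensional space.\<close>

lemma betti_nonzero:
  fixes act :: "('x, 'k::field) mpoly \<Rightarrow> 'a::ab_group_add \<Rightarrow> 'a"
  assumes M: "graded_action act X M" and "finite X"
    and fin: "\<And>d. \<exists>B. finite B \<and> M d \<subseteq> module.span (\<lambda>c. act (Const c)) B"
    and z: "z \<in> tor_cycles X act M i j" "z \<notin> tor_boundaries X act M i j"
  shows "betti X act M i j \<noteq> 0"
proof -
  interpret graded_action act X M by (rule M)
  let ?G = "residue_resolution X :: ('x, 'k, 'k) free_complex"
  let ?s = "\<lambda>(c::'k) (v::nat \<Rightarrow> 'a) a. act (Const c) (v a)"
  interpret coeffs: vector_space "\<lambda>c. act (Const c)"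
    by unfold_locales (simp_all add: algebra_simps Const_add Const_mult Const_1)
  interpret chains: vector_space ?s
    by unfold_locales (simp_all add: algebra_simps Const_add Const_mult Const_1 fun_eq_iff)
  have "chains.subspace (tor_boundaries X act M i j)"
  proof (rule chains.subspaceI)
    show "0 \<in> tor_boundaries X act M i j"
      unfolding tor_boundaries_def tensor_diff_mat_vec
      by (rule image_eqI[of _ _ "\<lambda>_. 0"]) (auto simp: tensor_piece_def piece_0 zero_fun_def)
    show "v + w \<in> tor_boundaries X act M i j"
      if vw: "v \<in> tor_boundaries X act M i j" "w \<in> tor_boundaries X act M i j" for v w
    proof -
      obtain v' w' where v': "v' \<in> tensor_piece M ?G (Suc i) j" "v = tensor_diff act ?G i v'"
        and w': "w' \<in> tensor_piece M ?G (Suc i) j" "w = tensor_diff act ?G i w'"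
        using vw by (auto simp: tor_boundaries_def)
      have "v + w = tensor_diff act ?G i (v' + w')"
        using v'(2) w'(2) by (auto simp: tensor_diff_def fun_eq_iff algebra_simps sum.distrib)
      moreover have "v' + w' \<in> tensor_piece M ?G (Suc i) j"
        using v'(1) w'(1) by (auto simp: tensor_piece_def piece_add)
      ultimately show ?thesis by (auto simp: tor_boundaries_def)
    qed
    show "?s c v \<in> tor_boundaries X act M i j" if v: "v \<in> tor_boundaries X act M i j" for c v
    proof -
      obtain v' where v': "v' \<in> tensor_piece M ?G (Suc i) j" "v = tensor_diff act ?G i v'"
        using v by (auto simp: tor_boundaries_def)
      have "?s c v = tensor_diff act ?G i (?s c v')"
        using v'(2) by (auto simp: tensor_diff_def fun_eq_iff scale_sum_right mult.commute)
      moreover have "?s c v' \<in> tensor_piece M ?G (Suc i) j"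
        using v'(1) piece_act[OF Const_piece] by (auto simp: tensor_piece_def)
      ultimately show ?thesis by (auto simp: tor_boundaries_def)
    qed
  qed
  moreover obtain B where B: "\<And>d. finite (B d) \<and> M d \<subseteq> coeffs.span (B d)"
    using fin by metis
  define single where "single a f = (\<lambda>a'. if a' = a then f else 0)" for a :: nat and f :: 'a
  let ?C = "\<Union>a < fc_rank ?G i. single a ` B (j - fc_shift ?G i a)"
  have "tor_cycles X act M i j \<subseteq> chains.span ?C"
  proof
    fix v assume "v \<in> tor_cycles X act M i j"
    then have v: "v \<in> tensor_piece M ?G i j" by (simp add: tor_cycles_def)
    have "single a (v a) \<in> chains.span ?C" if a: "a < fc_rank ?G i" for a
    proof -
      interpret single: module_hom "\<lambda>c. act (Const c)" ?s "single a"
        by unfold_locales (auto simp: single_def fun_eq_iff)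
      have "v a \<in> coeffs.span (B (j - fc_shift ?G i a))"
        using v a B by (auto simp: tensor_piece_def)
      then have "single a (v a) \<in> chains.span (single a ` B (j - fc_shift ?G i a))"
        unfolding single.span_image by blast
      then show ?thesis
        using chains.span_mono[of "single a ` B (j - fc_shift ?G i a)" ?C] a by blast
    qed
    then have "(\<Sum>a < fc_rank ?G i. single a (v a)) \<in> chains.span ?C"
      by (intro chains.span_sum) auto
    moreover have "(\<Sum>a < fc_rank ?G i. single a (v a)) = v"
    proof
      fix a
      have "(\<Sum>a < n. single a (v a)) a' = (if a' < n then v a' else 0)" for n a'
        by (induction n) (auto simp: single_def less_Suc_eq)
      then show "(\<Sum>a < fc_rank ?G i. single a (v a)) a = v a"
        using v by (auto simp: tensor_piece_def)
    qed
    ultimately show "v \<in> chains.span ?C" by simp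
  qed
  moreover have "finite ?C" using B by auto
  ultimately have "chains.dim (tor_boundaries X act M i j) < chains.dim (tor_cycles X act M i j)"
    using chains.dim_less[OF _ tor_boundaries_subset[OF \<open>finite X\<close>] z] by blast
  then show ?thesis
    by (simp add: betti_def Let_def)
qed

text \<open>The Betti numbers refer to an unspecified resolution of \<open>K\<close>. Since the Koszul complex is linear,
  a class exhibited there can be transported to it.\<close>

lemma (in koszul) regularity_ge:
  fixes act :: "('x, 'k::field) mpoly \<Rightarrow> 'a::ab_group_add \<Rightarrow> 'a"
  assumes M: "graded_action act X M"
    and fin: "\<And>d. \<exists>B. finite B \<and> M d \<subseteq> module.span (\<lambda>c. act (Const c)) B"
    and z: "z \<in> tensor_piece M (koszul_complex :: ('x, 'k, 'k) free_complex) i j" "i > 0 \<Longrightarrow> tensor_diff act koszul_complex (i - 1) z = 0"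
      "z \<notin> tensor_diff act koszul_complex i ` tensor_piece M (koszul_complex :: ('x, 'k, 'k) free_complex) (Suc i) j"
  shows "regularity X act M \<ge> ereal (real_of_int (j - int i))"
proof -
  obtain z' where z': "z' \<in> tensor_piece M (residue_resolution X :: ('x, 'k, 'k) free_complex) i j"
      "i > 0 \<Longrightarrow> tensor_diff act (residue_resolution X) (i - 1) z' = 0"
      "z' \<notin> tensor_diff act (residue_resolution X) i ` tensor_piece M (residue_resolution X :: ('x, 'k, 'k) free_complex) (Suc i) j"
    by (rule linear_resolution_class_survives[OF module_residue koszul_resolution
        residue_resolution_resolution[OF finite_X] _ M z]) (auto simp: koszul_complex_def)
  then have "betti X act M i j \<noteq> 0"
    by (intro betti_nonzero[OF M finite_X fin, where z = z'])
      (auto simp: tor_cycles_def tor_boundaries_def)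
  then show ?thesis
    unfolding regularity_def by (intro Sup_upper) blast
qed

section \<open>Rees algebras of edge ideals\<close>

lemma ideal_generated_induct [consumes 1, case_names zero add mult]:
  assumes "f \<in> ideal_generated R B" and "Q 0" and "\<And>f g. Q f \<Longrightarrow> Q g \<Longrightarrow> Q (f + g)"
    and "\<And>r b. r \<in> R \<Longrightarrow> b \<in> B \<Longrightarrow> Q (r * b)"
  shows "Q f"
proof -
  obtain F r where F: "f = (\<Sum>b\<in>F. r b * b)" "finite F" "F \<subseteq> B" "\<forall>b\<in>F. r b \<in> R"
    using assms(1) by (auto simp: ideal_generated_def)
  from F(2-4) have "Q (\<Sum>b\<in>F. r b * b)"
    by (induction F rule: finite_induct) (auto intro: assms(2-))
  with F(1) show ?thesis by simp
qed

lemma ideal_generated_0: "0 \<in> ideal_generated R B"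
  unfolding ideal_generated_def by (auto intro!: exI[of _ "{}"])

lemma ideal_generated_gen: "r \<in> R \<Longrightarrow> b \<in> B \<Longrightarrow> r * b \<in> ideal_generated R B"
  unfolding ideal_generated_def by (auto intro!: exI[of _ "{b}"] exI[of _ "\<lambda>_. r"])

lemma ideal_generated_add:
  fixes R :: "'a::comm_ring_1 set"
  assumes R: "0 \<in> R" "\<And>a b. a \<in> R \<Longrightarrow> b \<in> R \<Longrightarrow> a + b \<in> R"
    and f: "f \<in> ideal_generated R B" and g: "g \<in> ideal_generated R B"
  shows "f + g \<in> ideal_generated R B"
proof -
  obtain F r where F: "f = (\<Sum>b\<in>F. r b * b)" "finite F" "F \<subseteq> B" "\<forall>b\<in>F. r b \<in> R"
    using f by (auto simp: ideal_generated_def)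
  obtain G s where G: "g = (\<Sum>b\<in>G. s b * b)" "finite G" "G \<subseteq> B" "\<forall>b\<in>G. s b \<in> R"
    using g by (auto simp: ideal_generated_def)
  define t where "t b = (if b \<in> F then r b else 0) + (if b \<in> G then s b else 0)" for b
  have "(\<Sum>b\<in>F. r b * b) = (\<Sum>b\<in>F \<union> G. (if b \<in> F then r b else 0) * b)"
    using F(2) G(2) by (intro sum.mono_neutral_cong_left) auto
  moreover have "(\<Sum>b\<in>G. s b * b) = (\<Sum>b\<in>F \<union> G. (if b \<in> G then s b else 0) * b)"
    using F(2) G(2) by (intro sum.mono_neutral_cong_left) auto
  ultimately have "f + g = (\<Sum>b\<in>F \<union> G. t b * b)"
    by (simp add: F(1) G(1) t_def distrib_right sum.distrib)
  moreover have "\<forall>b\<in>F \<union> G. t b \<in> R"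
    using F(4) G(4) R by (auto simp: t_def)
  ultimately show ?thesis
    using F(2,3) G(2,3) unfolding ideal_generated_def
    by (intro CollectI exI[of _ "F \<union> G"] exI[of _ t]) auto
qed

lemma ideal_generated_mult:
  fixes R :: "'a::comm_ring_1 set"
  assumes R: "0 \<in> R" "\<And>a b. a \<in> R \<Longrightarrow> b \<in> R \<Longrightarrow> a + b \<in> R" "\<And>a b. a \<in> R \<Longrightarrow> b \<in> R \<Longrightarrow> a * b \<in> R"
    and "r \<in> R" and f: "f \<in> ideal_generated R B"
  shows "r * f \<in> ideal_generated R B"
  using f
proof (induction rule: ideal_generated_induct)
  case zero
  show ?case by (simp add: ideal_generated_0)
next
  case (add f g)
  then show ?case using ideal_generated_add[OF R(1,2)] by (simp add: distrib_left)
next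
  case (mult s b)
  then show ?case using ideal_generated_gen[OF R(3)[OF \<open>r \<in> R\<close>]] by (simp add: mult.assoc[symmetric])
qed

lemma polys_add: "p \<in> polys X \<Longrightarrow> q \<in> polys X \<Longrightarrow> p + q \<in> polys X"
  unfolding polys_def using keys_add[of p q] by blast

lemma polys_0: "0 \<in> polys X"
  by (simp add: polys_def)

lemma polys_mult: "(p :: ('x, 'k::comm_ring_1) mpoly) \<in> polys X \<Longrightarrow> q \<in> polys X \<Longrightarrow> p * q \<in> polys X"
  unfolding polys_def using keys_mult[of p q] by (fastforce simp: keys_add_nat)

lemma polys_single: "Poly_Mapping.keys \<mu> \<subseteq> X \<Longrightarrow> Poly_Mapping.single \<mu> a \<in> polys X"
  by (simp add: polys_def)

lemma polys_1: "1 \<in> polys X"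
  unfolding single_one[symmetric] by (rule polys_single) simp

text \<open>The exponent vector of the squarefree monomial \<open>\<Prod>i\<in>e. x\<^sub>i\<close>.\<close>

definition set_monomial :: "'x set \<Rightarrow> 'x \<Rightarrow>\<^sub>0 nat" where
  "set_monomial e = (\<Sum>i\<in>e. Poly_Mapping.single i 1)"

lemma lookup_set_monomial: "finite e \<Longrightarrow> Poly_Mapping.lookup (set_monomial e) i = (if i \<in> e then 1 else 0)"
  by (simp add: set_monomial_def lookup_sum lookup_single when_def)

lemma keys_set_monomial: "finite e \<Longrightarrow> Poly_Mapping.keys (set_monomial e) = e"
  by (auto simp: in_keys_iff lookup_set_monomial split: if_splits)

lemma mdeg_set_monomial: "finite e \<Longrightarrow> mdeg (set_monomial e) = card e"
  by (simp add: mdeg_def keys_set_monomial lookup_set_monomial)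

lemma prod_Var: "finite e \<Longrightarrow> (\<Prod>i\<in>e. Var i :: ('x, 'k::comm_ring_1) mpoly) = Poly_Mapping.single (set_monomial e) 1"
  by (induction e rule: finite_induct) (auto simp: set_monomial_def Var_def mult_single)

lemma edge_props:
  assumes "simple_graph n E" "e \<in> E"
  shows "e \<subseteq> {1..n}" "finite e" "card e = 2" "n + 1 \<notin> e"
proof -
  show sub: "e \<subseteq> {1..n}" and "card e = 2"
    using assms by (auto simp: simple_graph_def)
  from sub show "finite e" "n + 1 \<notin> e"
    using finite_subset[of e "{1..n}"] by auto
qed

lemma edge_ideal_gen:
  assumes "e \<in> E" "p \<in> polys {1..n}"
  shows "p * (\<Prod>i\<in>e. Var i) \<in> edge_ideal n E"
  unfolding edge_ideal_def by (rule ideal_generated_gen) (use assms in auto)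

lemma ideal_power_closed:
  fixes I :: "(nat, 'k::comm_ring_1) mpoly set"
  shows "0 \<in> ideal_power (polys X) I s"
    and "f \<in> ideal_power (polys X) I s \<Longrightarrow> g \<in> ideal_power (polys X) I s \<Longrightarrow> f + g \<in> ideal_power (polys X) I s"
    and "p \<in> polys X \<Longrightarrow> f \<in> ideal_power (polys X) I s \<Longrightarrow> p * f \<in> ideal_power (polys X) I s"
    by (cases s; simp add: polys_0 polys_add polys_mult ideal_generated_0 ideal_generated_add ideal_generated_mult)+

lemma ideal_power_Suc:
  fixes I :: "(nat, 'k::comm_ring_1) mpoly set"
  assumes "q \<in> I" "f \<in> ideal_power (polys X) I s"
  shows "q * f \<in> ideal_power (polys X) I (Suc s)"
proof -
  have "1 * (q * f) \<in> ideal_generated (polys X) {a * b | a b. a \<in> I \<and> b \<in> ideal_power (polys X) I s}"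
    by (rule ideal_generated_gen) (use assms polys_1 in auto)
  then show ?thesis by simp
qed

text \<open>Every monomial of \<open>I\<^sup>s\<close> is a product of \<open>s\<close> edges and a further monomial. Conditions \<open>P s\<close> that
  are stable under multiplication can therefore be checked by adding one edge at a time; they will be
  degree bounds and divisibility by an edge.\<close>

lemma ideal_power_keys:
  fixes f :: "(nat, 'k::comm_ring_1) mpoly"
  assumes G: "simple_graph n E"
    and P_0: "\<And>\<mu>. P 0 \<mu>"
    and P_add: "\<And>s \<mu> \<nu>. P s \<mu> \<Longrightarrow> P s (\<mu> + \<nu>)"
    and P_edge: "\<And>e s \<mu>. e \<in> E \<Longrightarrow> P s \<mu> \<Longrightarrow> P (Suc s) (set_monomial e + \<mu>)"
    and f: "f \<in> ideal_power (polys {1..n}) (edge_ideal n E) s" and \<mu>: "\<mu> \<in> Poly_Mapping.keys f"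
  shows "P s \<mu>"
  using f \<mu>
proof (induction s arbitrary: f \<mu>)
  case 0
  show ?case by (rule P_0)
next
  case (Suc s)
  have edge_keys: "\<exists>e\<in>E. \<exists>\<nu>. \<rho> = set_monomial e + \<nu>"
    if "a \<in> edge_ideal n E" "\<rho> \<in> Poly_Mapping.keys a" for a :: "(nat, 'k) mpoly" and \<rho>
    using that unfolding edge_ideal_def
  proof (induction arbitrary: \<rho> rule: ideal_generated_induct)
    case (add f g)
    then show ?case using keys_add[of f g] by blast
  next
    case (mult r b)
    then obtain e where e: "e \<in> E" "b = (\<Prod>i\<in>e. Var i)" by auto
    then have "b = Poly_Mapping.single (set_monomial e) 1"
      using prod_Var edge_props(2)[OF G] by auto
    then obtain \<nu> where "\<rho> = \<nu> + set_monomial e"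
      using mult.prems keys_mult[of r b] by auto
    then show ?case
      using e(1) by (metis add.commute)
  qed simp
  have "\<forall>\<mu>\<in>Poly_Mapping.keys f. P (Suc s) \<mu>"
    using Suc.prems(1) unfolding ideal_power.simps
  proof (induction rule: ideal_generated_induct)
    case (add f g)
    then show ?case using keys_add[of f g] by blast
  next
    case (mult r c)
    then obtain a b where ab: "c = a * b" "a \<in> edge_ideal n E" "b \<in> ideal_power (polys {1..n}) (edge_ideal n E) s"
      by auto
    show ?case
    proof
      fix \<mu> assume "\<mu> \<in> Poly_Mapping.keys (r * c)"
      then obtain \<nu> \<rho> where 1: "\<mu> = \<nu> + \<rho>" "\<rho> \<in> Poly_Mapping.keys c"
        using keys_mult[of r c] by auto
      then obtain \<sigma> \<tau> where 2: "\<rho> = \<sigma> + \<tau>" "\<sigma> \<in> Poly_Mapping.keys a" "\<tau> \<in> Poly_Mapping.keys b"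
        using keys_mult[of a b] ab by auto
      obtain e \<kappa> where e: "e \<in> E" "\<sigma> = set_monomial e + \<kappa>"
        using edge_keys[OF ab(2) 2(2)] by blast
      have "P (Suc s) (set_monomial e + \<tau> + (\<kappa> + \<nu>))"
        by (intro P_add P_edge e(1) Suc.IH[OF ab(3) 2(3)])
      then show "P (Suc s) \<mu>"
        by (simp add: 1 2 e add_ac)
    qed
  qed simp
  then show ?case using Suc.prems(2) by blast
qed

lemma coeff_hom_Const: "coeff_hom (\<lambda>c::'k::comm_ring_1. [:Const c :: (nat, 'k) mpoly:])"
  by unfold_locales (auto simp: Const_def single_add mult_single one_pCons mult.commute)

lemma module_rees: "module (rees_act n :: (nat set, 'k::comm_ring_1) mpoly \<Rightarrow> _)"
proof -
  interpret coeff_hom "\<lambda>c::'k. [:Const c :: (nat, 'k) mpoly:]" by (rule coeff_hom_Const)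
  show ?thesis
    by unfold_locales (auto simp: rees_act_def algebra_simps subst_poly_add subst_poly_mult subst_poly_1)
qed

lemma rees_act_Var: "rees_act n (Var e :: (nat set, 'k::comm_ring_1) mpoly) f = rees_gen n e * f"
proof -
  interpret coeff_hom "\<lambda>c::'k. [:Const c :: (nat, 'k) mpoly:]" by (rule coeff_hom_Const)
  show ?thesis by (simp add: rees_act_def subst_poly_Var)
qed

lemma rees_act_Const: "rees_act n (Const a :: (nat set, 'k::comm_ring_1) mpoly) f = smult (Const a) f"
proof -
  interpret coeff_hom "\<lambda>c::'k. [:Const c :: (nat, 'k) mpoly:]" by (rule coeff_hom_Const)
  have "subst_poly (\<lambda>c. [:Const c:]) (rees_gen n) (Const a) = [:Const a :: (nat, 'k) mpoly:]"
    using subst_poly_single[of "rees_gen n" 0 a] by (simp add: Const_def)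
  then show ?thesis by (simp add: rees_act_def)
qed

lemma rees_gen_edge:
  "simple_graph n E \<Longrightarrow> e \<in> E \<Longrightarrow> rees_gen n e = monom (\<Prod>i\<in>e. Var i) 1"
  using edge_props(4)[of n E e] by (simp add: rees_gen_def)

lemma rees_gen_vertex: "i \<in> {1..n} \<Longrightarrow> rees_gen n {i, n + 1} = monom (Var i) 0"
proof -
  assume "i \<in> {1..n}"
  then have "{i, n + 1} - {n + 1} = {i}" by auto
  then show ?thesis by (simp add: rees_gen_def)
qed

lemma rees_piece_add:
  fixes I :: "(nat, 'k::comm_ring_1) mpoly set"
  assumes "f \<in> rees_piece n I j" "g \<in> rees_piece n I j"
  shows "f + g \<in> rees_piece n I j"
  using assms by (auto simp: rees_piece_def rees_algebra_def ideal_power_closed poly_piece_add)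

lemma rees_piece_0: "0 \<in> rees_piece n (I :: (nat, 'k::comm_ring_1) mpoly set) j"
  by (auto simp: rees_piece_def rees_algebra_def ideal_power_closed)

lemma rees_gen_mult_piece:
  fixes f :: "(nat, 'k::comm_ring_1) mpoly poly"
  assumes G: "simple_graph n E" and e: "e \<in> cone_edges n E"
    and f: "f \<in> rees_piece n (edge_ideal n E) j"
  shows "rees_gen n e * f \<in> rees_piece n (edge_ideal n E) (1 + j)"
  using e unfolding cone_edges_def
proof (elim UnE)
  assume e: "e \<in> E"
  let ?q = "\<Prod>i\<in>e. Var i :: (nat, 'k) mpoly"
  have "?q \<in> poly_piece {1..n} 2"
    using edge_props[OF G e] by (auto simp: prod_Var keys_set_monomial mdeg_set_monomial intro!: poly_piece_single)
  then have "?q * coeff f s \<in> poly_piece {1..n} (2 + (j + int s))" for s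
    using f by (intro poly_piece_mult) (auto simp: rees_piece_def)
  moreover have "?q \<in> edge_ideal n E"
    using edge_ideal_gen[OF e polys_1] by simp
  then have "?q * coeff f s \<in> ideal_power (polys {1..n}) (edge_ideal n E) (Suc s)" for s
    using f by (intro ideal_power_Suc) (auto simp: rees_piece_def rees_algebra_def)
  moreover have "coeff (rees_gen n e * f) s = (case s of 0 \<Rightarrow> 0 | Suc s \<Rightarrow> ?q * coeff f s)" for s
    by (simp add: rees_gen_edge[OF G e] coeff_monom_mult split: nat.split)
  ultimately show ?thesis
    by (auto simp: rees_piece_def rees_algebra_def ideal_power_closed(1) split: nat.split
        simp del: ideal_power.simps)
next
  assume "e \<in> {{i, n + 1} |i. i \<in> {1..n}}"
  then obtain i where i: "i \<in> {1..n}" "e = {i, n + 1}" by blast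
  have "Var i * coeff f s \<in> poly_piece {1..n} (1 + (j + int s))" for s
    using f i by (intro poly_piece_mult poly_piece_Var) (auto simp: rees_piece_def)
  moreover have "Var i \<in> polys {1..n}"
    unfolding Var_def using i by (intro polys_single) auto
  then have "Var i * coeff f s \<in> ideal_power (polys {1..n}) (edge_ideal n E) s" for s
    using f by (intro ideal_power_closed) (auto simp: rees_piece_def rees_algebra_def)
  moreover have "coeff (rees_gen n e * f) s = Var i * coeff f s" for s
    unfolding i(2) rees_gen_vertex[OF i(1)] by (simp add: coeff_monom_mult)
  ultimately show ?thesis
    by (simp add: rees_piece_def rees_algebra_def add.assoc)
qed

lemma mono_eval_piece:
  assumes step: "\<And>x f j. x \<in> X \<Longrightarrow> f \<in> M j \<Longrightarrow> u x * f \<in> M (1 + j)"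
    and "Poly_Mapping.keys \<mu> \<subseteq> X" "f \<in> M j"
  shows "mono_eval u \<mu> * f \<in> M (int (mdeg \<mu>) + j)"
proof -
  have power: "u x ^ k * f \<in> M (int k + j)" if "x \<in> X" "f \<in> M j" for x k f j
  proof (induction k)
    case (Suc k)
    from step[OF that(1) Suc] show ?case by (simp add: mult.assoc add.assoc)
  qed (use that in simp)
  have "(\<Prod>x\<in>A. u x ^ Poly_Mapping.lookup \<mu> x) * f \<in> M (int (\<Sum>x\<in>A. Poly_Mapping.lookup \<mu> x) + j)"
    if "finite A" "A \<subseteq> X" for A
    using that
  proof (induction A rule: finite_induct)
    case (insert x A)
    then have "u x ^ Poly_Mapping.lookup \<mu> x * ((\<Prod>x\<in>A. u x ^ Poly_Mapping.lookup \<mu> x) * f)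
        \<in> M (int (Poly_Mapping.lookup \<mu> x) + (int (\<Sum>x\<in>A. Poly_Mapping.lookup \<mu> x) + j))"
      by (intro power) auto
    then show ?case using insert.hyps by (simp add: mult.assoc add.assoc)
  qed (use assms in simp)
  from this[OF finite_keys assms(2)] show ?thesis
    by (simp add: mono_eval_def mdeg_def)
qed

lemma graded_action_rees:
  assumes G: "simple_graph n E"
  shows "graded_action (rees_act n :: (nat set, 'k::comm_ring_1) mpoly \<Rightarrow> _)
    (cone_edges n E) (rees_piece n (edge_ideal n E))"
proof (intro graded_action.intro graded_action_axioms.intro module_rees rees_piece_add rees_piece_0)
  interpret coeff_hom "\<lambda>c::'k. [:Const c :: (nat, 'k) mpoly:]" by (rule coeff_hom_Const)
  let ?M = "rees_piece n (edge_ideal n E :: (nat, 'k) mpoly set)"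
  fix p :: "(nat set, 'k) mpoly" and d f j
  assume p: "p \<in> poly_piece (cone_edges n E) d" and f: "f \<in> ?M j"
  have "rees_act n p f = (\<Sum>\<mu>\<in>Poly_Mapping.keys p.
      smult (Const (Poly_Mapping.lookup p \<mu>)) (mono_eval (rees_gen n) \<mu> * f))"
    by (simp add: rees_act_def subst_poly_def mono_eval_def[symmetric] sum_distrib_right)
  moreover have "smult (Const a) g \<in> ?M i" if g: "g \<in> ?M i" for a g i
  proof -
    have "Const a \<in> polys {1..n}" unfolding Const_def by (rule polys_single) simp
    moreover have "Const a * coeff g s \<in> poly_piece {1..n} (0 + (i + int s))" for s
      using g by (intro poly_piece_mult Const_piece) (auto simp: rees_piece_def)
    ultimately show ?thesis
      using g by (auto simp: rees_piece_def rees_algebra_def ideal_power_closed)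
  qed
  moreover have "mono_eval (rees_gen n) \<mu> * f \<in> ?M (d + j)" if "\<mu> \<in> Poly_Mapping.keys p" for \<mu>
  proof -
    have "mono_eval (rees_gen n) \<mu> * f \<in> ?M (int (mdeg \<mu>) + j)"
      by (rule mono_eval_piece[of "cone_edges n E"])
        (use rees_gen_mult_piece[OF G] f p that in \<open>auto simp: poly_piece_iff in_keys_iff\<close>)
    then show ?thesis using p that by (auto simp: poly_piece_iff in_keys_iff)
  qed
  moreover have "sum g A \<in> ?M i" if "\<And>a. a \<in> A \<Longrightarrow> g a \<in> ?M i"
    for g and A :: "(nat set \<Rightarrow>\<^sub>0 nat) set" and i
    using that by (induction A rule: infinite_finite_induct) (auto intro: rees_piece_add rees_piece_0)
  ultimately show "rees_act n p f \<in> ?M (d + j)" by simp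
qed

lemma monom_sum_right: "monom (sum f A) s = (\<Sum>a\<in>A. monom (f a) s)"
  by (induction A rule: infinite_finite_induct) (auto simp: add_monom[symmetric])

lemma finite_monomials_of_degree:
  assumes "finite A"
  shows "finite {\<mu>. Poly_Mapping.keys \<mu> \<subseteq> A \<and> mdeg \<mu> \<le> d}"
proof (rule finite_imageD)
  have le: "Poly_Mapping.lookup \<mu> x \<le> mdeg \<mu>" for \<mu> :: "'a \<Rightarrow>\<^sub>0 nat" and x
    unfolding mdeg_def by (cases "x \<in> Poly_Mapping.keys \<mu>") (auto intro: member_le_sum simp: in_keys_iff)
  have "finite {f. \<forall>x. (x \<in> A \<longrightarrow> f x \<in> {..d}) \<and> (x \<notin> A \<longrightarrow> f x = 0)}"
    using assms by (intro finite_set_of_finite_funs) auto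
  then show "finite (Poly_Mapping.lookup ` {\<mu>. Poly_Mapping.keys \<mu> \<subseteq> A \<and> mdeg \<mu> \<le> d})"
  proof (rule rev_finite_subset, intro image_subsetI CollectI allI conjI impI)
    fix \<mu> :: "'a \<Rightarrow>\<^sub>0 nat" and x assume \<mu>: "\<mu> \<in> {\<mu>. Poly_Mapping.keys \<mu> \<subseteq> A \<and> mdeg \<mu> \<le> d}"
    show "Poly_Mapping.lookup \<mu> x \<in> {..d}" using \<mu> le[of \<mu> x] by simp
    show "Poly_Mapping.lookup \<mu> x = 0" if "x \<notin> A" using \<mu> that by (auto simp: in_keys_iff)
  qed
  show "inj_on Poly_Mapping.lookup {\<mu>. Poly_Mapping.keys \<mu> \<subseteq> A \<and> mdeg \<mu> \<le> d}"
    by (rule inj_onI) (simp only: poly_mapping_eq_iff)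
qed

text \<open>Monomials of \<open>I\<^sup>s\<close> have degree at least \<open>2s\<close>, so only the powers \<open>T\<^sup>s\<close> with \<open>s \<le> j\<close> occur in
  degree \<open>j\<close>.\<close>

lemma rees_piece_finite_dimensional:
  assumes G: "simple_graph n E"
  shows "\<exists>B. finite B \<and> rees_piece n (edge_ideal n E) j \<subseteq>
    module.span (\<lambda>c. rees_act n (Const (c::'k::field) :: (nat set, 'k) mpoly)) B"
proof (intro exI conjI)
  interpret rees: module "rees_act n :: (nat set, 'k) mpoly \<Rightarrow> _" by (rule module_rees)
  interpret module "\<lambda>c. rees_act n (Const (c::'k) :: (nat set, 'k) mpoly)"
    by unfold_locales (simp_all add: algebra_simps Const_add Const_mult Const_1)
  let ?mon = "{\<mu>. Poly_Mapping.keys \<mu> \<subseteq> {1..n} \<and> mdeg \<mu> \<le> nat (2 * j)}"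
  let ?B = "(\<lambda>(\<mu>, s). monom (Poly_Mapping.single \<mu> 1) s) ` (?mon \<times> {..nat j}) :: (nat, 'k) mpoly poly set"
  show "finite ?B"
    using finite_monomials_of_degree by auto
  show "rees_piece n (edge_ideal n E) j \<subseteq> span ?B"
  proof
    fix f :: "(nat, 'k) mpoly poly" assume f: "f \<in> rees_piece n (edge_ideal n E) j"
    have "monom (coeff f s) s \<in> span ?B" for s
    proof -
      let ?c = "coeff f s"
      have "monom ?c s = (\<Sum>\<mu>\<in>Poly_Mapping.keys ?c. monom (Poly_Mapping.single \<mu> (Poly_Mapping.lookup ?c \<mu>)) s)"
        unfolding monom_sum_right[symmetric] by (simp flip: poly_mapping_sum_single)
      also have "\<dots> = (\<Sum>\<mu>\<in>Poly_Mapping.keys ?c.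
          rees_act n (Const (Poly_Mapping.lookup ?c \<mu>) :: (nat set, 'k) mpoly) (monom (Poly_Mapping.single \<mu> 1) s))"
        unfolding rees_act_Const smult_monom by (simp add: Const_def mult_single)
      also have "\<dots> \<in> span ?B"
      proof (intro span_sum span_scale span_base)
        fix \<mu> assume \<mu>: "\<mu> \<in> Poly_Mapping.keys ?c"
        have "2 * s \<le> mdeg \<mu>"
          by (rule ideal_power_keys[OF G, of "\<lambda>s \<mu>. 2 * s \<le> mdeg \<mu>"])
            (use f \<mu> edge_props[OF G] in \<open>auto simp: mdeg_add mdeg_set_monomial rees_piece_def rees_algebra_def\<close>)
        moreover have "int (mdeg \<mu>) = j + int s" "Poly_Mapping.keys \<mu> \<subseteq> {1..n}"
          using f \<mu> by (auto simp: rees_piece_def poly_piece_iff in_keys_iff)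
        ultimately show "monom (Poly_Mapping.single \<mu> 1) s \<in> ?B"
          by (intro image_eqI[of _ _ "(\<mu>, s)"]) auto
      qed
      finally show ?thesis .
    qed
    then have "(\<Sum>s\<le>degree f. monom (coeff f s) s) \<in> span ?B"
      by (intro span_sum) auto
    then show "f \<in> span ?B"
      by (simp add: poly_as_sum_of_monoms)
  qed
qed

section \<open>The lower bound for a matching with at least two edges\<close>

text \<open>Sort by the value of \<open>f\<close> first and break ties arbitrarily.\<close>

lemma ordering_with_interval_fibres:
  fixes f :: "'x \<Rightarrow> 'b"
  assumes "finite X"
  obtains ord :: "'x \<Rightarrow> nat" where "inj_on ord X"
    "\<And>p y q. p \<in> X \<Longrightarrow> y \<in> X \<Longrightarrow> q \<in> X \<Longrightarrow> ord p \<le> ord y \<Longrightarrow> ord y \<le> ord q \<Longrightarrow> f p = f q \<Longrightarrow> f y = f p"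
proof -
  obtain g :: "'x \<Rightarrow> nat" and N where g: "g ` X = {i. i < N}" "inj_on g X"
    using finite_imp_inj_to_nat_seg[OF assms] by blast
  obtain h :: "'b \<Rightarrow> nat" where h: "inj_on h (f ` X)"
    using finite_imp_inj_to_nat_seg[of "f ` X"] assms by blast
  have g_less: "g x < N" if "x \<in> X" for x using g(1) that by blast
  define ord where "ord x = h (f x) * N + g x" for x
  have less: "ord x < ord y" if "x \<in> X" "h (f x) < h (f y)" for x y
  proof -
    have "ord x < Suc (h (f x)) * N" using g_less[OF that(1)] by (simp add: ord_def)
    also have "\<dots> \<le> h (f y) * N" using that(2) by (intro mult_le_mono1) simp
    also have "\<dots> \<le> ord y" by (simp add: ord_def)
    finally show ?thesis .
  qed
  then have le: "h (f x) \<le> h (f y)" if "x \<in> X" "y \<in> X" "ord x \<le> ord y" for x y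
    using that by (meson not_le)
  show ?thesis
  proof (rule that)
    show "inj_on ord X"
    proof (rule inj_onI)
      fix x y assume xy: "x \<in> X" "y \<in> X" "ord x = ord y"
      then have "h (f x) = h (f y)" using le[of x y] le[of y x] by simp
      then have "g x = g y" using xy by (simp add: ord_def)
      then show "x = y" using g(2) xy by (auto dest: inj_onD)
    qed
    show "f y = f p" if "p \<in> X" "y \<in> X" "q \<in> X" "ord p \<le> ord y" "ord y \<le> ord q" "f p = f q" for p y q
    proof -
      have "h (f y) = h (f p)" using le[of p y] le[of y q] that by simp
      then show ?thesis using h that by (auto dest: inj_onD)
    qed
  qed
qed

text \<open>The fundamental cocycle of the boundary of the simplex on \<open>insert t T\<close> counts the facet \<open>T\<close>; its
  pull-back along \<open>f\<close> counts the faces that \<open>f\<close> maps onto \<open>T\<close>. The left-hand side is the value of the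
  pull-back on the boundary of the chain \<open>c\<close>, which is supported on faces that \<open>f\<close> does not map onto
  the whole simplex. Only faces \<open>F\<close> with exactly one repeated value \<open>f p = f q\<close> contribute; the two
  facets \<open>F - {p}\<close> and \<open>F - {q}\<close> then carry opposite signs, because \<open>p\<close> and \<open>q\<close> are neighbours in \<open>F\<close> when the fibres of \<open>f\<close> are intervals.\<close>

lemma (in koszul) pulled_back_cocycle:
  fixes f :: "'x \<Rightarrow> 'b" and c :: "'x set \<Rightarrow> 'k::comm_ring_1"
  assumes fibres: "\<And>p y q. p \<in> X \<Longrightarrow> y \<in> X \<Longrightarrow> q \<in> X \<Longrightarrow> ord p \<le> ord y \<Longrightarrow> ord y \<le> ord q \<Longrightarrow>
      f p = f q \<Longrightarrow> f y = f p"
    and T: "finite T" "card T = k" and f: "f ` X \<subseteq> insert t T"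
    and c: "\<And>F. F \<in> faces (Suc k) \<Longrightarrow> f ` F = insert t T \<Longrightarrow> c F = 0"
  shows "(\<Sum>S | S \<in> faces k \<and> f ` S = T. \<Sum>x\<in>X - S. ksign x S * c (insert x S)) = 0"
proof -
  let ?S = "{S. S \<in> faces k \<and> f ` S = T}"
  have inj: "inj_on f S" if "S \<in> ?S" for S
  proof (rule eq_card_imp_inj_on)
    show "finite S" using that finite_face by blast
    have "f ` S = T" "card S = k" using that by (simp_all add: faces_def)
    then show "card (f ` S) = card S" using T(2) by simp
  qed
  have "(\<Sum>S\<in>?S. \<Sum>x\<in>X - S. ksign x S * c (insert x S))
      = (\<Sum>(S, x)\<in>(SIGMA S:?S. X - S). ksign x S * c (insert x S))"
    using finite_faces finite_X by (intro sum.Sigma) auto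
  also have "\<dots> = (\<Sum>(F, x)\<in>(SIGMA F:faces (Suc k). {x \<in> F. F - {x} \<in> ?S}). ksign x (F - {x}) * c F)"
    by (rule sum.reindex_bij_witness[of _ "\<lambda>(F, x). (F - {x}, x)" "\<lambda>(S, x). (insert x S, x)"])
      (auto simp: insert_absorb faces_def card_insert_disjoint finite_subset[OF _ finite_X])
  also have "\<dots> = (\<Sum>F\<in>faces (Suc k). \<Sum>x\<in>{x \<in> F. F - {x} \<in> ?S}. ksign x (F - {x}) * c F)"
    using finite_faces finite_face by (intro sum.Sigma[symmetric]) auto
  also have "\<dots> = 0"
  proof (rule sum.neutral, rule ballI)
    fix F assume F: "F \<in> faces (Suc k)"
    let ?A = "{x \<in> F. F - {x} \<in> ?S}"
    show "(\<Sum>x\<in>?A. ksign x (F - {x}) * c F) = 0"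
    proof (cases "?A = {} \<or> c F = 0")
      case False
      then obtain p where p: "p \<in> F" "F - {p} \<in> ?S" by blast
      have "f ` F = insert (f p) T" using p by auto
      then have "f p \<noteq> t" using c[OF F] False by auto
      moreover have "p \<in> X" using p(1) F by (auto simp: faces_def)
      then have "f p \<in> insert t T" using f by blast
      moreover have "f ` (F - {p}) = T" using p(2) by blast
      ultimately have "f p \<in> f ` (F - {p})" by blast
      then obtain q where q: "q \<in> F" "q \<noteq> p" "f q = f p" by force
      have A: "?A \<subseteq> {p, q}"
      proof
        fix x assume "x \<in> ?A"
        then have "inj_on f (F - {x})" using inj by blast
        then show "x \<in> {p, q}"
          using p q by (auto dest: inj_onD[of f _ p q])
      qed
      have collapse: "f ` (F - {u}) = f ` F" if "u \<in> F" "v \<in> F" "u \<noteq> v" "f u = f v" for u v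
      proof -
        have "f ` F = insert (f u) (f ` (F - {u}))" using that(1) by blast
        moreover have "f u \<in> f ` (F - {u})" by (rule image_eqI[of _ _ v]) (use that in auto)
        ultimately show ?thesis by blast
      qed
      have "f ` (F - {q}) = T"
        using collapse[of p q] collapse[of q p] p q by simp
      moreover have "F - {q} \<in> faces k"
        using q(1) F finite_face[OF F] by (auto simp: faces_def)
      ultimately have "q \<in> ?A"
        using q(1) by blast
      then have A_eq: "?A = {p, q}" using A p by auto
      have opposite: "ksign v (F - {v}) = - (ksign u (F - {u}) :: 'k)"
        if uv: "u \<in> F" "v \<in> F" "ord u < ord v" "f u = f v" "F - {u} \<in> ?S" for u v
      proof -
        have "{y \<in> F - {v}. ord y < ord v} = insert u {y \<in> F - {u}. ord y < ord u}"
        proof -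
          have "ord y < ord u" if y: "y \<in> F" "y \<noteq> v" "ord y < ord v" "y \<noteq> u" for y
          proof (rule ccontr)
            assume "\<not> ord y < ord u"
            then have "f y = f u"
              using fibres[of u y v] uv y F by (auto simp: faces_def)
            then have "y = v"
              using inj[OF uv(5)] uv y by (auto dest: inj_onD)
            then show False using y by simp
          qed
          then show ?thesis using uv by auto
        qed
        then show ?thesis
          using finite_face[OF F] by (simp add: ksign_def)
      qed
      have "ord p \<noteq> ord q"
        using inj_ord p q F by (auto simp: faces_def dest: inj_onD)
      then have "ksign q (F - {q}) + ksign p (F - {p}) = (0 :: 'k)"
        using opposite[of p q] opposite[of q p] p q \<open>q \<in> ?A\<close> by (cases "ord p < ord q") auto
      then show ?thesis
        unfolding A_eq using q(2) by (simp add: distrib_right[symmetric] add.commute)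
    next
      case True
      then show ?thesis
        by (elim disjE) (simp_all only: sum.empty mult_zero_right sum.neutral_const)
    qed
  qed
  finally show ?thesis .
qed

locale matching =
  fixes n :: nat and E :: "nat set set"
  assumes graph: "simple_graph n E" and disjoint: "pairwise disjnt E"
begin

abbreviation "vars \<equiv> cone_edges n E"

lemma finite_E: "finite E"
  using graph by (intro finite_subset[of E "Pow {1..n}"]) (auto simp: simple_graph_def)

lemma finite_vars: "finite vars"
  using finite_E by (simp add: cone_edges_def)

lemma edge_unique: "e \<in> E \<Longrightarrow> e' \<in> E \<Longrightarrow> i \<in> e \<Longrightarrow> i \<in> e' \<Longrightarrow> e = e'"
  using disjoint by (auto simp: pairwise_def disjnt_def)

text \<open>The part of \<open>r e\<^sub>F\<close> in the multidegree of \<open>(\<Prod>i\<in>\<Union>E. x\<^sub>i) T\<close>. Multiplying \<open>r\<close> by the generators in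
  \<open>F\<close> replaces a division of this monomial, which is not always possible.\<close>

definition top_coeff :: "nat set set \<Rightarrow> (nat, 'k::comm_ring_1) mpoly poly \<Rightarrow> 'k" where
  "top_coeff F r = Poly_Mapping.lookup (coeff ((\<Prod>x\<in>F. rees_gen n x) * r) 1) (set_monomial (\<Union>E))"

lemma finite_var: "x \<in> vars \<Longrightarrow> finite x"
  using edge_props(2)[OF graph] by (auto simp: cone_edges_def)

lemma rees_gen_eq:
  "x \<in> vars \<Longrightarrow> rees_gen n x = monom (Poly_Mapping.single (set_monomial (x - {n + 1})) 1)
    (if x \<in> E then 1 else 0)"
  using finite_var edge_props(4)[OF graph] by (auto simp: rees_gen_def prod_Var cone_edges_def)

lemma prod_rees_gen:
  assumes "F \<subseteq> vars"
  shows "(\<Prod>x\<in>F. rees_gen n x :: (nat, 'k::comm_ring_1) mpoly poly) =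
    monom (Poly_Mapping.single (\<Sum>x\<in>F. set_monomial (x - {n + 1})) 1) (card (F \<inter> E))"
  using finite_subset[OF assms finite_vars] assms
proof (induction F rule: finite_induct)
  case (insert x F)
  then have "card (insert x F \<inter> E) = (if x \<in> E then 1 else 0) + card (F \<inter> E)"
    by (auto simp: Int_insert_left)
  then show ?case
    using insert by (simp add: rees_gen_eq mult_monom mult_single)
qed (simp add: monom_0 one_pCons)

text \<open>Suppose that the coefficient is not zero. Since \<open>T\<close> occurs to the first power, both vertices
  of some edge \<open>e\<close> are used up, either by the variable of \<open>e\<close> in \<open>F\<close> or, when \<open>F\<close> has no edge, by the
  coefficient of \<open>T\<close> in \<open>r\<close>, which is in \<open>I\<close>. An element of \<open>F\<close> of colour \<open>e\<close> is not \<open>e\<close> itself, so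
  it is the variable of a vertex. The exponent of that vertex is then at least \<open>2\<close> if it is in \<open>e\<close>, and it
  should be \<open>0\<close> if it is on no edge; neither fits a product of distinct vertices of edges.\<close>

lemma top_coeff_vanishes:
  fixes r :: "(nat, 'k::comm_ring_1) mpoly poly"
  assumes F: "F \<subseteq> vars" and r: "r \<in> rees_algebra n (edge_ideal n E)"
    and onto: "f ` F = E"
    and f_edge: "\<And>e. e \<in> E \<Longrightarrow> f e \<noteq> e" and f_vertex: "\<And>e i. e \<in> E \<Longrightarrow> i \<in> e \<Longrightarrow> f {i, n + 1} = e"
  shows "top_coeff F r = 0"
proof (rule ccontr)
  assume nz: "top_coeff F r \<noteq> 0"
  let ?\<nu> = "\<Sum>x\<in>F. set_monomial (x - {n + 1})" and ?t = "card (F \<inter> E)"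
  have fin: "finite F" using F finite_vars by (rule finite_subset)
  have t: "?t \<le> 1" and nz': "Poly_Mapping.lookup (Poly_Mapping.single ?\<nu> 1 * coeff r (1 - ?t)) (set_monomial (\<Union>E)) \<noteq> 0"
    using nz by (auto simp: top_coeff_def prod_rees_gen[OF F] coeff_monom_mult split: if_splits)
  then obtain \<rho> where \<rho>: "set_monomial (\<Union>E) = ?\<nu> + \<rho>"
    using lookup_single_mult_eq_0 by metis
  then have \<rho>_key: "\<rho> \<in> Poly_Mapping.keys (coeff r (1 - ?t))"
    using nz' by (simp add: lookup_single_mult_shift in_keys_iff)
  have top: "Poly_Mapping.lookup (set_monomial (\<Union>E)) i = (if i \<in> \<Union>E then 1 else 0)" for i
    using finite_E edge_props(2)[OF graph] by (intro lookup_set_monomial) auto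
  have sum: "(\<Sum>x\<in>F. Poly_Mapping.lookup (set_monomial (x - {n + 1})) i) + Poly_Mapping.lookup \<rho> i
      = (if i \<in> \<Union>E then 1 else 0)" for i
    using top[of i] unfolding \<rho> lookup_add lookup_sum by simp
  \<comment> \<open>an edge whose two vertices are used up either by its own generator in \<open>F\<close> or by \<open>\<rho>\<close>\<close>
  obtain e where e: "e \<in> E" "F \<inter> E \<subseteq> {e}" "e \<in> F \<or> (\<forall>i\<in>e. Poly_Mapping.lookup \<rho> i \<ge> 1)"
  proof (cases "?t = 0")
    case True
    have "1 \<ge> (1::nat) \<longrightarrow> (\<exists>e\<in>E. \<forall>i\<in>e. Poly_Mapping.lookup \<rho> i \<ge> 1)"
    proof (rule ideal_power_keys[OF graph, of "\<lambda>s \<mu>. s \<ge> (1::nat) \<longrightarrow> (\<exists>e\<in>E. \<forall>i\<in>e. Poly_Mapping.lookup \<mu> i \<ge> 1)"])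
      show "coeff r 1 \<in> ideal_power (polys {1..n}) (edge_ideal n E) 1"
        using r unfolding rees_algebra_def by blast
      show "\<rho> \<in> Poly_Mapping.keys (coeff r 1)"
        using \<rho>_key True by simp
    qed (use edge_props(2)[OF graph] in \<open>auto simp: lookup_add lookup_set_monomial trans_le_add1 Bex_def\<close>)
    moreover have "F \<inter> E = {}" using True fin by simp
    ultimately show ?thesis using that by auto
  next
    case False
    then have "?t = 1" using t by simp
    then obtain e where "F \<inter> E = {e}" by (rule card_1_singletonE)
    then show ?thesis using that[of e] by auto
  qed
  obtain x where x: "x \<in> F" "f x = e" using onto e(1) by auto
  have "x \<notin> E"
  proof
    assume "x \<in> E"
    then have "x = e" using x e(2) by blast
    then show False using f_edge[OF e(1)] x by simp
  qed
  then obtain i where i: "i \<in> {1..n}" "x = {i, n + 1}" using x F by (auto simp: cone_edges_def)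
  then have xi: "x - {n + 1} = {i}" by auto
  have x_le: "(\<Sum>y\<in>F. Poly_Mapping.lookup (set_monomial (y - {n + 1})) i) \<ge> 1"
    using member_le_sum[of x F "\<lambda>y. Poly_Mapping.lookup (set_monomial (y - {n + 1})) i"] x fin xi
    by (simp add: lookup_set_monomial)
  have "i \<in> \<Union>E" using sum[of i] x_le by (auto split: if_splits)
  then have "i \<in> e" using f_vertex x i by auto
  from e(3) show False
  proof
    assume "e \<in> F"
    have "(\<Sum>y\<in>{x, e}. Poly_Mapping.lookup (set_monomial (y - {n + 1})) i)
        \<le> (\<Sum>y\<in>F. Poly_Mapping.lookup (set_monomial (y - {n + 1})) i)"
      using fin x \<open>e \<in> F\<close> by (intro sum_mono2) auto
    moreover have "x \<noteq> e" using \<open>x \<notin> E\<close> e(1) by auto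
    moreover have "i \<in> e - {n + 1}" using \<open>i \<in> e\<close> i by auto
    ultimately have "(\<Sum>y\<in>F. Poly_Mapping.lookup (set_monomial (y - {n + 1})) i) \<ge> 2"
      using edge_props(2)[OF graph e(1)] xi by (simp add: lookup_set_monomial)
    then show False using sum[of i] by (auto split: if_splits)
  next
    assume "\<forall>i\<in>e. Poly_Mapping.lookup \<rho> i \<ge> 1"
    then show False using sum[of i] x_le \<open>i \<in> e\<close> by (force split: if_splits)
  qed
qed

lemma top_coeff_0: "top_coeff F 0 = 0"
  by (simp add: top_coeff_def)

lemma top_coeff_add: "top_coeff F (r + s) = top_coeff F r + top_coeff F s"
  by (simp add: top_coeff_def distrib_left lookup_add)

lemma top_coeff_sum: "top_coeff F (sum g A) = (\<Sum>a\<in>A. top_coeff F (g a))"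
  by (induction A rule: infinite_finite_induct) (auto simp: top_coeff_0 top_coeff_add)

lemma rees_act_sign_Var:
  "rees_act n ((- 1) ^ k * Var x :: (nat set, 'k::comm_ring_1) mpoly) r = (- 1) ^ k * (rees_gen n x * r)"
proof -
  interpret module "rees_act n :: (nat set, 'k) mpoly \<Rightarrow> _" by (rule module_rees)
  show ?thesis by (cases "even k") (simp_all add: rees_act_Var)
qed

lemma top_coeff_sign:
  fixes r :: "(nat, 'k::comm_ring_1) mpoly poly"
  shows "top_coeff F ((- 1) ^ k * r) = (- 1) ^ k * top_coeff F r"
  by (cases "even k") (simp_all add: top_coeff_def)

text \<open>Multiplying by the generators of the face makes \<open>top_coeff\<close> compatible with the Koszul
  differential: removing \<open>x\<close> from the face and multiplying the coefficient by the generator of \<open>x\<close>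
  have the same effect.\<close>

lemma top_coeff_boundary:
  fixes V :: "nat set set \<Rightarrow> (nat, 'k::comm_ring_1) mpoly poly"
  assumes "koszul vars ord" and S: "S \<subseteq> vars"
  shows "top_coeff S (koszul.boundary vars ord (rees_act n) V S) =
    (\<Sum>x\<in>vars - S. koszul.ksign ord x S * top_coeff (insert x S) (V (insert x S)))"
proof -
  interpret koszul vars ord by fact
  have "top_coeff S (rees_gen n x * r) = top_coeff (insert x S) r" if "x \<in> vars - S"
    for x and r :: "(nat, 'k) mpoly poly"
    using that finite_subset[OF S finite_vars] by (simp add: top_coeff_def mult_ac)
  then show ?thesis
    unfolding boundary_def ksign_def rees_act_sign_Var top_coeff_sum top_coeff_sign
    by (intro sum.cong) auto
qed

lemma set_monomial_Un: "finite A \<Longrightarrow> finite B \<Longrightarrow> A \<inter> B = {} \<Longrightarrow> set_monomial (A \<union> B) = set_monomial A + set_monomial B"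
  unfolding set_monomial_def by (rule sum.union_disjoint)

text \<open>A second edge is what allows \<open>f\<close> to have no fixed point on \<open>E\<close>.\<close>

lemma colouring:
  assumes "card E \<ge> 2"
  obtains f where "f ` vars \<subseteq> E" "\<And>e. e \<in> E \<Longrightarrow> f e \<noteq> e"
    "\<And>e i. e \<in> E \<Longrightarrow> i \<in> e \<Longrightarrow> f {i, n + 1} = e"
proof -
  have other: "\<exists>e'. e' \<in> E \<and> e' \<noteq> e" for e
  proof (rule ccontr)
    assume "\<nexists>e'. e' \<in> E \<and> e' \<noteq> e"
    then have "E \<subseteq> {e}" by blast
    then have "card E \<le> 1" by (metis card_mono finite.emptyI finite_insert is_singletonI is_singleton_altdef)
    then show False using assms by simp
  qed
  then obtain p where p: "\<And>e. p e \<in> E \<and> p e \<noteq> e" by metis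
  define f where "f x = (if x \<in> E then p x else if \<exists>e\<in>E. x - {n + 1} \<subseteq> e
      then SOME e. e \<in> E \<and> x - {n + 1} \<subseteq> e else p x)" for x
  show ?thesis
  proof (rule that)
    have "f x \<in> E" for x
    proof (cases "x \<in> E \<or> \<not> (\<exists>e\<in>E. x - {n + 1} \<subseteq> e)")
      case False
      then have "\<exists>e. e \<in> E \<and> x - {n + 1} \<subseteq> e" by blast
      then have "(SOME e. e \<in> E \<and> x - {n + 1} \<subseteq> e) \<in> E" by (rule someI2_ex) blast
      then show ?thesis using False by (simp add: f_def)
    qed (use p in \<open>auto simp: f_def\<close>)
    then show "f ` vars \<subseteq> E" by blast
    show "f e \<noteq> e" if "e \<in> E" for e using that p by (simp add: f_def)
    show "f {i, n + 1} = e" if e: "e \<in> E" "i \<in> e" for e i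
    proof -
      have sub: "{i, n + 1} - {n + 1} = {i}"
        using edge_props(1,4)[OF graph e(1)] e(2) by auto
      have "{i, n + 1} \<notin> E" using edge_props(4)[OF graph] by blast
      then have "f {i, n + 1} = (SOME e. e \<in> E \<and> i \<in> e)"
        unfolding f_def sub using e by auto
      also have "\<dots> = e" using e edge_unique by (intro some_equality) blast+
      finally show ?thesis .
    qed
  qed
qed

text \<open>The class is the boundary \<open>Z\<close> of \<open>w e\<^sub>A\<close>, with one vertex variable of each edge in \<open>A\<close>. The only
  face of \<open>A\<close> of colour set \<open>E - {t}\<close> is the one without the variable of colour \<open>t\<close>, so the
  pulled-back cocycle takes the value \<open>\<plusminus>1\<close> on \<open>Z\<close>; on boundaries over the Rees algebra it is \<open>0\<close>.\<close>

theorem regularity_ge_card: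
  assumes m: "card E \<ge> 2"
  shows "regularity vars (rees_act n :: (nat set, 'k::field) mpoly \<Rightarrow> _) (rees_piece n (edge_ideal n E))
    \<ge> ereal (real (card E))"
proof -
  obtain f where f: "f ` vars \<subseteq> E" "\<And>e. e \<in> E \<Longrightarrow> f e \<noteq> e"
      "\<And>e i. e \<in> E \<Longrightarrow> i \<in> e \<Longrightarrow> f {i, n + 1} = e"
    using colouring[OF m] by blast
  obtain ord :: "nat set \<Rightarrow> nat" where ord: "inj_on ord vars"
    "\<And>p y q. p \<in> vars \<Longrightarrow> y \<in> vars \<Longrightarrow> q \<in> vars \<Longrightarrow> ord p \<le> ord y \<Longrightarrow> ord y \<le> ord q \<Longrightarrow>
      f p = f q \<Longrightarrow> f y = f p"
    using ordering_with_interval_fibres[OF finite_vars, of f] by metis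
  interpret koszul vars ord
    using finite_vars ord(1) by unfold_locales
  interpret rees: graded_action "rees_act n :: (nat set, 'k) mpoly \<Rightarrow> _" vars "rees_piece n (edge_ideal n E)"
    by (rule graded_action_rees[OF graph])
  let ?M = "rees_piece n (edge_ideal n E :: (nat, 'k) mpoly set)"
  define k where "k = card E - 1"
  have card_E: "card E = Suc k" and k_pos: "k > 0" using m by (auto simp: k_def)
  obtain t where t: "t \<in> E" using m by fastforce
  let ?T = "E - {t}"
  have T: "finite ?T" "card ?T = k" "insert t ?T = E"
    using t finite_E card_E by auto
  have "\<exists>a b. e = {a, b} \<and> a \<noteq> b" if "e \<in> E" for e
    using edge_props(3)[OF graph that] by (auto simp: card_2_iff)
  then obtain a b where ab: "\<And>e. e \<in> E \<Longrightarrow> e = {a e, b e} \<and> a e \<noteq> b e" by metis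
  have a_in: "a e \<in> e" and b_in: "b e \<in> e" if "e \<in> E" for e using ab[OF that] by blast+
  have a_vertex: "a e \<in> {1..n}" and b_vertex: "b e \<in> {1..n}" if "e \<in> E" for e
    using a_in[OF that] b_in[OF that] edge_props(1)[OF graph that] by blast+
  have inj_a: "inj_on a E" and inj_b: "inj_on b E"
    using a_in b_in edge_unique by (auto intro!: inj_onI) metis+
  have disj: "a ` E \<inter> b ` E = {}"
    using a_in b_in edge_unique ab by (auto; metis)
  define x where "x e = {a e, n + 1}" for e
  have x_minus: "x e - {n + 1} = {a e}" if "e \<in> E" for e
    using a_vertex[OF that] by (auto simp: x_def)
  have f_x: "f (x e) = e" if "e \<in> E" for e
    unfolding x_def using f(3) that a_in by blast
  have inj_x: "inj_on x E" using f_x by (rule inj_on_inverseI)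
  define A where "A = x ` E"
  have A: "A \<subseteq> vars" "card A = Suc k"
    using a_vertex card_image[OF inj_x] card_E by (auto simp: A_def x_def cone_edges_def)
  \<comment> \<open>\<open>w\<close> itself is not in the Rees algebra, but its multiples by the variables in \<open>A\<close> are\<close>
  define w :: "(nat, 'k) mpoly poly" where "w = monom (Poly_Mapping.single (set_monomial (b ` E)) 1) 1"
  define W where "W F = (if F = A then w else 0)" for F
  define Z where "Z = boundary (rees_act n) W"
  have w_mult: "rees_gen n (x e) * w \<in> ?M (int k + 1)" if e: "e \<in> E" for e
  proof -
    let ?v = "set_monomial {a e} + set_monomial (b ` E)"
    have rees_w: "rees_gen n (x e) * w = monom (Poly_Mapping.single ?v 1) 1"
      unfolding x_def rees_gen_vertex[OF a_vertex[OF e]]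
      by (simp add: w_def mult_monom Var_def set_monomial_def mult_single)
    \<comment> \<open>split off the edge \<open>e\<close>, whose vertices are \<open>a e\<close> and \<open>b e\<close>\<close>
    have v: "?v = set_monomial (b ` (E - {e})) + set_monomial e"
    proof -
      have "set_monomial (b ` E) = set_monomial (insert (b e) (b ` (E - {e})))"
        using e by (metis image_insert insert_Diff)
      moreover have "b e \<notin> b ` (E - {e})" using inj_b e by (auto dest: inj_onD)
      moreover have "set_monomial e = set_monomial {a e} + set_monomial {b e}"
        using set_monomial_Un[of "{a e}" "{b e}"] ab[OF e] by (simp add: insert_commute)
      ultimately show ?thesis
        using finite_E set_monomial_Un[of "{b e}" "b ` (E - {e})"] by (simp add: add_ac)
    qed
    have "Poly_Mapping.single ?v 1 = Poly_Mapping.single (set_monomial (b ` (E - {e}))) 1 * (\<Prod>i\<in>e. Var i :: (nat, 'k) mpoly)"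
      unfolding v prod_Var[OF edge_props(2)[OF graph e]] by (simp add: mult_single)
    also have "\<dots> \<in> edge_ideal n E"
      using e finite_E b_vertex by (intro edge_ideal_gen polys_single) (auto simp: keys_set_monomial)
    finally have "Poly_Mapping.single ?v 1 * 1 \<in> ideal_power (polys {1..n}) (edge_ideal n E :: (nat, 'k) mpoly set) (Suc 0)"
      by (intro ideal_power_Suc) (simp_all add: polys_1)
    moreover have "Poly_Mapping.single ?v (1::'k) \<in> poly_piece {1..n} (int k + 1 + 1)"
    proof (rule poly_piece_single)
      show "Poly_Mapping.keys ?v \<subseteq> {1..n}"
        using finite_E a_vertex[OF e] b_vertex by (auto simp: keys_add_nat keys_set_monomial)
      show "int (mdeg ?v) = int k + 1 + 1"
        using finite_E card_image[OF inj_b] card_E by (simp add: mdeg_add mdeg_set_monomial)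
    qed
    ultimately show ?thesis
      unfolding rees_w by (auto simp: rees_piece_def rees_algebra_def ideal_power_closed(1) simp del: ideal_power.simps)
  qed
  have Z_piece: "Z S \<in> ?M (int k + 1)" if "S \<in> faces k" for S
    unfolding Z_def boundary_def
  proof (rule rees.piece_sum)
    fix y assume "y \<in> vars - S"
    show "rees_act n (ksign y S * Var y) (W (insert y S)) \<in> ?M (int k + 1)"
    proof (cases "insert y S = A")
      case True
      then have "y \<in> A" by blast
      then obtain e where e: "e \<in> E" "y = x e" by (auto simp: A_def)
      have "rees_act n (ksign y S * Var y :: (nat set, 'k) mpoly) w
          = rees_act n ((- 1) ^ card {z \<in> S. ord z < ord y}) (rees_gen n y * w)"
        by (simp add: ksign_def rees_act_Var flip: rees.scale_scale)
      also have "\<dots> \<in> ?M (0 + (int k + 1))"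
        unfolding e(2)
        by (intro rees.piece_act w_mult e) (cases "even (card {z \<in> S. ord z < ord (x e)})";
            simp add: poly_piece_one poly_piece_diff[OF poly_piece_0 poly_piece_one, simplified])
      finally show ?thesis by (simp add: W_def True)
    qed (simp add: W_def rees.piece_0)
  qed
  have top_A: "top_coeff A w = 1"
  proof -
    have "(\<Sum>y\<in>A. set_monomial (y - {n + 1})) = (\<Sum>e\<in>E. set_monomial {a e})"
      unfolding A_def sum.reindex[OF inj_x] by (intro sum.cong) (auto simp: x_minus simp del: One_nat_def)
    also have "\<dots> = set_monomial (a ` E)"
      unfolding set_monomial_def sum.reindex[OF inj_a] by simp
    finally have "(\<Sum>y\<in>A. set_monomial (y - {n + 1})) + set_monomial (b ` E) = set_monomial (a ` E \<union> b ` E)"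
      using set_monomial_Un[of "a ` E" "b ` E"] disj finite_E by simp
    also have "a ` E \<union> b ` E = \<Union>E" using ab by (auto; blast)
    finally have top: "(\<Sum>y\<in>A. set_monomial (y - {n + 1})) + set_monomial (b ` E) = set_monomial (\<Union>E)" .
    have "A \<inter> E = {}" using edge_props(4)[OF graph] by (auto simp: A_def x_def)
    then show ?thesis
      unfolding top_coeff_def prod_rees_gen[OF A(1)] w_def mult_monom mult_single top by simp
  qed
  let ?S = "{S. S \<in> faces k \<and> f ` S = ?T}"
  have pairing_Z: "(\<Sum>S\<in>?S. top_coeff S (Z S)) \<noteq> 0"
  proof -
    define S\<^sub>0 where "S\<^sub>0 = A - {x t}"
    have "x t \<in> A" using t by (simp add: A_def)
    have ins: "insert (x t) S\<^sub>0 = A" using \<open>x t \<in> A\<close> by (auto simp: S\<^sub>0_def)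
    have "S\<^sub>0 = x ` ?T" using inj_x t by (auto simp: S\<^sub>0_def A_def dest: inj_onD)
    then have "f ` S\<^sub>0 = ?T" using f_x by force
    moreover have "S\<^sub>0 \<in> faces k"
      using A \<open>x t \<in> A\<close> finite_subset[OF A(1) finite_vars] by (auto simp: faces_def S\<^sub>0_def)
    ultimately have S\<^sub>0: "S\<^sub>0 \<in> ?S" by blast
    have "(\<Sum>S\<in>?S. top_coeff S (Z S))
        = (\<Sum>S\<in>?S. \<Sum>y\<in>vars - S. ksign y S * top_coeff (insert y S) (W (insert y S)))"
      unfolding Z_def
      by (intro sum.cong top_coeff_boundary refl koszul_axioms) (auto simp: faces_def)
    also have "\<dots> = (\<Sum>(S, y)\<in>(SIGMA S:?S. vars - S). ksign y S * top_coeff (insert y S) (W (insert y S)))"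
      using finite_faces finite_vars by (intro sum.Sigma) auto
    also have "\<dots> = (\<Sum>(S, y)\<in>{(S\<^sub>0, x t)}. ksign y S * top_coeff (insert y S) (W (insert y S)))"
    proof (rule sum.mono_neutral_right)
      show "finite (SIGMA S:?S. vars - S)" using finite_faces finite_vars by auto
      show "{(S\<^sub>0, x t)} \<subseteq> (SIGMA S:?S. vars - S)"
        using S\<^sub>0 \<open>x t \<in> A\<close> A(1) by (auto simp: S\<^sub>0_def)
      show "\<forall>p\<in>(SIGMA S:?S. vars - S) - {(S\<^sub>0, x t)}.
          (case p of (S, y) \<Rightarrow> ksign y S * top_coeff (insert y S) (W (insert y S))) = 0"
      proof
        fix p assume p: "p \<in> (SIGMA S:?S. vars - S) - {(S\<^sub>0, x t)}"
        obtain S y where Sy: "p = (S, y)" by (cases p)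
        have "insert y S \<noteq> A"
        proof
          assume eq: "insert y S = A"
          then have "y \<in> A" by blast
          then obtain e where e: "e \<in> E" "y = x e" by (auto simp: A_def)
          have S: "S = A - {x e}" "f ` S = ?T" using eq p Sy e by auto
          have "e = t"
          proof (rule ccontr)
            assume "e \<noteq> t"
            then have "e \<in> f ` S" using S(2) e(1) by auto
            then obtain e' where "e' \<in> E" "x e' \<in> S" "f (x e') = e" using S(1) by (auto simp: A_def)
            then show False using f_x[of e'] S(1) by auto
          qed
          then show False using p Sy e S(1) by (auto simp: S\<^sub>0_def)
        qed
        then show "(case p of (S, y) \<Rightarrow> ksign y S * top_coeff (insert y S) (W (insert y S))) = 0"
          by (simp add: Sy W_def top_coeff_0)
      qed
    qed
    also have "\<dots> = ksign (x t) S\<^sub>0"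
      by (simp add: ins W_def top_A)
    also have "(ksign (x t) S\<^sub>0 :: 'k) \<noteq> 0"
      by (simp add: ksign_def)
    finally show ?thesis .
  qed
  have "regularity vars (rees_act n :: (nat set, 'k) mpoly \<Rightarrow> _) ?M
      \<ge> ereal (real_of_int ((2 * int k + 1) - int k))"
  proof (rule regularity_ge[OF rees.graded_action_axioms rees_piece_finite_dimensional[OF graph]])
    show "chain_vec k Z \<in> tensor_piece ?M koszul_complex k (2 * int k + 1)"
      using Z_piece by (simp add: chain_vec_piece_iff)
    show "tensor_diff (rees_act n) koszul_complex (k - 1) (chain_vec k Z) = 0"
    proof -
      have "chain_vec (k - 1) (boundary (rees_act n) Z) = 0"
        unfolding Z_def chain_vec_eq_0_iff
        using boundary_boundary[OF rees.module_axioms] by (auto simp: faces_def)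
      then show ?thesis
        using tensor_diff_chain_vec[OF rees.module_axioms, of "k - 1" Z] k_pos by simp
    qed
    show "chain_vec k Z \<notin> tensor_diff (rees_act n) koszul_complex k `
        tensor_piece ?M (koszul_complex :: (nat set, 'k, 'k) free_complex) (Suc k) (2 * int k + 1)"
    proof
      assume "chain_vec k Z \<in> tensor_diff (rees_act n) koszul_complex k `
        tensor_piece ?M (koszul_complex :: (nat set, 'k, 'k) free_complex) (Suc k) (2 * int k + 1)"
      then obtain v where v: "v \<in> tensor_piece ?M (koszul_complex :: (nat set, 'k, 'k) free_complex) (Suc k) (2 * int k + 1)"
        and Zv: "chain_vec k Z = tensor_diff (rees_act n) (koszul_complex :: (nat set, 'k, 'k) free_complex) k v"
        by blast
      define V where "V S = v (position S)" for S
      have v_eq: "v = chain_vec (Suc k) V"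
        unfolding V_def using chain_vec_position[OF v] by simp
      have V: "V F \<in> rees_algebra n (edge_ideal n E)" if "F \<in> faces (Suc k)" for F
        using v that unfolding v_eq chain_vec_piece_iff by (auto simp: rees_piece_def)
      have "\<forall>S\<in>faces k. Z S = boundary (rees_act n) V S"
        using Zv unfolding v_eq tensor_diff_chain_vec[OF rees.module_axioms] chain_vec_eq_iff .
      then have "(\<Sum>S\<in>?S. top_coeff S (Z S)) = (\<Sum>S\<in>?S. top_coeff S (boundary (rees_act n) V S))"
        by (intro sum.cong) auto
      also have "\<dots> = (\<Sum>S\<in>?S. \<Sum>y\<in>vars - S. ksign y S * top_coeff (insert y S) (V (insert y S)))"
        by (intro sum.cong top_coeff_boundary refl koszul_axioms) (auto simp: faces_def)
      also have "\<dots> = 0"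
      proof (rule pulled_back_cocycle[of f ?T k t "\<lambda>F. top_coeff F (V F)"])
        show "top_coeff F (V F) = 0" if "F \<in> faces (Suc k)" "f ` F = insert t ?T" for F
          using that T(3) V[OF that(1)] by (intro top_coeff_vanishes[of _ _ f] f(2,3)) (auto simp: faces_def)
      qed (use ord(2) T f(1) in blast)+
      finally show False using pairing_Z by simp
    qed
  qed
  then show ?thesis using card_E by (simp add: add.commute)
qed

end

section \<open>Regularity for a single edge\<close>

text \<open>Over a module that is free on one generator \<open>g\<close> of degree \<open>0\<close>, tensoring changes nothing: the
  resolution of \<open>K\<close> stays exact, and only \<open>\<beta>\<^sub>0\<^sub>0\<close> survives.\<close>

lemma regularity_free_module:
  fixes act :: "('x, 'k::field) mpoly \<Rightarrow> 'a::ab_group_add \<Rightarrow> 'a"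
  assumes M: "graded_action act X M" and X: "finite X"
    and fin: "\<And>d. \<exists>B. finite B \<and> M d \<subseteq> module.span (\<lambda>c. act (Const c)) B"
    and g: "g \<in> M 0" and onto: "\<And>d. M d \<subseteq> (\<lambda>p. act p g) ` poly_piece X d"
    and free: "\<And>d p. p \<in> poly_piece X d \<Longrightarrow> act p g = 0 \<Longrightarrow> p = 0"
  shows "regularity X act M = 0"
proof -
  interpret graded_action act X M by (rule M)
  interpret P: graded_action "(*) :: ('x, 'k) mpoly \<Rightarrow> _" X "poly_piece X"
    by (rule graded_action_poly)
  let ?G = "residue_resolution X :: ('x, 'k, 'k) free_complex"
  let ?P = "poly_piece X :: int \<Rightarrow> ('x, 'k) mpoly set"
  have G: "graded_free_resolution X residue_act residue_piece ?G"
    by (rule residue_resolution_resolution[OF X])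
  define \<theta> where "\<theta> u = (\<lambda>a. act (u a) g)" for u :: "nat \<Rightarrow> ('x, 'k) mpoly"
  have \<theta>_diff: "tensor_diff act ?G i (\<theta> u) = \<theta> (tensor_diff (*) ?G i u)" for i u
    by (auto simp: tensor_diff_def \<theta>_def fun_eq_iff scale_sum_left)
  have \<theta>_piece: "\<theta> u \<in> tensor_piece M ?G i j" if "u \<in> tensor_piece ?P ?G i j" for u i j
    using that piece_act[OF _ g] by (force simp: tensor_piece_def \<theta>_def)
  have lift: "\<exists>u \<in> tensor_piece ?P ?G i j. v = \<theta> u" if v: "v \<in> tensor_piece M ?G i j" for v i j
  proof -
    have "\<exists>p. (a < fc_rank ?G i \<longrightarrow> p \<in> ?P (j - fc_shift ?G i a)) \<and> (a \<ge> fc_rank ?G i \<longrightarrow> p = 0) \<and> v a = act p g" for a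
    proof (cases "a < fc_rank ?G i")
      case True
      then have "v a \<in> M (j - fc_shift ?G i a)" using v by (simp add: tensor_piece_def)
      then show ?thesis using onto True by fastforce
    qed (use v in \<open>simp add: tensor_piece_def\<close>)
    then obtain u where "\<And>a. (a < fc_rank ?G i \<longrightarrow> u a \<in> ?P (j - fc_shift ?G i a)) \<and>
        (a \<ge> fc_rank ?G i \<longrightarrow> u a = 0) \<and> v a = act (u a) g"
      by metis
    then show ?thesis
      by (intro bexI[of _ u]) (auto simp: tensor_piece_def \<theta>_def)
  qed
  have \<theta>_inj: "u = u'" if u: "u \<in> tensor_piece ?P ?G i j" "u' \<in> tensor_piece ?P ?G i j" "\<theta> u = \<theta> u'" for u u' i j
  proof
    fix a
    show "u a = u' a"
    proof (cases "a < fc_rank ?G i")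
      case True
      have "act (u a - u' a) g = 0"
        using fun_cong[OF u(3), of a] by (simp add: \<theta>_def scale_left_diff_distrib)
      moreover have "u a - u' a \<in> ?P (j - fc_shift ?G i a)"
        using u(1,2) True by (auto simp: tensor_piece_def intro: poly_piece_diff)
      ultimately show ?thesis using free by fastforce
    qed (use u in \<open>simp add: tensor_piece_def\<close>)
  qed
  have boundary_iff: "\<theta> u \<in> tor_boundaries X act M i j \<longleftrightarrow> res_cycle residue_act ?G i u"
    if u: "u \<in> tensor_piece ?P ?G i j" for u i j
  proof -
    have "res_cycle residue_act ?G i u \<longleftrightarrow> u \<in> tensor_diff (*) ?G i ` tensor_piece ?P ?G (Suc i) j"
      using resolution_exact[OF G, of u i j] u by blast
    also have "\<dots> \<longleftrightarrow> \<theta> u \<in> tor_boundaries X act M i j"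
    proof
      assume "u \<in> tensor_diff (*) ?G i ` tensor_piece ?P ?G (Suc i) j"
      then obtain w where w: "w \<in> tensor_piece ?P ?G (Suc i) j" "u = tensor_diff (*) ?G i w" by blast
      then have "\<theta> u = tensor_diff act ?G i (\<theta> w)" using \<theta>_diff by simp
      then show "\<theta> u \<in> tor_boundaries X act M i j"
        using \<theta>_piece[OF w(1)] unfolding tor_boundaries_def by blast
    next
      assume "\<theta> u \<in> tor_boundaries X act M i j"
      then obtain v where v: "v \<in> tensor_piece M ?G (Suc i) j" "\<theta> u = tensor_diff act ?G i v"
        unfolding tor_boundaries_def by blast
      obtain w where w: "w \<in> tensor_piece ?P ?G (Suc i) j" "v = \<theta> w" using lift[OF v(1)] by blast
      have "\<theta> u = \<theta> (tensor_diff (*) ?G i w)" using v(2) w(2) \<theta>_diff by simp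
      then have "u = tensor_diff (*) ?G i w"
        using \<theta>_inj[OF u P.tensor_diff_piece[OF G w(1)]] by blast
      then show "u \<in> tensor_diff (*) ?G i ` tensor_piece ?P ?G (Suc i) j" using w(1) by blast
    qed
    finally show ?thesis by blast
  qed
  have aug: "augmentation residue_act ?G ` tensor_piece ?P ?G 0 j = residue_piece j" for j
    using G by (simp add: graded_free_resolution_def)
  have zero: "betti X act M i j = 0" if ij: "i > 0 \<or> j \<noteq> 0" for i j
  proof (rule betti_eq_0, rule antisym[OF _ tor_boundaries_subset[OF X]], rule subsetI)
    fix v assume v: "v \<in> tor_cycles X act M i j"
    then have "v \<in> tensor_piece M ?G i j" unfolding tor_cycles_def by blast
    then obtain u where u: "u \<in> tensor_piece ?P ?G i j" "v = \<theta> u"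
      using lift by blast
    have "res_cycle residue_act ?G i u"
    proof (cases i)
      case 0
      then have "augmentation residue_act ?G u \<in> residue_piece j" using aug[of j] u(1) by blast
      then show ?thesis using 0 ij by (simp add: res_cycle_def residue_piece_def)
    next
      case (Suc k)
      have "\<theta> (tensor_diff (*) ?G k u) = 0"
        using v Suc u(2) \<theta>_diff[of k u] by (simp add: tor_cycles_def)
      also have "0 = \<theta> 0" by (simp add: \<theta>_def fun_eq_iff)
      finally have "tensor_diff (*) ?G k u = 0"
      proof (rule \<theta>_inj[rotated 2])
        show "tensor_diff (*) ?G k u \<in> tensor_piece ?P ?G k j"
          using P.tensor_diff_piece[OF G] u(1) Suc by blast
        show "0 \<in> tensor_piece ?P ?G k j" by (simp add: tensor_piece_def)
      qed
      then show ?thesis by (simp add: res_cycle_def Suc zero_fun_def)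
    qed
    then show "v \<in> tor_boundaries X act M i j" using boundary_iff u by blast
  qed
  have nonzero: "betti X act M 0 0 \<noteq> 0"
  proof -
    have "1 \<in> augmentation residue_act ?G ` tensor_piece ?P ?G 0 0"
      unfolding aug by (simp add: residue_piece_def)
    then obtain u where u: "u \<in> tensor_piece ?P ?G 0 0" "augmentation residue_act ?G u = 1"
      by auto
    show ?thesis
    proof (rule betti_nonzero[OF M X fin])
      show "\<theta> u \<in> tor_cycles X act M 0 0"
        using \<theta>_piece[OF u(1)] by (simp add: tor_cycles_def)
      show "\<theta> u \<notin> tor_boundaries X act M 0 0"
        unfolding boundary_iff[OF u(1)] using u(2) by (simp add: res_cycle_def)
    qed
  qed
  have only: "i = 0 \<and> j = 0" if "betti X act M i j \<noteq> 0" for i j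
  proof (rule ccontr)
    assume "\<not> (i = 0 \<and> j = 0)"
    then have "i > 0 \<or> j \<noteq> 0" by simp
    from zero[OF this] that show False by simp
  qed
  have "{ereal (real_of_int (j - int i)) | i j. betti X act M i j \<noteq> 0} = {0}"
  proof (rule antisym)
    show "{ereal (real_of_int (j - int i)) | i j. betti X act M i j \<noteq> 0} \<subseteq> {0}"
    proof
      fix r assume "r \<in> {ereal (real_of_int (j - int i)) | i j. betti X act M i j \<noteq> 0}"
      then obtain i j where "r = ereal (real_of_int (j - int i))" "betti X act M i j \<noteq> 0" by blast
      with only[OF this(2)] show "r \<in> {0}" by simp
    qed
    show "{0} \<subseteq> {ereal (real_of_int (j - int i)) | i j. betti X act M i j \<noteq> 0}"
      using nonzero by (intro subsetI CollectI exI[of _ "0::nat"] exI[of _ "0::int"]) simp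
  qed
  then show ?thesis by (simp add: regularity_def)
qed

text \<open>For a single edge the generators of the Rees algebra are algebraically independent: a monomial
  \<open>\<nu> T\<^sup>s\<close> of the Rees algebra is divisible by the \<open>s\<close>-th power of the edge, and the quotient is a product
  of vertex variables in a unique way.\<close>

locale single_edge = matching n "{e}"
  for n :: nat and e :: "nat set"
begin

lemma vars_eq: "vars = insert e ((\<lambda>i. {i, n + 1}) ` {1..n})"
  by (auto simp: cone_edges_def)

lemma e_not_vertex: "e \<noteq> {i, n + 1}"
  using edge_props(4)[OF graph, of e] by auto

lemma sum_vars: "(\<Sum>x\<in>vars. h x) = h e + (\<Sum>i\<in>{1..n}. h {i, n + 1})"
proof -
  have inj: "inj_on (\<lambda>i. {i, n + 1}) {1..n}"
  proof (rule inj_onI)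
    fix i j assume "i \<in> {1..n}" "j \<in> {1..n}" "{i, n + 1} = {j, n + 1}"
    then show "i = j" by (metis doubleton_eq_iff)
  qed
  have "e \<notin> (\<lambda>i. {i, n + 1}) ` {1..n}"
    using e_not_vertex by (simp only: image_iff) blast
  then have "sum h vars = h e + sum h ((\<lambda>i. {i, n + 1}) ` {1..n})"
    unfolding vars_eq by (intro sum.insert) simp_all
  then show ?thesis
    unfolding sum.reindex[OF inj] by (simp only: comp_def)
qed

text \<open>The exponent vector of \<open>x\<close> in the image of a monomial under \<open>t\<^sub>x \<mapsto> rees_gen n x\<close>; the exponent
  of \<open>T\<close> is the one of \<open>t\<^sub>e\<close>.\<close>

definition x_exponent :: "(nat set \<Rightarrow>\<^sub>0 nat) \<Rightarrow> nat \<Rightarrow>\<^sub>0 nat" where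
  "x_exponent \<mu> = (\<Sum>x\<in>vars. \<Sum>k<Poly_Mapping.lookup \<mu> x. set_monomial (x - {n + 1}))"

lemma lookup_x_exponent:
  "Poly_Mapping.lookup (x_exponent \<mu>) i =
    (if i \<in> e then Poly_Mapping.lookup \<mu> e else 0) + (if i \<in> {1..n} then Poly_Mapping.lookup \<mu> {i, n + 1} else 0)"
proof -
  have "Poly_Mapping.lookup (x_exponent \<mu>) i =
      (\<Sum>x\<in>vars. Poly_Mapping.lookup \<mu> x * Poly_Mapping.lookup (set_monomial (x - {n + 1})) i)"
    unfolding x_exponent_def lookup_sum by simp
  also have "\<dots> = Poly_Mapping.lookup \<mu> e * Poly_Mapping.lookup (set_monomial (e - {n + 1})) i
      + (\<Sum>l\<in>{1..n}. Poly_Mapping.lookup \<mu> {l, n + 1} * Poly_Mapping.lookup (set_monomial ({l, n + 1} - {n + 1})) i)"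
    by (rule sum_vars)
  also have "Poly_Mapping.lookup \<mu> e * Poly_Mapping.lookup (set_monomial (e - {n + 1})) i
      = (if i \<in> e then Poly_Mapping.lookup \<mu> e else 0)"
    using edge_props(2,4)[OF graph, of e] by (auto simp: lookup_set_monomial)
  also have "(\<Sum>l\<in>{1..n}. Poly_Mapping.lookup \<mu> {l, n + 1} * Poly_Mapping.lookup (set_monomial ({l, n + 1} - {n + 1})) i)
      = (\<Sum>l\<in>{1..n}. if l = i then Poly_Mapping.lookup \<mu> {l, n + 1} else 0)"
    by (rule sum.cong) (auto simp: lookup_set_monomial)
  finally show ?thesis by simp
qed

lemma mono_eval_rees_gen:
  assumes "Poly_Mapping.keys \<mu> \<subseteq> vars"
  shows "mono_eval (rees_gen n) \<mu> =
    (monom (Poly_Mapping.single (x_exponent \<mu>) 1) (Poly_Mapping.lookup \<mu> e) :: (nat, 'k::comm_ring_1) mpoly poly)"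
proof -
  have single_power: "Poly_Mapping.single \<nu> (1::'k) ^ k = Poly_Mapping.single (\<Sum>l<k. \<nu>) 1"
    for \<nu> :: "nat \<Rightarrow>\<^sub>0 nat" and k
    by (induction k) (simp_all add: mult_single add.commute del: sum_constant)
  have "(\<Prod>x\<in>A. rees_gen n x ^ Poly_Mapping.lookup \<mu> x) =
      (monom (Poly_Mapping.single (\<Sum>x\<in>A. \<Sum>k<Poly_Mapping.lookup \<mu> x. set_monomial (x - {n + 1})) 1)
        (\<Sum>x\<in>A. if x = e then Poly_Mapping.lookup \<mu> x else 0) :: (nat, 'k) mpoly poly)"
    if "finite A" "A \<subseteq> vars" for A
    using that
  proof (induction A rule: finite_induct)
    case (insert x A)
    have "rees_gen n x ^ Poly_Mapping.lookup \<mu> x =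
        (monom (Poly_Mapping.single (\<Sum>k<Poly_Mapping.lookup \<mu> x. set_monomial (x - {n + 1})) 1)
          (if x = e then Poly_Mapping.lookup \<mu> x else 0) :: (nat, 'k) mpoly poly)"
      using insert.prems by (auto simp: rees_gen_eq monom_power single_power simp del: sum_constant)
    then show ?case
      using insert by (simp add: mult_monom mult_single del: sum_constant sum.delta sum.delta')
  qed (simp add: monom_0 one_pCons)
  from this[of vars] have "(\<Prod>x\<in>vars. rees_gen n x ^ Poly_Mapping.lookup \<mu> x) =
      (monom (Poly_Mapping.single (x_exponent \<mu>) 1) (Poly_Mapping.lookup \<mu> e) :: (nat, 'k) mpoly poly)"
    using finite_vars by (simp add: x_exponent_def vars_eq del: sum_constant)
  then show ?thesis
    by (simp only: mono_eval_superset[OF finite_vars assms])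
qed

lemma rees_act_1:
  fixes p :: "(nat set, 'k::comm_ring_1) mpoly"
  assumes "p \<in> polys vars"
  shows "rees_act n p 1 = (\<Sum>\<mu>\<in>Poly_Mapping.keys p.
    monom (Poly_Mapping.single (x_exponent \<mu>) (Poly_Mapping.lookup p \<mu>)) (Poly_Mapping.lookup \<mu> e))"
  unfolding rees_act_def subst_poly_def mono_eval_def[symmetric] mult_1_right
proof (rule sum.cong[OF refl])
  fix \<mu> assume "\<mu> \<in> Poly_Mapping.keys p"
  then have "mono_eval (rees_gen n) \<mu> =
      (monom (Poly_Mapping.single (x_exponent \<mu>) 1) (Poly_Mapping.lookup \<mu> e) :: (nat, 'k) mpoly poly)"
    using assms by (intro mono_eval_rees_gen) (auto simp: polys_def)
  then show "[:Const (Poly_Mapping.lookup p \<mu>):] * mono_eval (rees_gen n) \<mu> =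
      monom (Poly_Mapping.single (x_exponent \<mu>) (Poly_Mapping.lookup p \<mu>)) (Poly_Mapping.lookup \<mu> e)"
    by (simp add: smult_monom Const_def mult_single)
qed

lemma monomial_eqI:
  assumes "Poly_Mapping.keys \<mu> \<subseteq> vars" "Poly_Mapping.keys \<nu> \<subseteq> vars"
    and "x_exponent \<mu> = x_exponent \<nu>" "Poly_Mapping.lookup \<mu> e = Poly_Mapping.lookup \<nu> e"
  shows "\<mu> = \<nu>"
proof (rule poly_mapping_eqI)
  fix x
  consider "x = e" | i where "i \<in> {1..n}" "x = {i, n + 1}" | "x \<notin> vars"
    unfolding vars_eq by blast
  then show "Poly_Mapping.lookup \<mu> x = Poly_Mapping.lookup \<nu> x"
  proof cases
    case 2
    then show ?thesis
      using arg_cong[OF assms(3), of "\<lambda>\<rho>. Poly_Mapping.lookup \<rho> i"] assms(4)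
      by (simp only: lookup_x_exponent) simp
  next
    case 3
    then have "x \<notin> Poly_Mapping.keys \<mu>" "x \<notin> Poly_Mapping.keys \<nu>" using assms(1,2) by auto
    then show ?thesis by (simp add: in_keys_iff)
  qed (use assms in simp)
qed

text \<open>Distinct monomials in the variables \<open>vars\<close> have distinct images, so no cancellation can occur.\<close>

lemma free:
  fixes p :: "(nat set, 'k::comm_ring_1) mpoly"
  assumes p: "p \<in> polys vars" and "rees_act n p 1 = 0"
  shows "p = 0"
proof (rule ccontr)
  assume "p \<noteq> 0"
  then obtain \<nu> where \<nu>: "\<nu> \<in> Poly_Mapping.keys p"
    using poly_mapping_eqI[of p 0] by (auto simp: in_keys_iff)
  have "Poly_Mapping.lookup (coeff (rees_act n p 1) (Poly_Mapping.lookup \<nu> e)) (x_exponent \<nu>)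
      = (\<Sum>\<mu>\<in>Poly_Mapping.keys p. if \<mu> = \<nu> then Poly_Mapping.lookup p \<nu> else 0)"
    unfolding rees_act_1[OF p] coeff_sum lookup_sum
  proof (rule sum.cong[OF refl])
    fix \<mu> assume "\<mu> \<in> Poly_Mapping.keys p"
    then have "\<mu> = \<nu>" if "x_exponent \<mu> = x_exponent \<nu>" "Poly_Mapping.lookup \<mu> e = Poly_Mapping.lookup \<nu> e"
      using p \<nu> that by (intro monomial_eqI) (auto simp: polys_def)
    then show "Poly_Mapping.lookup (coeff (monom (Poly_Mapping.single (x_exponent \<mu>) (Poly_Mapping.lookup p \<mu>))
        (Poly_Mapping.lookup \<mu> e)) (Poly_Mapping.lookup \<nu> e)) (x_exponent \<nu>)
        = (if \<mu> = \<nu> then Poly_Mapping.lookup p \<nu> else 0)"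
      by (auto simp: lookup_single when_def)
  qed
  also have "\<dots> = Poly_Mapping.lookup p \<nu>" using \<nu> by simp
  finally show False using assms(2) \<nu> by (simp add: in_keys_iff)
qed

lemma onto:
  fixes f :: "(nat, 'k::comm_ring_1) mpoly poly"
  assumes f: "f \<in> rees_piece n (edge_ideal n {e}) d"
  shows "f \<in> (\<lambda>p. rees_act n p 1) ` poly_piece vars d"
proof -
  interpret module "rees_act n :: (nat set, 'k) mpoly \<Rightarrow> _" by (rule module_rees)
  let ?im = "(\<lambda>p. rees_act n p 1 :: (nat, 'k) mpoly poly) ` poly_piece vars d"
  have im_0: "0 \<in> ?im" by (rule image_eqI[of _ _ 0]) simp_all
  have im_add: "g + h \<in> ?im" if "g \<in> ?im" "h \<in> ?im" for g h
    using that by (auto simp: scale_left_distrib[symmetric] intro: poly_piece_add)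
  have im_sum: "sum h A \<in> ?im" if "\<And>a. a \<in> A \<Longrightarrow> h a \<in> ?im"
    for A :: "'b set" and h :: "'b \<Rightarrow> (nat, 'k) mpoly poly"
    using that by (induction A rule: infinite_finite_induct) (simp_all add: im_0 im_add)
  have mono: "monom (Poly_Mapping.single \<nu> c) s \<in> ?im"
    if \<nu>: "\<nu> \<in> Poly_Mapping.keys (coeff f s)" for \<nu> c s
  proof -
    have ge: "\<forall>i\<in>e. s \<le> Poly_Mapping.lookup \<nu> i"
      by (rule ideal_power_keys[OF graph, of "\<lambda>s \<mu>. \<forall>i\<in>e. s \<le> Poly_Mapping.lookup \<mu> i"])
        (use f \<nu> edge_props(2)[OF graph] in \<open>auto simp: rees_piece_def rees_algebra_def lookup_add
          lookup_set_monomial trans_le_add1\<close>)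
    have keys_\<nu>: "Poly_Mapping.keys \<nu> \<subseteq> {1..n}" and deg: "int (mdeg \<nu>) = d + int s"
      using f \<nu> by (auto simp: rees_piece_def poly_piece_iff in_keys_iff)
    \<comment> \<open>the unique preimage of \<open>\<nu> T\<^sup>s\<close>: \<open>s\<close> copies of the edge, and vertex variables for the rest\<close>
    define r where "r i = Poly_Mapping.lookup \<nu> i - (if i \<in> e then s else 0)" for i
    define \<mu> where "\<mu> = Poly_Mapping.single e s + (\<Sum>i\<in>{1..n}. Poly_Mapping.single {i, n + 1} (r i))"
    have l_e: "Poly_Mapping.lookup \<mu> e = s"
      using e_not_vertex[symmetric] by (simp add: \<mu>_def lookup_add lookup_sum lookup_single when_def)
    have l_v: "Poly_Mapping.lookup \<mu> {i, n + 1} = r i" if "i \<in> {1..n}" for i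
    proof -
      have "(\<Sum>l\<in>{1..n}. Poly_Mapping.lookup (Poly_Mapping.single {l, n + 1} (r l)) {i, n + 1})
          = (\<Sum>l\<in>{1..n}. if l = i then r l else 0)"
        using that by (intro sum.cong) (auto simp: lookup_single when_def doubleton_eq_iff)
      then show ?thesis
        using that e_not_vertex[of i] by (simp add: \<mu>_def lookup_add lookup_sum lookup_single when_def)
    qed
    have keys_\<mu>: "Poly_Mapping.keys \<mu> \<subseteq> vars"
    proof (rule ccontr)
      assume "\<not> ?thesis"
      then obtain x where x: "Poly_Mapping.lookup \<mu> x \<noteq> 0" "x \<notin> vars" by (auto simp: in_keys_iff)
      then show False
        unfolding vars_eq by (auto simp: \<mu>_def lookup_add lookup_sum lookup_single when_def split: if_splits)
    qed
    have x_exp: "x_exponent \<mu> = \<nu>"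
    proof (rule poly_mapping_eqI)
      fix i
      have "i \<in> e \<Longrightarrow> i \<in> {1..n}" using edge_props(1)[OF graph, of e] by auto
      moreover have "i \<notin> {1..n} \<Longrightarrow> Poly_Mapping.lookup \<nu> i = 0"
        using keys_\<nu> by (auto simp: in_keys_iff)
      ultimately show "Poly_Mapping.lookup (x_exponent \<mu>) i = Poly_Mapping.lookup \<nu> i"
        using ge l_v[of i] unfolding lookup_x_exponent l_e by (auto simp: r_def)
    qed
    have "int (mdeg \<mu>) = d"
    proof -
      have "mdeg \<mu> = (\<Sum>x\<in>vars. Poly_Mapping.lookup \<mu> x)"
        by (rule mdeg_superset) (use keys_\<mu> in \<open>auto simp: vars_eq\<close>)
      also have "\<dots> = s + (\<Sum>i\<in>{1..n}. r i)"
        unfolding sum_vars l_e using l_v by simp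
      finally have 1: "mdeg \<mu> = s + (\<Sum>i\<in>{1..n}. r i)" .
      have "(\<Sum>i\<in>{1..n}. if i \<in> e then s else 0) = (\<Sum>i\<in>{1..n} \<inter> e. s)"
        by (subst sum.inter_restrict) simp_all
      also have "{1..n} \<inter> e = e" using edge_props(1)[OF graph, of e] by blast
      finally have 2: "(\<Sum>i\<in>{1..n}. if i \<in> e then s else 0) = 2 * s"
        using edge_props(3)[OF graph, of e] by simp
      have "mdeg \<nu> = (\<Sum>i\<in>{1..n}. Poly_Mapping.lookup \<nu> i)"
        by (rule mdeg_superset) (use keys_\<nu> in auto)
      also have "\<dots> = (\<Sum>i\<in>{1..n}. r i + (if i \<in> e then s else 0))"
        by (rule sum.cong) (use ge in \<open>auto simp: r_def\<close>)
      also have "\<dots> = (\<Sum>i\<in>{1..n}. r i) + 2 * s"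
        unfolding sum.distrib 2 ..
      finally show ?thesis using 1 deg by simp
    qed
    then have "Poly_Mapping.single \<mu> c \<in> poly_piece vars d"
      using keys_\<mu> by (intro poly_piece_single)
    moreover have "rees_act n (Poly_Mapping.single \<mu> c) 1 = monom (Poly_Mapping.single \<nu> c) s"
      using keys_\<mu> by (subst rees_act_1) (auto simp: polys_single x_exp l_e)
    ultimately show ?thesis by (intro image_eqI[OF sym])
  qed
  have "monom (coeff f s) s \<in> ?im" for s
  proof -
    have "monom (coeff f s) s = (\<Sum>\<nu>\<in>Poly_Mapping.keys (coeff f s).
        monom (Poly_Mapping.single \<nu> (Poly_Mapping.lookup (coeff f s) \<nu>)) s)"
      unfolding monom_sum_right[symmetric] by (simp flip: poly_mapping_sum_single)
    also have "\<dots> \<in> ?im" by (rule im_sum) (rule mono)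
    finally show ?thesis .
  qed
  then have "(\<Sum>s\<le>degree f. monom (coeff f s) s) \<in> ?im" by (intro im_sum)
  then show ?thesis by (simp add: poly_as_sum_of_monoms)
qed

theorem regularity_eq_0:
  "regularity vars (rees_act n :: (nat set, 'k::field) mpoly \<Rightarrow> _) (rees_piece n (edge_ideal n {e})) = 0"
proof (rule regularity_free_module[where g = 1])
  show "graded_action (rees_act n :: (nat set, 'k) mpoly \<Rightarrow> _) vars (rees_piece n (edge_ideal n {e}))"
    by (rule graded_action_rees[OF graph])
  show "finite vars" by (simp add: vars_eq)
  show "1 \<in> rees_piece n (edge_ideal n {e} :: (nat, 'k) mpoly set) 0"
  proof -
    have "coeff (1 :: (nat, 'k) mpoly poly) s \<in> ideal_power (polys {1..n}) (edge_ideal n {e}) s" for s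
      by (cases s) (simp_all add: polys_1 ideal_generated_0)
    then show ?thesis
      by (auto simp: rees_piece_def rees_algebra_def poly_piece_one of_bool_def)
  qed
  show "p = 0" if "p \<in> poly_piece vars d" "rees_act n p 1 = 0" for p :: "(nat set, 'k) mpoly" and d
  proof (rule free)
    show "p \<in> polys vars" using that(1) by (simp add: poly_piece_def)
  qed (rule that(2))
qed (use rees_piece_finite_dimensional[OF graph] onto in blast)+

end

section \<open>Rees algebras of disjoint edges\<close>

theorem proposition1p5:
  fixes m :: nat and E :: "nat set set" and I :: "(nat, 'k::field) mpoly set"
  assumes "m \<ge> 1"
    and "simple_graph (2 * m) E" and "card E = m" and "pairwise disjnt E"
    and "I = edge_ideal (2 * m) E"
  shows "(m = 1 \<longrightarrow>
            regularity (cone_edges (2 * m) E) (rees_act (2 * m)) (rees_piece (2 * m) I) = 0) \<and>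
         (m > 1 \<longrightarrow>
            regularity (cone_edges (2 * m) E) (rees_act (2 * m)) (rees_piece (2 * m) I)
              \<ge> ereal (real m))"
proof (intro conjI impI)
  assume "m = 1"
  then obtain e where E: "E = {e}"
    using assms(3) card_1_singletonE by metis
  interpret single_edge "2 * m" e
    using assms(2) E by unfold_locales simp_all
  show "regularity (cone_edges (2 * m) E) (rees_act (2 * m)) (rees_piece (2 * m) I) = 0"
    using regularity_eq_0 assms(5) E by simp
next
  assume "m > 1"
  interpret matching "2 * m" E
    using assms(2,4) by unfold_locales
  show "regularity (cone_edges (2 * m) E) (rees_act (2 * m)) (rees_piece (2 * m) I) \<ge> ereal (real m)"
    using regularity_ge_card \<open>m > 1\<close> assms(3,5) by simp
qed

end
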